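(* Let $\alpha\in(0,1)$ and $\beta\in[1-\frac1\alpha,\infty)$. Then $\Lambda_{\alpha,\beta}:L^2(\mathbf{e})\to L^2(\mathbf{e}_{\alpha,\beta})$ is a one-to-one bounded Markov operator with dense range, i.e. $\overline{\mathrm{Ran}}(\Lambda_{\alpha,\beta})=L^2(\mathbf{e}_{\alpha,\beta})$. Moreover, for any $t\ge 0$, the intertwining relation $$P_t\,\Lambda_{\alpha,\beta}=\Lambda_{\alpha,\beta}\,Q_t$$ holds on $L^2(\mathbf{e})$.
   Context: $\mathbf{e}(x)=e^{-x}$ and $\mathbf{e}_{\alpha,\beta}(x)=\frac{x^{\beta+\frac1\alpha-1}e^{-x^{1/\alpha}}}{\alpha\,\Gamma(\alpha\beta+1)}$, $x>0$; $L^2(w)$ is the weighted Hilbert space on $(0,\infty)$ with $\|f\|_w^2=\int_0^\infty f^2(x)w(x)\,dx$. A linear operator $\Lambda_\lambda$ is a Markov operator if for any bounded Borel $f$ on $[0,\infty)$, $\Lambda_\lambda f(x)=\int_0^\infty f(xy)\lambda(y)\,dy$, where $\lambda\ge0$ is the density of a probability measure on $(0,\infty)$. $\Lambda_{\alpha,\beta}=\Lambda_{\lambda_{\alpha,\beta}}$, where $\lambda_{\alpha,\beta}$ is the entire function $$\lambda_{\alpha,\beta}(z)=\frac{\Gamma(\alpha\beta+1)}{\pi}\sum_{k=0}^\infty(-1)^k\,\Gamma(\alpha k+\alpha(1-\beta))\sin\big(\alpha(k+1-\beta)\pi\big)\frac{z^k}{k!},$$ with $\frac1\pi\Gamma(w)\sin(\pi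 w)$ read as $1/\Gamma(1-w)$. $(Q_t)_{t\ge0}$ is the Laguerre semigroup of order $0$: the self-adjoint contraction semigroup on $L^2(\mathbf{e})$ generated by $f\mapsto xf''(x)+(1-x)f'(x)$. $(P_t)_{t\ge0}$ is the Gauss-Laguerre semigroup: the contraction Markov semigroup on $L^2(\mathbf{e}_{\alpha,\beta})$ whose generator has the polynomials as a core, on which it acts as $$\mathbf{L}_{\alpha,\beta}f(x)=(d_{\alpha,\beta}-x)f'(x)+\frac{\sin(\alpha\pi)}{\pi}\,x\int_0^1 f''(xy)\,g_{\alpha,\beta}(y)\,dy,$$ with $d_{\alpha,\beta}=\frac{\Gamma(\alpha\beta+\alpha+1)}{\Gamma(\alpha\beta+1)}$ and $g_{\alpha,\beta}(y)=\frac{\Gamma(\alpha)}{\beta+\frac1\alpha+1}y^{\beta+\frac1\alpha+1}{}_2F_1(\alpha(\beta+1)+1,\alpha+1;\alpha(\beta+1)+2;y^{1/\alpha})$. *)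

theory Defs
  imports "HOL-Probability.Probability"
begin

section \<open>Weighted Hilbert spaces on the positive half-line\<close>

text \<open>
  Elements of \<open>L\<^sup>2(w)\<close> are represented by measurable functions; equality in \<open>L\<^sup>2(w)\<close> is equality
  almost everywhere with respect to \<open>w(x) dx\<close> on \<open>(0,\<infinity>)\<close>, and the values of a representative
  outside \<open>(0,\<infinity>)\<close> are irrelevant.
\<close>

definition weighted :: "(real \<Rightarrow> real) \<Rightarrow> real measure" where
  "weighted w = density (restrict_space lborel {0<..}) (\<lambda>x. ennreal (w x))"

definition L2 :: "(real \<Rightarrow> real) \<Rightarrow> (real \<Rightarrow> real) set" where
  "L2 w = {f \<in> borel_measurable (weighted w). integrable (weighted w) (\<lambda>x. (f x)\<^sup>2)}"

definition L2_norm :: "(real \<Rightarrow> real) \<Rightarrow> (real \<Rightarrow> real) \<Rightarrow> real" where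
  "L2_norm w f = sqrt (\<integral>x. (f x)\<^sup>2 \<partial>weighted w)"

definition L2_inner :: "(real \<Rightarrow> real) \<Rightarrow> (real \<Rightarrow> real) \<Rightarrow> (real \<Rightarrow> real) \<Rightarrow> real" where
  "L2_inner w f g = (\<integral>x. f x * g x \<partial>weighted w)"

definition L2_eq :: "(real \<Rightarrow> real) \<Rightarrow> (real \<Rightarrow> real) \<Rightarrow> (real \<Rightarrow> real) \<Rightarrow> bool" where
  "L2_eq w f g \<longleftrightarrow> (AE x in weighted w. f x = g x)"

definition L2_closure :: "(real \<Rightarrow> real) \<Rightarrow> (real \<Rightarrow> real) set \<Rightarrow> (real \<Rightarrow> real) set" where
  "L2_closure w A = {g \<in> L2 w. \<forall>\<epsilon>>0. \<exists>h\<in>A. L2_norm w (\<lambda>x. g x - h x) < \<epsilon>}"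

text \<open>
  Linearity together with boundedness makes such a \<open>T\<close> respect almost everywhere equality, so that
  it acts on the equivalence classes.
\<close>

definition bounded_L2_operator ::
    "(real \<Rightarrow> real) \<Rightarrow> (real \<Rightarrow> real) \<Rightarrow> ((real \<Rightarrow> real) \<Rightarrow> real \<Rightarrow> real) \<Rightarrow> bool" where
  "bounded_L2_operator v w T \<longleftrightarrow>
     (\<forall>f\<in>L2 v. T f \<in> L2 w) \<and>
     (\<forall>f\<in>L2 v. \<forall>g\<in>L2 v. \<forall>a b.
        L2_eq w (T (\<lambda>x. a * f x + b * g x)) (\<lambda>x. a * T f x + b * T g x)) \<and>
     (\<exists>C. \<forall>f\<in>L2 v. L2_norm w (T f) \<le> C * L2_norm v f)"

definition L2_one_to_one ::
    "(real \<Rightarrow> real) \<Rightarrow> (real \<Rightarrow> real) \<Rightarrow> ((real \<Rightarrow> real) \<Rightarrow> real \<Rightarrow> real) \<Rightarrow> bool" where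
  "L2_one_to_one v w T \<longleftrightarrow> (\<forall>f\<in>L2 v. \<forall>g\<in>L2 v. L2_eq w (T f) (T g) \<longrightarrow> L2_eq v f g)"

section \<open>Semigroups and generators\<close>

definition contraction_semigroup ::
    "(real \<Rightarrow> real) \<Rightarrow> (real \<Rightarrow> (real \<Rightarrow> real) \<Rightarrow> real \<Rightarrow> real) \<Rightarrow> bool" where
  "contraction_semigroup w P \<longleftrightarrow>
     (\<forall>t\<ge>0. bounded_L2_operator w w (P t)) \<and>
     (\<forall>t\<ge>0. \<forall>f\<in>L2 w. L2_norm w (P t f) \<le> L2_norm w f) \<and>
     (\<forall>f\<in>L2 w. L2_eq w (P 0 f) f) \<and>
     (\<forall>s\<ge>0. \<forall>t\<ge>0. \<forall>f\<in>L2 w. L2_eq w (P (s + t) f) (P s (P t f))) \<and>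
     (\<forall>f\<in>L2 w. ((\<lambda>t. L2_norm w (\<lambda>x. P t f x - f x)) \<longlongrightarrow> 0) (at_right 0))"

definition self_adjoint_semigroup ::
    "(real \<Rightarrow> real) \<Rightarrow> (real \<Rightarrow> (real \<Rightarrow> real) \<Rightarrow> real \<Rightarrow> real) \<Rightarrow> bool" where
  "self_adjoint_semigroup w P \<longleftrightarrow>
     (\<forall>t\<ge>0. \<forall>f\<in>L2 w. \<forall>g\<in>L2 w. L2_inner w (P t f) g = L2_inner w f (P t g))"

definition markov_semigroup ::
    "(real \<Rightarrow> real) \<Rightarrow> (real \<Rightarrow> (real \<Rightarrow> real) \<Rightarrow> real \<Rightarrow> real) \<Rightarrow> bool" where
  "markov_semigroup w P \<longleftrightarrow>
     (\<forall>t\<ge>0. \<forall>f\<in>L2 w. (AE x in weighted w. 0 \<le> f x) \<longrightarrow> (AE x in weighted w. 0 \<le> P t f x)) \<and>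
     (\<forall>t\<ge>0. L2_eq w (P t (\<lambda>_. 1)) (\<lambda>_. 1))"

text \<open>
  The generator as a graph: \<open>L2_generator w P f h\<close> says that \<open>f\<close> is in the domain of the generator
  of \<open>P\<close> and is mapped to \<open>h\<close>.
\<close>

definition L2_generator :: "(real \<Rightarrow> real) \<Rightarrow> (real \<Rightarrow> (real \<Rightarrow> real) \<Rightarrow> real \<Rightarrow> real) \<Rightarrow>
    (real \<Rightarrow> real) \<Rightarrow> (real \<Rightarrow> real) \<Rightarrow> bool" where
  "L2_generator w P f h \<longleftrightarrow> f \<in> L2 w \<and> h \<in> L2 w \<and>
     ((\<lambda>t. L2_norm w (\<lambda>x. (P t f x - f x) / t - h x)) \<longlongrightarrow> 0) (at_right 0)"

text \<open>A core is a subset of the domain that is dense in it for the graph norm.\<close>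

definition generator_core :: "(real \<Rightarrow> real) \<Rightarrow> (real \<Rightarrow> (real \<Rightarrow> real) \<Rightarrow> real \<Rightarrow> real) \<Rightarrow>
    (real \<Rightarrow> real) set \<Rightarrow> bool" where
  "generator_core w P D \<longleftrightarrow>
     (\<forall>f\<in>D. \<exists>h. L2_generator w P f h) \<and>
     (\<forall>f h. L2_generator w P f h \<longrightarrow>
        (\<forall>\<epsilon>>0. \<exists>g\<in>D. \<exists>k. L2_generator w P g k \<and>
           L2_norm w (\<lambda>x. f x - g x) < \<epsilon> \<and> L2_norm w (\<lambda>x. h x - k x) < \<epsilon>))"

definition polynomial_functions :: "(real \<Rightarrow> real) set" where
  "polynomial_functions = range poly"

definition generated_on_polynomials :: "(real \<Rightarrow> real) \<Rightarrow>
    (real \<Rightarrow> (real \<Rightarrow> real) \<Rightarrow> real \<Rightarrow> real) \<Rightarrow> ((real \<Rightarrow> real) \<Rightarrow> real \<Rightarrow> real) \<Rightarrow> bool" where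
  "generated_on_polynomials w P L \<longleftrightarrow>
     generator_core w P polynomial_functions \<and>
     (\<forall>f\<in>polynomial_functions. L2_generator w P f (L f))"

section \<open>The Laguerre semigroup of order 0\<close>

definition laguerre_weight :: "real \<Rightarrow> real" where
  "laguerre_weight x = exp (- x)"

definition laguerre_operator :: "(real \<Rightarrow> real) \<Rightarrow> real \<Rightarrow> real" where
  "laguerre_operator f x = x * deriv (deriv f) x + (1 - x) * deriv f x"

text \<open>
  On its own the differential expression does not determine a self-adjoint operator, since \<open>0\<close> is
  a limit-circle endpoint; the Laguerre semigroup is the one for which the polynomials form a core.
\<close>

definition laguerre_semigroup :: "(real \<Rightarrow> (real \<Rightarrow> real) \<Rightarrow> real \<Rightarrow> real) \<Rightarrow> bool" where
  "laguerre_semigroup Q \<longleftrightarrow>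
     contraction_semigroup laguerre_weight Q \<and>
     self_adjoint_semigroup laguerre_weight Q \<and>
     generated_on_polynomials laguerre_weight Q laguerre_operator"

section \<open>The Gauss-Laguerre semigroup\<close>

definition gauss_laguerre_weight :: "real \<Rightarrow> real \<Rightarrow> real \<Rightarrow> real" where
  "gauss_laguerre_weight \<alpha> \<beta> x =
     x powr (\<beta> + 1 / \<alpha> - 1) * exp (- (x powr (1 / \<alpha>))) / (\<alpha> * Gamma (\<alpha> * \<beta> + 1))"

definition gauss_laguerre_drift :: "real \<Rightarrow> real \<Rightarrow> real" where
  "gauss_laguerre_drift \<alpha> \<beta> = Gamma (\<alpha> * \<beta> + \<alpha> + 1) / Gamma (\<alpha> * \<beta> + 1)"

definition hypergeometric_2F1 :: "real \<Rightarrow> real \<Rightarrow> real \<Rightarrow> real \<Rightarrow> real" where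
  "hypergeometric_2F1 a b c z = eval_fps (fps_hypergeo [a, b] [c] 1) z"

definition gauss_laguerre_kernel :: "real \<Rightarrow> real \<Rightarrow> real \<Rightarrow> real" where
  "gauss_laguerre_kernel \<alpha> \<beta> y =
     Gamma \<alpha> / (\<beta> + 1 / \<alpha> + 1) * y powr (\<beta> + 1 / \<alpha> + 1) *
     hypergeometric_2F1 (\<alpha> * (\<beta> + 1) + 1) (\<alpha> + 1) (\<alpha> * (\<beta> + 1) + 2) (y powr (1 / \<alpha>))"

definition gauss_laguerre_operator :: "real \<Rightarrow> real \<Rightarrow> (real \<Rightarrow> real) \<Rightarrow> real \<Rightarrow> real" where
  "gauss_laguerre_operator \<alpha> \<beta> f x =
     (gauss_laguerre_drift \<alpha> \<beta> - x) * deriv f x +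
     sin (\<alpha> * pi) / pi * x *
       (LINT y:{0<..<1}|lborel. deriv (deriv f) (x * y) * gauss_laguerre_kernel \<alpha> \<beta> y)"

definition gauss_laguerre_semigroup ::
    "real \<Rightarrow> real \<Rightarrow> (real \<Rightarrow> (real \<Rightarrow> real) \<Rightarrow> real \<Rightarrow> real) \<Rightarrow> bool" where
  "gauss_laguerre_semigroup \<alpha> \<beta> P \<longleftrightarrow>
     contraction_semigroup (gauss_laguerre_weight \<alpha> \<beta>) P \<and>
     markov_semigroup (gauss_laguerre_weight \<alpha> \<beta>) P \<and>
     generated_on_polynomials (gauss_laguerre_weight \<alpha> \<beta>) P (gauss_laguerre_operator \<alpha> \<beta>)"

section \<open>Multiplicative Markov operators\<close>

definition mult_operator :: "(real \<Rightarrow> real) \<Rightarrow> (real \<Rightarrow> real) \<Rightarrow> real \<Rightarrow> real" where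
  "mult_operator \<rho> f x = (LINT y:{0<..}|lborel. f (x * y) * \<rho> y)"

definition markov_operator :: "(real \<Rightarrow> real) \<Rightarrow> ((real \<Rightarrow> real) \<Rightarrow> real \<Rightarrow> real) \<Rightarrow> bool" where
  "markov_operator \<rho> T \<longleftrightarrow>
     \<rho> \<in> borel_measurable (restrict_space borel {0<..}) \<and>
     (\<forall>y>0. 0 \<le> \<rho> y) \<and>
     prob_space (weighted \<rho>) \<and>
     (\<forall>f\<in>borel_measurable (restrict_space borel {0..}). bounded (f ` {0..}) \<longrightarrow>
        (\<forall>x\<ge>0. T f x = mult_operator \<rho> f x))"

text \<open>
  The coefficient \<open>\<Gamma>(u) sin(\<pi>u)/\<pi>\<close>, with \<open>u = \<alpha>k + \<alpha>(1 - \<beta>)\<close>, equals \<open>1/\<Gamma>(1 - u)\<close> by reflection; the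
  latter form is also meaningful at the poles of \<open>\<Gamma>\<close>. The definition covers the entire function on the
  complex plane and its restriction to the real line.
\<close>

definition gauss_laguerre_lambda ::
    "real \<Rightarrow> real \<Rightarrow> 'a::{banach, real_normed_field} \<Rightarrow> 'a" where
  "gauss_laguerre_lambda \<alpha> \<beta> z =
     of_real (Gamma (\<alpha> * \<beta> + 1)) *
     (\<Sum>k. (- 1) ^ k * of_real (rGamma (1 - (\<alpha> * real k + \<alpha> * (1 - \<beta>)))) * z ^ k / fact k)"

definition gauss_laguerre_Lambda :: "real \<Rightarrow> real \<Rightarrow> (real \<Rightarrow> real) \<Rightarrow> real \<Rightarrow> real" where
  "gauss_laguerre_Lambda \<alpha> \<beta> = mult_operator (gauss_laguerre_lambda \<alpha> \<beta>)"

end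

theory Submission
  imports Defs "HOL-Complex_Analysis.Complex_Analysis"
begin

text \<open>
  Let \<open>Y\<close> have the invariant density of the Gauss-Laguerre semigroup and let \<open>I\<close> be independent of \<open>Y\<close>
  with density \<open>\<lambda>\<close>. The theorem rests on two facts: \<open>\<lambda>\<close> is nonnegative, and \<open>Y * I\<close> has the standard
  exponential law. The operator is \<open>\<Lambda>f(x) = E f(x * I)\<close>, so Jensen's inequality and the factorisation
  make it a contraction, and comparing moments gives \<open>E I\<^sup>n\<close>; the case \<open>n = 0\<close> says that \<open>\<lambda>\<close> is a
  probability density.

  \<^emph>\<open>Factorisation.\<close> Put \<open>b = \<alpha>\<beta> + 1\<close> and \<open>\<delta> = b - \<alpha>\<close>; the hypothesis on \<open>\<beta>\<close> says \<open>\<delta> \<ge> 0\<close>. The substitution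
  \<open>x = u t\<^sup>\<alpha>\<close> in the density of \<open>Y * I\<close> at \<open>u\<close> (lemma \<open>product_density\<close>) reduces the claim to the Laplace
  transform \<open>\<integral> exp(-st) t\<^sup>\<delta>\<^sup>-\<^sup>1 \<lambda>(t\<^sup>-\<^sup>\<alpha>) dt = \<Gamma>(b) s\<^sup>-\<^sup>\<delta> exp(-s\<^sup>\<alpha>)\<close>. To compute it, \<open>t\<^sup>\<delta>\<^sup>-\<^sup>1 \<lambda>(t\<^sup>-\<^sup>\<alpha>)\<close> is written as
  the Bromwich integral of \<open>\<Gamma>(b) z\<^sup>-\<^sup>\<delta> exp(-z\<^sup>\<alpha>)\<close> along a ray whose angle \<open>\<theta>\<close> satisfies
  \<open>\<pi>/2 < \<theta> < \<pi>/(2\<alpha>)\<close>. On such a ray both \<open>exp(tz)\<close> and \<open>exp(-z\<^sup>\<alpha>)\<close> decay. Hence the exponential series may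
  be integrated term by term with Hankel's formula, which produces the power series of \<open>\<lambda>\<close>
  (\<open>wright_series\<close>), while Fubini and Cauchy's formula give the Laplace transform
  (\<open>laplace_ray_transform\<close>). The ray starts at a point \<open>c > 0\<close>, away from the singularity of \<open>z\<^sup>-\<^sup>\<delta>\<close>, so
  that all \<open>\<delta> \<ge> 0\<close> are treated alike.

  \<^emph>\<open>Positivity.\<close> The function \<open>s\<^sup>-\<^sup>\<delta> exp(-s\<^sup>\<alpha>)\<close> is completely monotone. Its alternating differences are
  therefore nonnegative, and they are the integrals of \<open>t\<^sup>\<delta>\<^sup>-\<^sup>1 \<lambda>(t\<^sup>-\<^sup>\<alpha>)\<close> against Bernstein polynomials in
  \<open>exp(-t)\<close>; Bernstein approximation gives \<open>\<lambda> \<ge> 0\<close> (\<open>completely_monotone_laplace_nonneg\<close>).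

  \<^emph>\<open>Injectivity and dense range.\<close> If \<open>\<Lambda>f = 0\<close>, integrating against the invariant density dilated by
  \<open>a \<ge> 1\<close>, and using the factorisation again, gives \<open>\<integral> f(u) exp(-au) du = 0\<close> (\<open>Lam_eq_0_imp\<close>). The
  exponentials span a dense subspace (\<open>all_limits\<close>), so \<open>f = 0\<close>. The range contains all polynomials because no
  moment of \<open>I\<close> vanishes, and polynomials are dense for any law with an exponential moment
  (\<open>polynomials_dense\<close>); the law of \<open>Y\<close> inherits such a moment from \<open>Y * I\<close>.

  \<^emph>\<open>Intertwining.\<close> On monomials both generators are weighted shifts. The Laguerre generator maps
  \<open>x\<^sup>n\<close> to \<open>n\<^sup>2 x\<^sup>n\<^sup>-\<^sup>1 - n x\<^sup>n\<close>, the other one maps it to \<open>n \<phi>(n) x\<^sup>n\<^sup>-\<^sup>1 - n x\<^sup>n\<close> with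
  \<open>\<phi>(n) = \<Gamma>(\<alpha>n + b) / \<Gamma>(\<alpha>n + b - \<alpha>)\<close>, by a Beta integral for the moments of the hypergeometric kernel
  (\<open>kernel_moment\<close>). Since \<open>E I\<^sup>n \<phi>(n) = n E I\<^sup>n\<^sup>-\<^sup>1\<close>, the operator \<open>\<Lambda>\<close> intertwines the generators on
  polynomials, hence carries Laguerre polynomials to eigenvectors for the same eigenvalues. A contraction
  semigroup multiplies an eigenvector of its generator by an exponential (\<open>semigroup_eigenvector\<close>), so
  \<open>P\<^sub>t \<Lambda> = \<Lambda> Q\<^sub>t\<close> on polynomials, and on \<open>L\<^sup>2\<close> by density.
\<close>

section \<open>Rays in the slit plane and Cauchy's theorem\<close>

definition ray :: "real \<Rightarrow> real \<Rightarrow> real \<Rightarrow> complex" where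
  "ray c \<theta> r = of_real c + of_real r * cis \<theta>"

definition slit_plane :: "complex set" where
  "slit_plane = - \<real>\<^sub>\<le>\<^sub>0"

text \<open>The contour integral along the ray. By reflection in the real axis, its imaginary part, divided by \<open>pi\<close>, is the
  normalised integral over the full contour that comes in along the conjugate ray.\<close>

definition ray_integral :: "real \<Rightarrow> real \<Rightarrow> (complex \<Rightarrow> complex) \<Rightarrow> complex" where
  "ray_integral c \<theta> F = (LINT r:{0..}|lborel. F (ray c \<theta> r) * cis \<theta>)"

definition ray_integrable :: "real \<Rightarrow> real \<Rightarrow> (complex \<Rightarrow> complex) \<Rightarrow> bool" where
  "ray_integrable c \<theta> F \<longleftrightarrow> set_integrable lborel {0..} (\<lambda>r. F (ray c \<theta> r))"

lemma Re_ray: "Re (ray c \<theta> r) = c + r * cos \<theta>"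
  and Im_ray: "Im (ray c \<theta> r) = r * sin \<theta>"
  by (simp_all add: ray_def)

lemma ray_0 [simp]: "ray c \<theta> 0 = of_real c"
  by (simp add: ray_def)

lemma ray_has_derivative: "((\<lambda>r. ray c \<theta> r) has_vector_derivative cis \<theta>) F"
  unfolding ray_def by (auto intro!: derivative_eq_intros simp: has_vector_derivative_def scaleR_conv_of_real)

lemma continuous_on_ray: "continuous_on S (ray c \<theta>)"
  unfolding ray_def by (intro continuous_intros)

lemma open_slit_plane: "open slit_plane"
  unfolding slit_plane_def by (simp add: open_Compl closed_nonpos_Reals_complex)

lemma slit_plane_eq: "slit_plane = - (complex_of_real ` {..0})"
  by (auto simp: slit_plane_def nonpos_Reals_def)

lemma slit_plane_iff: "z \<in> slit_plane \<longleftrightarrow> Im z \<noteq> 0 \<or> Re z > 0"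
  by (auto simp: slit_plane_def complex_nonpos_Reals_iff)

lemma ray_in_slit_plane: "0 < c \<Longrightarrow> 0 < \<theta> \<Longrightarrow> \<theta> < pi \<Longrightarrow> ray c \<theta> r \<in> slit_plane"
  using sin_gt_zero[of \<theta>] by (cases "r = 0") (auto simp: slit_plane_iff Im_ray Re_ray)

text \<open>The slit plane is starlike, so every holomorphic function on it has a primitive.\<close>

lemma slit_plane_primitive:
  assumes "H holomorphic_on slit_plane" and real: "\<And>x. x > 0 \<Longrightarrow> Im (H (of_real x)) = 0"
  obtains A where "\<And>z. z \<in> slit_plane \<Longrightarrow> (A has_field_derivative H z) (at z)"
    and "\<And>x. x > 0 \<Longrightarrow> Im (A (of_real x)) = 0"
proof -
  have "\<exists>A. \<forall>z\<in>slit_plane. (A has_field_derivative H z) (at z)"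
    using assms(1) open_slit_plane starlike_slotted_complex_plane_left[of 0]
    by (intro holomorphic_starlike_primitive[where k = "{}"])
      (auto simp: slit_plane_eq holomorphic_on_imp_continuous_on holomorphic_on_imp_differentiable_at)
  then obtain A0 where A0: "\<And>z. z \<in> slit_plane \<Longrightarrow> (A0 has_field_derivative H z) (at z)"
    by blast
  define A where "A z = A0 z - A0 1" for z
  have A: "(A has_field_derivative H z) (at z)" if "z \<in> slit_plane" for z
    unfolding A_def using A0[OF that] by (auto intro!: derivative_eq_intros)
  have der: "((\<lambda>x. Im (A (of_real x))) has_field_derivative 0) (at x)" if "x > 0" for x :: real
  proof -
    have "(A has_field_derivative H (of_real x)) (at (of_real x))"
      by (rule A) (use that in \<open>auto simp: slit_plane_iff\<close>)
    from has_vector_derivative_real_field[OF this]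
    have "((\<lambda>x. A (of_real x)) has_vector_derivative H (of_real x)) (at x)" .
    then have "((\<lambda>x. Im (A (of_real x))) has_vector_derivative Im (H (of_real x))) (at x)"
      by (rule bounded_linear.has_vector_derivative[OF bounded_linear_Im])
    then show ?thesis using real[OF that] by (simp add: has_real_derivative_iff_has_vector_derivative)
  qed
  have "Im (A (of_real x)) = 0" if "x > 0" for x :: real
  proof -
    have "\<exists>k. \<forall>x\<in>{0<..}. Im (A (of_real x)) = k"
      by (rule has_field_derivative_zero_constant)
         (use der in \<open>auto intro: has_field_derivative_at_within\<close>)
    then obtain k where "\<forall>x\<in>{0<..}. Im (A (of_real x)) = k" by blast
    from bspec[OF this, of x] bspec[OF this, of 1] that have "Im (A (of_real x)) = Im (A 1)" by simp
    then show ?thesis by (simp add: A_def)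
  qed
  with A show ?thesis using that by blast
qed

text \<open>The ray stays below its parallel through the origin: the cross product of \<open>cis \<theta>\<close> with a point of the
  ray is \<open>c * sin \<theta> > 0\<close>.\<close>

lemma Arg_ray_bounds:
  assumes "0 < c" "0 < \<theta>" "\<theta> < pi" "0 \<le> r"
  shows "0 \<le> Arg (ray c \<theta> r)" "Arg (ray c \<theta> r) \<le> \<theta>"
proof -
  define z where "z = ray c \<theta> r"
  have s: "sin \<theta> > 0" using assms sin_gt_zero by simp
  show 0: "0 \<le> Arg (ray c \<theta> r)"
    using assms s by (simp add: Arg_less_0 Im_ray)
  have z: "z = of_real (cmod z) * cis (Arg z)"
    by (metis rcis_cmod_Arg rcis_def)
  have "Im (cis \<theta> * cnj z) = c * sin \<theta>"
    unfolding z_def ray_def by (simp add: algebra_simps)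
  moreover have "Im (cis \<theta> * cnj z) = cmod z * sin (\<theta> - Arg z)"
    by (subst z) (simp add: sin_diff algebra_simps)
  ultimately have "cmod z * sin (\<theta> - Arg z) > 0" using s assms by (metis mult_pos_pos)
  then have "sin (\<theta> - Arg z) > 0" by (simp add: zero_less_mult_iff)
  moreover have "\<theta> - Arg z > - pi"
    using Arg_le_pi[of z] assms by simp
  ultimately have "\<theta> - Arg z > 0"
    using sin_ge_zero[of "-(\<theta> - Arg z)"] by (smt (verit) sin_minus)
  then show "Arg (ray c \<theta> r) \<le> \<theta>" by (simp add: z_def)
qed

lemma norm_ray_lower:
  assumes "0 < c" "0 < \<theta>" "\<theta> < pi"
  obtains k where "k > 0" "\<And>r. 0 \<le> r \<Longrightarrow> k * (1 + r) \<le> cmod (ray c \<theta> r)"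
proof -
  define q where "q = (1 + cos \<theta>) / 2"
  have q: "q > 0" using assms cos_monotone_0_pi[of \<theta> pi] by (simp add: q_def)
  have "sqrt q * (c + r) \<le> cmod (ray c \<theta> r)" if "0 \<le> r" for r
  proof -
    have "(cmod (ray c \<theta> r))\<^sup>2 = c\<^sup>2 + r\<^sup>2 + 2 * c * r * cos \<theta>"
    proof -
      have "(r * cos \<theta>)\<^sup>2 + (r * sin \<theta>)\<^sup>2 = r\<^sup>2 * ((cos \<theta>)\<^sup>2 + (sin \<theta>)\<^sup>2)"
        by (simp only: power_mult_distrib distrib_left)
      then have "(r * cos \<theta>)\<^sup>2 + (r * sin \<theta>)\<^sup>2 = r\<^sup>2" by simp
      moreover have "(cmod (ray c \<theta> r))\<^sup>2 = c\<^sup>2 + 2 * c * r * cos \<theta> + ((r * cos \<theta>)\<^sup>2 + (r * sin \<theta>)\<^sup>2)"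
        unfolding cmod_power2 Re_ray Im_ray
        by (simp add: power2_eq_square ring_distribs)
      ultimately show ?thesis by simp
    qed
    \<comment> \<open>diagonalising the quadratic form in \<open>c\<close> and \<open>r\<close>; both eigenvalues are positive for \<open>\<theta> < pi\<close>\<close>
    also have "\<dots> = q * (c + r)\<^sup>2 + (1 - cos \<theta>) / 2 * (c - r)\<^sup>2"
      by (simp add: q_def field_simps power2_eq_square)
    also have "\<dots> \<ge> q * (c + r)\<^sup>2" by simp
    finally have "(sqrt q * (c + r))\<^sup>2 \<le> (cmod (ray c \<theta> r))\<^sup>2"
      using q by (simp add: power_mult_distrib)
    then show ?thesis by (rule power2_le_imp_le) simp
  qed
  moreover have "sqrt q * min 1 c * (1 + r) \<le> sqrt q * (c + r)" if "0 \<le> r" for r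
  proof -
    have "min 1 c * (1 + r) \<le> c + r"
    proof (cases "c \<le> 1")
      case True
      then have "c * r \<le> 1 * r" using that by (intro mult_right_mono) auto
      then show ?thesis using True by (simp add: algebra_simps)
    qed auto
    then show ?thesis using q by (simp add: mult.assoc)
  qed
  ultimately show ?thesis
    using q assms that[of "sqrt q * min 1 c"] by (meson min_less_iff_conj mult_pos_pos order_trans real_sqrt_gt_zero zero_less_one)
qed

lemma norm_ray_upper:
  assumes "0 < c" "0 \<le> r"
  shows "cmod (ray c \<theta> r) \<le> (1 + c) * (1 + r)"
proof -
  have "cmod (ray c \<theta> r) \<le> c + r"
    unfolding ray_def using assms by (intro norm_triangle_le) (simp add: norm_mult)
  also have "\<dots> \<le> (1 + c) * (1 + r)" using assms by (simp add: algebra_simps)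
  finally show ?thesis .
qed

lemma norm_diff_ray_lower:
  assumes "c < s" "pi / 2 < \<theta>" "\<theta> < pi"
  obtains k where "k > 0" "\<And>r. 0 \<le> r \<Longrightarrow> k * (1 + r) \<le> s - Re (ray c \<theta> r)"
proof -
  have cos: "cos \<theta> < 0" using assms cos_monotone_0_pi[of "pi / 2" \<theta>] by simp
  define k where "k = min (s - c) (- cos \<theta>)"
  have "k * (1 + r) \<le> s - Re (ray c \<theta> r)" if "0 \<le> r" for r
  proof -
    have "k * r \<le> (- cos \<theta>) * r" using that by (intro mult_right_mono) (auto simp: k_def)
    moreover have "k \<le> s - c" by (simp add: k_def)
    ultimately show ?thesis by (simp add: Re_ray algebra_simps)
  qed
  moreover have "k > 0" using assms cos by (simp add: k_def)
  ultimately show ?thesis using that by blast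
qed

lemma filterlim_norm_ray:
  assumes "0 < c" "0 < \<theta>" "\<theta> < pi"
  shows "filterlim (\<lambda>r. cmod (ray c \<theta> r)) at_top at_top"
proof -
  obtain k where k: "k > 0" "\<And>r. 0 \<le> r \<Longrightarrow> k * (1 + r) \<le> cmod (ray c \<theta> r)"
    using norm_ray_lower[OF assms] by blast
  show ?thesis
  proof (rule filterlim_at_top_mono)
    show "filterlim (\<lambda>r. k * (1 + r)) at_top at_top"
      using k(1) by real_asymp
    show "\<forall>\<^sub>F r in at_top. k * (1 + r) \<le> cmod (ray c \<theta> r)"
      using eventually_ge_at_top[of 0] by eventually_elim (use k in auto)
  qed
qed

lemma ray_integral_FTC:
  assumes c: "0 < c" "0 < \<theta>" "\<theta> < pi" and "0 \<le> R"
    and A: "\<And>z. z \<in> slit_plane \<Longrightarrow> (A has_field_derivative H z) (at z)"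
    and H: "continuous_on slit_plane H"
  shows "(LINT r:{0..R}|lborel. H (ray c \<theta> r) * cis \<theta>) = A (ray c \<theta> R) - A (of_real c)"
proof -
  have "(LINT r:{0..R}|lborel. H (ray c \<theta> r) * cis \<theta>) = A (ray c \<theta> R) - A (ray c \<theta> 0)"
    unfolding set_lebesgue_integral_def
  proof (rule integral_FTC_atLeastAtMost)
    show "continuous_on {0..R} (\<lambda>r. H (ray c \<theta> r) * cis \<theta>)"
      by (intro continuous_intros continuous_on_compose2[OF H continuous_on_ray])
        (use ray_in_slit_plane[OF c] in auto)
    fix x assume "0 \<le> x" "x \<le> R"
    have "((\<lambda>r. A (ray c \<theta> r)) has_vector_derivative cis \<theta> * H (ray c \<theta> x)) (at x within {0..R})"
      using field_vector_diff_chain_within[OF ray_has_derivative has_field_derivative_at_within[OF A[OF ray_in_slit_plane[OF c]]]]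
      by (simp add: o_def)
    then show "((\<lambda>r. A (ray c \<theta> r)) has_vector_derivative H (ray c \<theta> x) * cis \<theta>) (at x within {0..R})"
      by (simp add: mult.commute)
  qed (use assms in auto)
  then show ?thesis by simp
qed

lemma ray_integral_limit:
  assumes "ray_integrable c \<theta> H"
  shows "((\<lambda>R. LINT r:{0..R}|lborel. H (ray c \<theta> r) * cis \<theta>) \<longlongrightarrow> ray_integral c \<theta> H) at_top"
  unfolding ray_integral_def
  by (rule tendsto_set_lebesgue_integral_at_top) (use assms in \<open>auto simp: ray_integrable_def\<close>)

text \<open>Cauchy's theorem for the contour formed by the ray, an arc at infinity and the positive axis: the
  integral over the axis is real, and the decay of \<open>z * H z\<close> makes the arc negligible.\<close>

lemma Im_ray_integral_eq_0:
  assumes c: "0 < c" "0 < \<theta>" "\<theta> < pi"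
    and hol: "H holomorphic_on slit_plane"
    and real: "\<And>x. x > 0 \<Longrightarrow> Im (H (of_real x)) = 0"
    and decay: "\<And>\<epsilon>. \<epsilon> > 0 \<Longrightarrow> \<exists>B. \<forall>z. cmod z > B \<longrightarrow> 0 \<le> Arg z \<longrightarrow> Arg z \<le> \<theta> \<longrightarrow> cmod (z * H z) \<le> \<epsilon>"
    and int: "ray_integrable c \<theta> H"
  shows "Im (ray_integral c \<theta> H) = 0"
proof -
  obtain A where A: "\<And>z. z \<in> slit_plane \<Longrightarrow> (A has_field_derivative H z) (at z)"
    and A_real: "\<And>x. x > 0 \<Longrightarrow> Im (A (of_real x)) = 0"
    using slit_plane_primitive[OF hol real] by blast
  have arc: "\<bar>Im (A z)\<bar> \<le> \<theta> * \<epsilon>"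
    if \<epsilon>: "\<epsilon> > 0" and z: "z \<noteq> 0" "0 \<le> Arg z" "Arg z \<le> \<theta>"
      and B: "\<And>w. cmod w = cmod z \<Longrightarrow> 0 \<le> Arg w \<Longrightarrow> Arg w \<le> \<theta> \<Longrightarrow> cmod (w * H w) \<le> \<epsilon>" for z \<epsilon>
  proof -
    define \<rho> where "\<rho> = cmod z"
    have \<rho>: "\<rho> > 0" using z by (simp add: \<rho>_def)
    define h where "h \<phi> = Im (A (rcis \<rho> \<phi>))" for \<phi>
    have der: "\<exists>D. (h has_field_derivative D) (at \<phi>) \<and> \<bar>D\<bar> \<le> \<epsilon>" if "0 \<le> \<phi>" "\<phi> \<le> \<theta>" for \<phi>
    proof -
      have Arg: "Arg (rcis \<rho> \<phi>) = \<phi>" using that \<rho> c by (intro Arg_rcis) auto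
      have in_slit: "rcis \<rho> \<phi> \<in> slit_plane"
        using that \<rho> c sin_gt_zero[of \<phi>] by (cases "\<phi> = 0") (auto simp: slit_plane_iff)
      have "((\<lambda>\<phi>. rcis \<rho> \<phi>) has_vector_derivative \<i> * rcis \<rho> \<phi>) (at \<phi>)"
        unfolding rcis_def cis_conv_exp
        by (rule has_vector_derivative_eq_rhs[OF has_vector_derivative_real_field])
           (auto intro!: derivative_eq_intros)
      from field_vector_diff_chain_at[OF this A[OF in_slit]]
      have "((\<lambda>\<phi>. A (rcis \<rho> \<phi>)) has_vector_derivative \<i> * rcis \<rho> \<phi> * H (rcis \<rho> \<phi>)) (at \<phi>)"
        by (simp add: o_def)
      from bounded_linear.has_vector_derivative[OF bounded_linear_Im this]
      have "(h has_field_derivative Im (\<i> * rcis \<rho> \<phi> * H (rcis \<rho> \<phi>))) (at \<phi>)"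
        unfolding h_def has_real_derivative_iff_has_vector_derivative .
      moreover have "\<bar>Im (\<i> * rcis \<rho> \<phi> * H (rcis \<rho> \<phi>))\<bar> \<le> cmod (\<i> * rcis \<rho> \<phi> * H (rcis \<rho> \<phi>))"
        by (rule abs_Im_le_cmod)
      moreover have "\<dots> = cmod (rcis \<rho> \<phi> * H (rcis \<rho> \<phi>))" by (simp add: norm_mult)
      moreover have "\<dots> \<le> \<epsilon>"
        by (rule B) (use that \<rho> Arg in \<open>auto simp: \<rho>_def\<close>)
      ultimately show ?thesis by auto
    qed
    then obtain D where D: "\<And>\<phi>. 0 \<le> \<phi> \<Longrightarrow> \<phi> \<le> \<theta> \<Longrightarrow> (h has_field_derivative D \<phi>) (at \<phi>) \<and> \<bar>D \<phi>\<bar> \<le> \<epsilon>"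
      by metis
    have h0: "h 0 = 0" using A_real[OF \<rho>] by (simp add: h_def rcis_def)
    have hz: "h (Arg z) = Im (A z)" by (simp add: h_def \<rho>_def rcis_cmod_Arg)
    show ?thesis
    proof (cases "Arg z = 0")
      case True
      then show ?thesis using h0 hz \<epsilon> c by simp
    next
      case False
      then have "\<exists>\<xi>. 0 < \<xi> \<and> \<xi> < Arg z \<and> h (Arg z) - h 0 = (Arg z - 0) * D \<xi>"
        using z D by (intro MVT2) auto
      then obtain \<xi> where \<xi>: "0 < \<xi>" "\<xi> < Arg z" "h (Arg z) - h 0 = (Arg z - 0) * D \<xi>" by blast
      have "\<bar>Im (A z)\<bar> = Arg z * \<bar>D \<xi>\<bar>" using \<xi> h0 hz z by (simp add: abs_mult)
      also have "\<dots> \<le> \<theta> * \<epsilon>" using D[of \<xi>] \<xi> z by (intro mult_mono) auto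
      finally show ?thesis .
    qed
  qed
  have lim_A: "((\<lambda>R. Im (A (ray c \<theta> R))) \<longlongrightarrow> 0) at_top"
  proof (rule tendstoI)
    fix e :: real assume e: "e > 0"
    define \<epsilon> where "\<epsilon> = e / (2 * \<theta>)"
    have \<epsilon>: "\<epsilon> > 0" using e c by (simp add: \<epsilon>_def)
    obtain B where B: "\<And>z. cmod z > B \<Longrightarrow> 0 \<le> Arg z \<Longrightarrow> Arg z \<le> \<theta> \<Longrightarrow> cmod (z * H z) \<le> \<epsilon>"
      using decay[OF \<epsilon>] by blast
    have "\<forall>\<^sub>F R in at_top. cmod (ray c \<theta> R) > B"
      using filterlim_norm_ray[OF c] by (simp add: filterlim_at_top_dense)
    then show "\<forall>\<^sub>F R in at_top. dist (Im (A (ray c \<theta> R))) 0 < e"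
      using eventually_ge_at_top[of 0]
    proof eventually_elim
      case (elim R)
      have "ray c \<theta> R \<noteq> 0" using ray_in_slit_plane[OF c, of R] by (auto simp: slit_plane_iff)
      then have "\<bar>Im (A (ray c \<theta> R))\<bar> \<le> \<theta> * \<epsilon>"
        using elim Arg_ray_bounds[OF c, of R] B by (intro arc \<epsilon>) auto
      also have "\<dots> < e" using e c by (simp add: \<epsilon>_def)
      finally show ?case by simp
    qed
  qed
  have lim_int: "((\<lambda>R. Im (LINT r:{0..R}|lborel. H (ray c \<theta> r) * cis \<theta>)) \<longlongrightarrow> Im (ray_integral c \<theta> H)) at_top"
    by (intro tendsto_Im ray_integral_limit int)
  have "\<forall>\<^sub>F R in at_top. Im (LINT r:{0..R}|lborel. H (ray c \<theta> r) * cis \<theta>) = Im (A (ray c \<theta> R))"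
    using eventually_ge_at_top[of 0]
  proof eventually_elim
    case (elim R)
    show ?case
      using ray_integral_FTC[OF c elim A holomorphic_on_imp_continuous_on[OF hol]] A_real[OF c(1)] by simp
  qed
  from tendsto_cong[OF this] lim_int
  have "((\<lambda>R. Im (A (ray c \<theta> R))) \<longlongrightarrow> Im (ray_integral c \<theta> H)) at_top" by (rule iffD1)
  from tendsto_unique[OF trivial_limit_at_top_linorder this lim_A] show ?thesis .
qed

section \<open>Cauchy's formula on a ray\<close>

lemma set_integrable_halfline_bound:
  fixes f :: "real \<Rightarrow> 'a::{banach, second_countable_topology}"
  assumes [measurable]: "f \<in> borel_measurable borel"
    and p: "p > 1" and bound: "\<And>r. 0 \<le> r \<Longrightarrow> norm (f r) \<le> C * (1 + r) powr (- p)"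
  shows "set_integrable lborel {0..} f"
proof -
  have "((\<lambda>x. x powr (- p)) has_integral -(1 powr (- p + 1)) / (- p + 1)) {1..}"
    using p by (intro has_integral_powr_to_inf) auto
  then have "(\<lambda>x. x powr (- p)) integrable_on {1..}" by blast
  then have "(\<lambda>x. x powr (- p)) absolutely_integrable_on {1..}"
    by (intro nonnegative_absolutely_integrable_1) auto
  then have "set_integrable lborel {1..} (\<lambda>x. x powr (- p))"
    unfolding set_integrable_def by (subst (asm) integrable_completion) auto
  then have "integrable lborel (\<lambda>x. indicator {1..} x *\<^sub>R x powr (- p))"
    unfolding set_integrable_def .
  from lborel_integrable_real_affine[OF this, of 1 1]
  have "integrable lborel (\<lambda>x. indicator {1..} (1 + x) *\<^sub>R (1 + x) powr (- p))" by simp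
  then have int: "integrable lborel (\<lambda>x. C * (indicator {0..} x *\<^sub>R (1 + x) powr (- p)))"
    by (intro integrable_mult_right) (simp add: indicator_def)
  show ?thesis
    unfolding set_integrable_def
  proof (rule Bochner_Integration.integrable_bound[OF int])
    show "AE x in lborel. norm (indicator {0..} x *\<^sub>R f x) \<le> norm (C * (indicator {0..} x *\<^sub>R (1 + x) powr (- p)))"
      using bound by (intro AE_I2) (auto simp: indicator_def intro: order_trans[OF _ abs_ge_self])
  qed auto
qed

lemma borel_measurable_ray [measurable]: "ray c \<theta> \<in> borel_measurable borel"
  by (intro borel_measurable_continuous_onI continuous_on_ray)

lemma borel_measurable_comp_ray:
  assumes c: "0 < c" "0 < \<theta>" "\<theta> < pi" and F: "continuous_on slit_plane F"
  shows "(\<lambda>r. F (ray c \<theta> r)) \<in> borel_measurable borel"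
  by (intro borel_measurable_continuous_onI continuous_on_compose2[OF F continuous_on_ray])
     (use ray_in_slit_plane[OF c] in auto)

text \<open>The closed sector swept from the positive axis to the direction of the ray.\<close>

definition sector :: "real \<Rightarrow> complex set" where
  "sector \<theta> = {z. z \<noteq> 0 \<and> 0 \<le> Arg z \<and> Arg z \<le> \<theta>}"

lemma ray_in_sector: "0 < c \<Longrightarrow> 0 < \<theta> \<Longrightarrow> \<theta> < pi \<Longrightarrow> 0 \<le> r \<Longrightarrow> ray c \<theta> r \<in> sector \<theta>"
  using Arg_ray_bounds[of c \<theta> r] ray_in_slit_plane[of c \<theta> r] by (auto simp: sector_def slit_plane_iff)

lemma diff_ray_neq_0: "0 < c \<Longrightarrow> c < s \<Longrightarrow> 0 < \<theta> \<Longrightarrow> \<theta> < pi \<Longrightarrow> of_real s - ray c \<theta> r \<noteq> 0"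
  using sin_gt_zero[of \<theta>] by (cases "r = 0") (auto simp: complex_eq_iff Im_ray)

lemma Re_le_norm_diff: "s - Re z \<le> cmod (of_real s - z)"
  by (metis Re_complex_of_real complex_Re_le_cmod minus_complex.sel(1))

lemma norm_Cauchy_kernel_bound:
  assumes c: "0 < c" "c < s" "pi / 2 < \<theta>" "\<theta> < pi"
    and q: "q > 0" and bound: "\<And>z. z \<in> sector \<theta> \<Longrightarrow> cmod (G z) \<le> C * cmod z powr (- q)"
  obtains K where "\<And>r. 0 \<le> r \<Longrightarrow> cmod (G (ray c \<theta> r)) / (s - Re (ray c \<theta> r)) \<le> K * (1 + r) powr (- (q + 1))"
proof -
  have th: "0 < \<theta>" using c pi_gt_zero by linarith
  obtain k1 where k1: "k1 > 0" "\<And>r. 0 \<le> r \<Longrightarrow> k1 * (1 + r) \<le> cmod (ray c \<theta> r)"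
    using norm_ray_lower[OF c(1) th c(4)] by blast
  obtain k2 where k2: "k2 > 0" "\<And>r. 0 \<le> r \<Longrightarrow> k2 * (1 + r) \<le> s - Re (ray c \<theta> r)"
    using norm_diff_ray_lower[OF c(2-4)] by blast
  have C: "C \<ge> 0"
  proof -
    have "0 \<le> C * cmod 1 powr (- q)"
      using bound[of 1] th by (intro order_trans[OF norm_ge_zero]) (auto simp: sector_def)
    then show ?thesis by simp
  qed
  show ?thesis
  proof (rule that[of "C * k1 powr (- q) / k2"])
    fix r :: real assume r: "0 \<le> r"
    have "cmod (G (ray c \<theta> r)) \<le> C * cmod (ray c \<theta> r) powr (- q)"
      using bound ray_in_sector[OF c(1) th c(4) r] by blast
    also have "\<dots> \<le> C * (k1 * (1 + r)) powr (- q)"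
      using k1 r q C by (intro mult_left_mono powr_mono2') auto
    finally have 1: "cmod (G (ray c \<theta> r)) \<le> C * (k1 * (1 + r)) powr (- q)" .
    have "cmod (G (ray c \<theta> r)) / (s - Re (ray c \<theta> r)) \<le> (C * (k1 * (1 + r)) powr (- q)) / (k2 * (1 + r))"
      using 1 k2 r C by (intro frac_le) auto
    also have "\<dots> = C * k1 powr (- q) / k2 * ((1 + r) powr (- q) / (1 + r) powr 1)"
      using r k1 by (simp add: powr_mult)
    also have "(1 + r) powr (- q) / (1 + r) powr 1 = (1 + r) powr (- (q + 1))"
      unfolding powr_diff[symmetric] by (rule arg_cong[where f = "\<lambda>e. (1 + r) powr e"]) simp
    finally show "cmod (G (ray c \<theta> r)) / (s - Re (ray c \<theta> r)) \<le> C * k1 powr (- q) / k2 * (1 + r) powr (- (q + 1))" .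
  qed
qed

lemma ray_integrable_Cauchy_kernel:
  assumes c: "0 < c" "c < s" "pi / 2 < \<theta>" "\<theta> < pi" and G: "continuous_on slit_plane G"
    and q: "q > 0" and bound: "\<And>z. z \<in> sector \<theta> \<Longrightarrow> cmod (G z) \<le> C * cmod z powr (- q)"
  shows "ray_integrable c \<theta> (\<lambda>z. G z / (of_real s - z))"
    and "set_integrable lborel {0..} (\<lambda>r. cmod (G (ray c \<theta> r)) / (s - Re (ray c \<theta> r)))"
proof -
  have th: "0 < \<theta>" using c pi_gt_zero by linarith
  obtain K where K: "\<And>r. 0 \<le> r \<Longrightarrow> cmod (G (ray c \<theta> r)) / (s - Re (ray c \<theta> r)) \<le> K * (1 + r) powr (- (q + 1))"
    using norm_Cauchy_kernel_bound[OF c q bound] by blast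
  have pos: "s - Re (ray c \<theta> r) > 0" if "0 \<le> r" for r
    using that norm_diff_ray_lower[OF c(2-4)] by (metis add_pos_nonneg less_le_trans mult_pos_pos zero_less_one)
  note [measurable] = borel_measurable_comp_ray[OF c(1) th c(4) G]
  show "set_integrable lborel {0..} (\<lambda>r. cmod (G (ray c \<theta> r)) / (s - Re (ray c \<theta> r)))"
    by (rule set_integrable_halfline_bound[where p = "q + 1" and C = K])
       (use q K pos in \<open>auto simp: less_imp_le\<close>)
  have "cmod (G (ray c \<theta> r) / (of_real s - ray c \<theta> r)) \<le> K * (1 + r) powr (- (q + 1))" if "0 \<le> r" for r
  proof -
    have "cmod (G (ray c \<theta> r) / (of_real s - ray c \<theta> r)) \<le> cmod (G (ray c \<theta> r)) / (s - Re (ray c \<theta> r))"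
      unfolding norm_divide using pos[OF that] less_le_trans[OF pos[OF that] Re_le_norm_diff]
      by (intro divide_left_mono Re_le_norm_diff mult_pos_pos) auto
    then show ?thesis using K[OF that] by simp
  qed
  then show "ray_integrable c \<theta> (\<lambda>z. G z / (of_real s - z))"
    unfolding ray_integrable_def using q
    by (intro set_integrable_halfline_bound[where p = "q + 1" and C = K]) auto
qed

lemma ray_integral_diff:
  assumes "ray_integrable c \<theta> F" "ray_integrable c \<theta> G"
  shows "ray_integral c \<theta> (\<lambda>z. F z - G z) = ray_integral c \<theta> F - ray_integral c \<theta> G"
    and "ray_integrable c \<theta> (\<lambda>z. F z - G z)"
  using assms unfolding ray_integral_def ray_integrable_def
  by (simp_all add: left_diff_distrib set_integral_diff)

lemma ray_integral_cmult:
  shows "ray_integral c \<theta> (\<lambda>z. a * F z) = a * ray_integral c \<theta> F"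
  unfolding ray_integral_def by (simp add: mult.assoc)

lemma ray_integral_cong:
  assumes "\<And>r. 0 \<le> r \<Longrightarrow> F (ray c \<theta> r) = G (ray c \<theta> r)"
  shows "ray_integral c \<theta> F = ray_integral c \<theta> G" "ray_integrable c \<theta> F = ray_integrable c \<theta> G"
proof -
  have *: "indicator {0..} r *\<^sub>R (F (ray c \<theta> r) * w) = indicator {0..} r *\<^sub>R (G (ray c \<theta> r) * w)" for r :: real and w
    using assms[of r] by (auto simp: indicator_def)
  show "ray_integral c \<theta> F = ray_integral c \<theta> G"
    unfolding ray_integral_def set_lebesgue_integral_def * ..
  show "ray_integrable c \<theta> F = ray_integrable c \<theta> G"
    using *[of _ 1] unfolding ray_integrable_def set_integrable_def mult_1_right by (simp only:)
qed

text \<open>The comparison function for Cauchy's formula: the integrand is the derivative of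
  \<open>Ln z - Ln (s - z)\<close>, whose imaginary part grows from \<open>0\<close> to \<open>\<theta> - (\<theta> - pi)\<close> along the ray.\<close>

lemma Im_ray_integral_inverse_kernel:
  assumes c: "0 < c" "c < s" "pi / 2 < \<theta>" "\<theta> < pi"
  shows "Im (ray_integral c \<theta> (\<lambda>z. of_real s / z / (of_real s - z))) = pi"
    and "ray_integrable c \<theta> (\<lambda>z. of_real s / z / (of_real s - z))"
proof -
  have th: "0 < \<theta>" using c pi_gt_zero by linarith
  define H where "H z = of_real s / z / (of_real s - z)" for z :: complex
  have cont: "continuous_on slit_plane (\<lambda>z. of_real s / z)"
    by (intro continuous_intros) (auto simp: slit_plane_iff)
  show int: "ray_integrable c \<theta> (\<lambda>z. of_real s / z / (of_real s - z))"
    by (rule ray_integrable_Cauchy_kernel(1)[OF c cont, of 1 s])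
       (use c in \<open>auto simp: norm_divide powr_minus divide_simps\<close>)
  have lim: "((\<lambda>R. Im (LINT r:{0..R}|lborel. H (ray c \<theta> r) * cis \<theta>)) \<longlongrightarrow> Im (ray_integral c \<theta> H)) at_top"
    by (intro tendsto_Im ray_integral_limit) (use int in \<open>simp add: H_def\<close>)
  have FTC: "Im (LINT r:{0..R}|lborel. H (ray c \<theta> r) * cis \<theta>) = Arg (ray c \<theta> R) - Arg (of_real s - ray c \<theta> R)"
    if R: "0 \<le> R" for R
  proof -
    have sin: "sin \<theta> > 0" using c th sin_gt_zero by simp
    have nz: "ray c \<theta> r \<noteq> 0" "of_real s - ray c \<theta> r \<noteq> 0" for r
      using ray_in_slit_plane[OF c(1) th c(4), of r] diff_ray_neq_0[OF c(1,2) th c(4), of r]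
      by (auto simp: slit_plane_iff)
    have "(LINT r:{0..R}|lborel. H (ray c \<theta> r) * cis \<theta>)
      = (Ln (ray c \<theta> R) - Ln (of_real s - ray c \<theta> R)) - (Ln (ray c \<theta> 0) - Ln (of_real s - ray c \<theta> 0))"
      unfolding set_lebesgue_integral_def
    proof (rule integral_FTC_atLeastAtMost)
      show "continuous_on {0..R} (\<lambda>r. H (ray c \<theta> r) * cis \<theta>)"
        unfolding H_def using nz by (intro continuous_intros continuous_on_ray) auto
      fix x assume x: "0 \<le> x" "x \<le> R"
      have 1: "ray c \<theta> x \<notin> \<real>\<^sub>\<le>\<^sub>0" using ray_in_slit_plane[OF c(1) th c(4), of x] by (simp add: slit_plane_def)
      have 2: "of_real s - ray c \<theta> x \<notin> \<real>\<^sub>\<le>\<^sub>0"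
        using x c sin by (cases "x = 0") (auto simp: complex_nonpos_Reals_iff Im_ray Re_ray)
      have "((\<lambda>z. Ln z - Ln (of_real s - z)) has_field_derivative H (ray c \<theta> x)) (at (ray c \<theta> x))"
        using 1 2 nz[of x] by (auto intro!: derivative_eq_intros simp: H_def divide_simps)
      from field_vector_diff_chain_within[OF ray_has_derivative has_field_derivative_at_within[OF this]]
      show "((\<lambda>r. Ln (ray c \<theta> r) - Ln (of_real s - ray c \<theta> r)) has_vector_derivative H (ray c \<theta> x) * cis \<theta>) (at x within {0..R})"
        by (simp add: o_def mult.commute)
    qed (use R in auto)
    moreover have "Im (Ln (of_real s - ray c \<theta> 0)) = 0" "Im (Ln (ray c \<theta> 0)) = 0"
      using c by (simp_all flip: of_real_diff Ln_of_real)
    ultimately show ?thesis using nz[of R] by (simp add: Arg_eq_Im_Ln)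
  qed
  have inv: "((\<lambda>R::real. of_real (1 / R) :: complex) \<longlongrightarrow> of_real 0) at_top"
    by (intro tendsto_of_real) real_asymp
  have Arg1: "((\<lambda>R. Arg (ray c \<theta> R)) \<longlongrightarrow> \<theta>) at_top"
  proof -
    have "((\<lambda>R. of_real c * of_real (1 / R) + cis \<theta>) \<longlongrightarrow> of_real c * of_real 0 + cis \<theta>) at_top"
      by (intro tendsto_intros inv)
    then have "((\<lambda>R. Arg (of_real c * of_real (1 / R) + cis \<theta>)) \<longlongrightarrow> Arg (cis \<theta>)) at_top"
      using c th sin_gt_zero[of \<theta>]
      by (intro isCont_tendsto_compose[where g = Arg] continuous_at_Arg) (auto simp: complex_nonpos_Reals_iff)
    moreover have "Arg (cis \<theta>) = \<theta>" using c th by (intro Arg_cis) auto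
    moreover have "\<forall>\<^sub>F R in at_top. Arg (of_real c * of_real (1 / R) + cis \<theta>) = Arg (ray c \<theta> R)"
      using eventually_gt_at_top[of 0]
    proof eventually_elim
      case (elim R)
      then have "of_real c * of_real (1 / R) + cis \<theta> = ray c \<theta> R / of_real R"
        by (simp add: ray_def field_simps)
      then show ?case using elim by simp
    qed
    ultimately show ?thesis using tendsto_cong by force
  qed
  have Arg2: "((\<lambda>R. Arg (of_real s - ray c \<theta> R)) \<longlongrightarrow> \<theta> - pi) at_top"
  proof -
    have "((\<lambda>R. of_real (s - c) * of_real (1 / R) - cis \<theta>) \<longlongrightarrow> of_real (s - c) * of_real 0 - cis \<theta>) at_top"
      by (intro tendsto_intros inv)
    moreover have eq: "of_real (s - c) * of_real 0 - cis \<theta> = cis (\<theta> - pi)"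
      by (simp add: complex_eq_iff cos_diff sin_diff)
    ultimately have "((\<lambda>R. Arg (of_real (s - c) * of_real (1 / R) - cis \<theta>)) \<longlongrightarrow> Arg (cis (\<theta> - pi))) at_top"
      using c th sin_gt_zero[of \<theta>]
      by (intro isCont_tendsto_compose[where g = Arg] continuous_at_Arg) (auto simp: complex_nonpos_Reals_iff sin_diff)
    moreover have "Arg (cis (\<theta> - pi)) = \<theta> - pi" using c th by (intro Arg_cis) auto
    moreover have "\<forall>\<^sub>F R in at_top. Arg (of_real (s - c) * of_real (1 / R) - cis \<theta>) = Arg (of_real s - ray c \<theta> R)"
      using eventually_gt_at_top[of 0]
    proof eventually_elim
      case (elim R)
      then have "of_real (s - c) * of_real (1 / R) - cis \<theta> = (of_real s - ray c \<theta> R) / of_real R"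
        by (simp add: ray_def field_simps)
      then show ?case using elim by simp
    qed
    ultimately show ?thesis using tendsto_cong by force
  qed
  have "((\<lambda>R. Arg (ray c \<theta> R) - Arg (of_real s - ray c \<theta> R)) \<longlongrightarrow> \<theta> - (\<theta> - pi)) at_top"
    by (intro tendsto_diff Arg1 Arg2)
  moreover have "\<forall>\<^sub>F R in at_top. Im (LINT r:{0..R}|lborel. H (ray c \<theta> r) * cis \<theta>) = Arg (ray c \<theta> R) - Arg (of_real s - ray c \<theta> R)"
    using eventually_ge_at_top[of 0] by eventually_elim (rule FTC)
  ultimately have "((\<lambda>R. Im (LINT r:{0..R}|lborel. H (ray c \<theta> r) * cis \<theta>)) \<longlongrightarrow> pi) at_top"
    using tendsto_cong by force
  from tendsto_unique[OF trivial_limit_at_top_linorder lim this]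
  show "Im (ray_integral c \<theta> (\<lambda>z. of_real s / z / (of_real s - z))) = pi" by (simp add: H_def[abs_def])
qed

text \<open>Cauchy's integral formula for the region to the right of the ray and its mirror image. Since
  \<open>G z - G s * (s / z)\<close> vanishes at \<open>s\<close>, its quotient by \<open>s - z\<close> is holomorphic and decays faster than
  \<open>1 / z\<close>, so it does not contribute, and the remaining integral is explicit.\<close>

lemma ray_Cauchy_formula:
  assumes c: "0 < c" "c < s" "pi / 2 < \<theta>" "\<theta> < pi"
    and hol: "G holomorphic_on slit_plane"
    and real: "\<And>x. x > 0 \<Longrightarrow> Im (G (of_real x)) = 0"
    and q: "q > 0" and bound: "\<And>z. z \<in> sector \<theta> \<Longrightarrow> cmod (G z) \<le> C * cmod z powr (- q)"
  shows "Im (ray_integral c \<theta> (\<lambda>z. G z / (of_real s - z))) = pi * Re (G (of_real s))"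
proof -
  have th: "0 < \<theta>" using c pi_gt_zero by linarith
  define f where "f z = G z - G (of_real s) * (of_real s / z)" for z
  define F where "F z = (if z = of_real s then deriv f (of_real s) else (f z - f (of_real s)) / (z - of_real s))" for z
  have fs: "f (of_real s) = 0" using c by (simp add: f_def)
  have "f holomorphic_on slit_plane"
    unfolding f_def by (intro holomorphic_intros hol) (auto simp: slit_plane_iff)
  then have Fhol: "F holomorphic_on slit_plane"
    unfolding F_def using open_slit_plane by (rule pole_lemma_open)
  have Gs: "G (of_real s) = of_real (Re (G (of_real s)))" using real[of s] c by (simp add: complex_eq_iff)
  have Im0: "Im (F (of_real x)) = 0" if "x > 0" "x \<noteq> s" for x
  proof -
    have "f (of_real x) = of_real (Re (G (of_real x)) - Re (G (of_real s)) * (s / x))"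
      unfolding f_def using real[of x] Gs that by (auto simp: complex_eq_iff)
    then have "F (of_real x) = of_real ((Re (G (of_real x)) - Re (G (of_real s)) * (s / x)) / (x - s))"
      unfolding F_def fs using that by simp
    then show ?thesis by simp
  qed
  have Im0s: "Im (F (of_real s)) = 0"
  proof -
    have "isCont F (of_real s)"
      using Fhol open_slit_plane c by (metis continuous_on_eq_continuous_at holomorphic_on_imp_continuous_on
          order_less_trans slit_plane_iff Re_complex_of_real)
    moreover have "(\<lambda>n. of_real (s + 1 / real (Suc n)) :: complex) \<longlonglongrightarrow> of_real (s + 0)"
      by (intro tendsto_intros LIMSEQ_inverse_real_of_nat[unfolded inverse_eq_divide])
    ultimately have "(\<lambda>n. F (of_real (s + 1 / real (Suc n)))) \<longlonglongrightarrow> F (of_real s)"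
      by (intro isCont_tendsto_compose[where g = F]) auto
    then have "(\<lambda>n. Im (F (of_real (s + 1 / real (Suc n))))) \<longlonglongrightarrow> Im (F (of_real s))"
      by (rule tendsto_Im)
    moreover have "Im (F (of_real (s + 1 / real (Suc n)))) = 0" for n
      using c by (intro Im0) (auto simp: add_pos_pos)
    ultimately show ?thesis by (simp add: LIMSEQ_const_iff)
  qed
  have eq: "G z / (of_real s - z) - G (of_real s) * (of_real s / z / (of_real s - z)) = - F z" if "z \<noteq> of_real s" for z
    using that c unfolding F_def fs f_def by (simp add: divide_simps) (simp add: algebra_simps)
  have int1: "ray_integrable c \<theta> (\<lambda>z. G z / (of_real s - z))"
    by (rule ray_integrable_Cauchy_kernel(1)[OF c holomorphic_on_imp_continuous_on[OF hol] q bound])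
  have int2: "ray_integrable c \<theta> (\<lambda>z. G (of_real s) * (of_real s / z / (of_real s - z)))"
    using Im_ray_integral_inverse_kernel(2)[OF c] unfolding ray_integrable_def by (rule set_integrable_mult_right)
  have "ray c \<theta> r \<noteq> of_real s" for r
    using diff_ray_neq_0[OF c(1,2) th c(4), of r] by auto
  note eq_ray = eq[OF this]
  have 0: "Im (ray_integral c \<theta> (\<lambda>z. - F z)) = 0"
  proof (rule Im_ray_integral_eq_0[OF c(1) th c(4)])
    show "(\<lambda>z. - F z) holomorphic_on slit_plane" by (intro holomorphic_intros Fhol)
    show "Im (- F (of_real x)) = 0" if "x > 0" for x
      using Im0 Im0s that by (cases "x = s") auto
    show "ray_integrable c \<theta> (\<lambda>z. - F z)"
      using ray_integral_diff(2)[OF int1 int2] eq_ray by (simp add: ray_integrable_def)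
    fix \<epsilon> :: real assume \<epsilon>: "\<epsilon> > 0"
    define D where "D = cmod (G (of_real s)) * s"
    have "((\<lambda>x. 2 * (C * x powr (- q) + D / x)) \<longlongrightarrow> 0) at_top"
    proof -
      have "((\<lambda>x. x powr (- q)) \<longlongrightarrow> 0) at_top" "((\<lambda>x::real. 1 / x) \<longlongrightarrow> 0) at_top"
        using q by real_asymp+
      then have "((\<lambda>x. 2 * (C * x powr (- q) + D * (1 / x))) \<longlongrightarrow> 2 * (C * 0 + D * 0)) at_top"
        by (intro tendsto_intros)
      then show ?thesis by simp
    qed
    then have "\<forall>\<^sub>F x in at_top. 2 * (C * x powr (- q) + D / x) < \<epsilon>" using \<epsilon> by (rule order_tendstoD)
    then obtain B0 where B0: "\<And>x. x \<ge> B0 \<Longrightarrow> 2 * (C * x powr (- q) + D / x) < \<epsilon>"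
      by (auto simp: eventually_at_top_linorder)
    define B where "B = max B0 (2 * s)"
    have "cmod (z * - F z) \<le> \<epsilon>" if z: "cmod z > B" "0 \<le> Arg z" "Arg z \<le> \<theta>" for z
    proof -
      have z2: "cmod z > 2 * s" "cmod z \<ge> B0" using z by (auto simp: B_def)
      have zs: "z \<noteq> of_real s" "z \<noteq> 0" using z2 c by auto
      have "cmod z - s \<le> cmod (z - of_real s)"
        using norm_triangle_ineq2[of z "of_real s"] c by simp
      then have d: "cmod z / 2 \<le> cmod (z - of_real s)" using z2 by simp
      have "cmod (f z) \<le> cmod (G z) + cmod (G (of_real s) * (of_real s / z))"
        unfolding f_def by (rule norm_triangle_ineq4)
      also have "\<dots> \<le> C * cmod z powr (- q) + D / cmod z"
        using bound[of z] z zs c by (auto simp: sector_def D_def norm_mult norm_divide)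
      finally have fz: "cmod (f z) \<le> C * cmod z powr (- q) + D / cmod z" .
      have "cmod (z * - F z) = cmod z * cmod (f z) / cmod (z - of_real s)"
        using zs by (simp add: F_def fs norm_mult norm_divide)
      also have "\<dots> \<le> cmod z * cmod (f z) / (cmod z / 2)"
        using d zs by (intro divide_left_mono) (auto intro!: mult_pos_pos)
      also have "\<dots> = 2 * cmod (f z)" using zs by simp
      also have "\<dots> \<le> 2 * (C * cmod z powr (- q) + D / cmod z)" using fz by simp
      also have "\<dots> \<le> \<epsilon>" using B0[OF z2(2)] by simp
      finally show ?thesis .
    qed
    then show "\<exists>B. \<forall>z. cmod z > B \<longrightarrow> 0 \<le> Arg z \<longrightarrow> Arg z \<le> \<theta> \<longrightarrow> cmod (z * - F z) \<le> \<epsilon>" by blast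
  qed
  have "ray_integral c \<theta> (\<lambda>z. - F z) = ray_integral c \<theta> (\<lambda>z. G z / (of_real s - z) - G (of_real s) * (of_real s / z / (of_real s - z)))"
    by (rule ray_integral_cong) (simp only: eq_ray)
  also have "\<dots> = ray_integral c \<theta> (\<lambda>z. G z / (of_real s - z)) - G (of_real s) * ray_integral c \<theta> (\<lambda>z. of_real s / z / (of_real s - z))"
    using ray_integral_diff(1)[OF int1 int2] by (simp only: ray_integral_cmult)
  finally have "Im (ray_integral c \<theta> (\<lambda>z. G z / (of_real s - z)))
    = Im (G (of_real s) * ray_integral c \<theta> (\<lambda>z. of_real s / z / (of_real s - z)))"
    using 0 by simp
  also have "\<dots> = Re (G (of_real s)) * pi"
    using real[of s] c Im_ray_integral_inverse_kernel(1)[OF c] by simp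
  finally show ?thesis by simp
qed

section \<open>Laplace transforms of Bromwich integrals\<close>

lemma set_integral_Ici_Ioi:
  fixes f :: "real \<Rightarrow> 'a::{banach, second_countable_topology}"
  shows "(LINT x:{a..}|lborel. f x) = (LINT x:{a<..}|lborel. f x)"
    and "set_integrable lborel {a..} f = set_integrable lborel {a<..} f"
  by (rule set_integral_discrete_difference[where X = "{a}"] set_integrable_discrete_difference[where X = "{a}"]; auto)+

lemma laplace_exp:
  fixes w :: complex
  assumes w: "Re w > 0"
  shows "set_integrable lborel {0<..} (\<lambda>t. exp (- (of_real t * w)))"
    and "(LINT t:{0<..}|lborel. exp (- (of_real t * w))) = 1 / w"
    and "(LINT t:{0<..}|lborel. exp (- (t * Re w))) = 1 / Re w"
proof -
  have "((\<lambda>x. exp (- Re w * x)) has_integral exp (- Re w * 0) / Re w) {0..}"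
    using w by (rule has_integral_exp_minus_to_infinity)
  moreover from this have "(\<lambda>x. exp (- Re w * x)) absolutely_integrable_on {0..}"
    by (intro nonnegative_absolutely_integrable_1) auto
  ultimately have real: "set_integrable lborel {0..} (\<lambda>t. exp (- Re w * t))"
    "(LINT t:{0..}|lborel. exp (- Re w * t)) = 1 / Re w"
  proof -
    assume 1: "((\<lambda>x. exp (- Re w * x)) has_integral exp (- Re w * 0) / Re w) {0..}"
      and 2: "(\<lambda>x. exp (- Re w * x)) absolutely_integrable_on {0..}"
    from 2 show 3: "set_integrable lborel {0..} (\<lambda>t. exp (- Re w * t))"
      unfolding set_integrable_def by (subst (asm) integrable_completion) auto
    show "(LINT t:{0..}|lborel. exp (- Re w * t)) = 1 / Re w"
      using set_borel_integral_eq_integral(2)[OF 3] integral_unique[OF 1] by simp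
  qed
  then show "(LINT t:{0<..}|lborel. exp (- (t * Re w))) = 1 / Re w"
    by (simp add: set_integral_Ici_Ioi mult.commute)
  have int: "set_integrable lborel {0..} (\<lambda>t. exp (- (of_real t * w)))"
    by (rule set_integrable_bound[OF real(1)]) (auto simp: mult.commute set_borel_measurable_def)
  then show "set_integrable lborel {0<..} (\<lambda>t. exp (- (of_real t * w)))"
    by (simp add: set_integral_Ici_Ioi)
  have wn: "w \<noteq> 0" using w by auto
  have "((\<lambda>T. LINT t:{0..T}|lborel. exp (- (of_real t * w))) \<longlongrightarrow> (LINT t:{0..}|lborel. exp (- (of_real t * w)))) at_top"
    by (rule tendsto_set_lebesgue_integral_at_top[OF _ int]) auto
  moreover have "\<forall>\<^sub>F T in at_top. (LINT t:{0..T}|lborel. exp (- (of_real t * w))) = 1 / w - exp (- (of_real T * w)) / w"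
    using eventually_ge_at_top[of 0]
  proof eventually_elim
    case (elim T)
    have "(LINT t:{0..T}|lborel. exp (- (of_real t * w))) = - exp (- (of_real T * w)) / w - (- exp (- (of_real 0 * w)) / w)"
      unfolding set_lebesgue_integral_def
    proof (rule integral_FTC_atLeastAtMost)
      fix x assume "0 \<le> x" "x \<le> T"
      have "((\<lambda>z. - exp (- (z * w)) / w) has_field_derivative exp (- (of_real x * w))) (at (of_real x))"
        using wn by (auto intro!: derivative_eq_intros)
      from has_vector_derivative_real_field[OF this]
      show "((\<lambda>x. - exp (- (of_real x * w)) / w) has_vector_derivative exp (- (of_real x * w))) (at x within {0..T})"
        by (rule has_vector_derivative_at_within)
    qed (use elim in \<open>auto intro!: continuous_intros\<close>)
    then show ?case by simp
  qed
  ultimately have lim: "((\<lambda>T. 1 / w - exp (- (of_real T * w)) / w) \<longlongrightarrow> (LINT t:{0..}|lborel. exp (- (of_real t * w)))) at_top"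
    using tendsto_cong by force
  have "((\<lambda>T. exp (- (of_real T * w))) \<longlongrightarrow> 0) at_top"
  proof (rule tendsto_norm_zero_cancel)
    have "((\<lambda>T. exp (- (T * Re w))) \<longlongrightarrow> 0) at_top" using w by real_asymp
    then show "((\<lambda>T. cmod (exp (- (of_real T * w)))) \<longlongrightarrow> 0) at_top" by simp
  qed
  then have "((\<lambda>T. 1 / w - exp (- (of_real T * w)) / w) \<longlongrightarrow> 1 / w - 0 / w) at_top"
    by (intro tendsto_intros wn)
  from tendsto_unique[OF trivial_limit_at_top_linorder lim this]
  show "(LINT t:{0<..}|lborel. exp (- (of_real t * w))) = 1 / w" by (simp add: set_integral_Ici_Ioi)
qed

text \<open>The Bromwich integral of \<open>G\<close>, taken over the ray and its mirror image.\<close>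

definition ray_transform :: "real \<Rightarrow> real \<Rightarrow> (complex \<Rightarrow> complex) \<Rightarrow> real \<Rightarrow> real" where
  "ray_transform c \<theta> G t = Im (ray_integral c \<theta> (\<lambda>z. exp (of_real t * z) * G z)) / pi"

text \<open>Fubini: integrating \<open>exp (- t * (s - z))\<close> over \<open>t\<close> turns the Laplace transform of the Bromwich integral
  into the Cauchy integral over the ray. The decay of \<open>G\<close> makes the double integral absolutely convergent.\<close>

lemma laplace_ray_transform:
  assumes c: "0 < c" "c < s" "pi / 2 < \<theta>" "\<theta> < pi"
    and hol: "G holomorphic_on slit_plane"
    and real: "\<And>x. x > 0 \<Longrightarrow> Im (G (of_real x)) = 0"
    and q: "q > 0" and bound: "\<And>z. z \<in> sector \<theta> \<Longrightarrow> cmod (G z) \<le> C * cmod z powr (- q)"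
  shows "set_integrable lborel {0<..} (\<lambda>t. exp (- (s * t)) * ray_transform c \<theta> G t)"
    and "(LINT t:{0<..}|lborel. exp (- (s * t)) * ray_transform c \<theta> G t) = Re (G (of_real s))"
proof -
  have th: "0 < \<theta>" using c pi_gt_zero by linarith
  note cont = holomorphic_on_imp_continuous_on[OF hol]
  have [measurable]: "(\<lambda>r. G (ray c \<theta> r)) \<in> borel_measurable borel"
    by (rule borel_measurable_comp_ray[OF c(1) th c(4) cont])
  have [measurable]: "(\<lambda>r. G (ray c \<theta> r)) \<in> borel_measurable lborel" by simp
  have [measurable]: "ray c \<theta> \<in> borel_measurable lborel" by simp
  define f where "f r t = indicator {0..} r *\<^sub>R (indicator {0<..} t *\<^sub>R (exp (- (of_real t * (of_real s - ray c \<theta> r))) * (G (ray c \<theta> r) * cis \<theta>)))" for r t :: real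
  have pos: "Re (of_real s - ray c \<theta> r) > 0" if "0 \<le> r" for r
    using that norm_diff_ray_lower[OF c(2-4)]
    by (metis Re_complex_of_real add_pos_nonneg less_le_trans minus_complex.simps(1) mult_pos_pos zero_less_one)
  have int: "integrable (lborel \<Otimes>\<^sub>M lborel) (case_prod f)"
  proof -
    have meas: "case_prod f \<in> borel_measurable (lborel \<Otimes>\<^sub>M lborel)"
      unfolding f_def by measurable
    have "(\<integral>t. norm (f r t) \<partial>lborel) = indicator {0..} r *\<^sub>R (cmod (G (ray c \<theta> r)) / (s - Re (ray c \<theta> r)))" for r
    proof (cases "0 \<le> r")
      case True
      have "(\<integral>t. norm (f r t) \<partial>lborel) = (\<integral>t. cmod (G (ray c \<theta> r)) * (indicator {0<..} t *\<^sub>R exp (- (t * Re (of_real s - ray c \<theta> r)))) \<partial>lborel)"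
        unfolding f_def using True by (intro Bochner_Integration.integral_cong) (auto simp: norm_mult indicator_def)
      also have "\<dots> = cmod (G (ray c \<theta> r)) * (1 / Re (of_real s - ray c \<theta> r))"
        using laplace_exp(3)[OF pos[OF True]] unfolding set_lebesgue_integral_def by (simp only: integral_mult_right_zero)
      finally show ?thesis using True by simp
    qed (simp add: f_def)
    then have norm: "integrable lborel (\<lambda>r. \<integral>t. norm (f r t) \<partial>lborel)"
      using ray_integrable_Cauchy_kernel(2)[OF c cont q bound] unfolding set_integrable_def by simp
    have "integrable lborel (f r)" for r
    proof (cases "0 \<le> r")
      case True
      have "integrable lborel (\<lambda>t. (indicator {0<..} t *\<^sub>R exp (- (of_real t * (of_real s - ray c \<theta> r)))) * (G (ray c \<theta> r) * cis \<theta>))"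
        using laplace_exp(1)[OF pos[OF True]] unfolding set_integrable_def by (rule integrable_mult_left)
      then show ?thesis unfolding f_def using True by simp
    qed (simp add: f_def[abs_def])
    then show ?thesis
      by (intro lborel_pair.Fubini_integrable meas) (simp_all add: norm)
  qed
  have inner: "(\<integral>r. f r t \<partial>lborel) = indicator {0<..} t *\<^sub>R (of_real (exp (- (s * t))) * ray_integral c \<theta> (\<lambda>z. exp (of_real t * z) * G z))" for t
  proof -
    have "f r t = indicator {0<..} t *\<^sub>R (of_real (exp (- (s * t))) * (indicator {0..} r *\<^sub>R (exp (of_real t * ray c \<theta> r) * G (ray c \<theta> r) * cis \<theta>)))" for r
    proof -
      have "exp (- (of_real t * (of_real s - ray c \<theta> r))) = of_real (exp (- (s * t))) * exp (of_real t * ray c \<theta> r)"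
        by (simp add: algebra_simps flip: exp_of_real exp_add)
      then show ?thesis unfolding f_def by (simp add: indicator_def)
    qed
    then have "(\<integral>r. f r t \<partial>lborel) = (\<integral>r. indicator {0<..} t *\<^sub>R (of_real (exp (- (s * t))) * (indicator {0..} r *\<^sub>R (exp (of_real t * ray c \<theta> r) * G (ray c \<theta> r) * cis \<theta>))) \<partial>lborel)"
      by simp
    also have "\<dots> = indicator {0<..} t *\<^sub>R (of_real (exp (- (s * t))) * ray_integral c \<theta> (\<lambda>z. exp (of_real t * z) * G z))"
      unfolding ray_integral_def set_lebesgue_integral_def
      by (cases "0 < t") (simp_all only: integral_mult_right_zero indicator_simps greaterThan_iff scaleR_one scaleR_zero_left integral_zero not_False_eq_True if_False)
    finally show ?thesis .
  qed
  have outer: "(\<integral>t. f r t \<partial>lborel) = indicator {0..} r *\<^sub>R (G (ray c \<theta> r) / (of_real s - ray c \<theta> r) * cis \<theta>)" for r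
  proof (cases "0 \<le> r")
    case True
    have "(\<integral>t. f r t \<partial>lborel) = (\<integral>t. (indicator {0<..} t *\<^sub>R exp (- (of_real t * (of_real s - ray c \<theta> r)))) * (G (ray c \<theta> r) * cis \<theta>) \<partial>lborel)"
      unfolding f_def using True by simp
    also have "\<dots> = 1 / (of_real s - ray c \<theta> r) * (G (ray c \<theta> r) * cis \<theta>)"
      using laplace_exp(2)[OF pos[OF True]] unfolding set_lebesgue_integral_def by (simp only: integral_mult_left_zero)
    finally show ?thesis using True by simp
  qed (simp add: f_def)
  have I: "integrable lborel (\<lambda>t. \<integral>r. f r t \<partial>lborel)"
    by (rule lborel_pair.integrable_snd[OF int])
  have eq: "indicator {0<..} t *\<^sub>R (exp (- (s * t)) * ray_transform c \<theta> G t) = Im (\<integral>r. f r t \<partial>lborel) / pi" for t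
    unfolding inner ray_transform_def by simp
  show "set_integrable lborel {0<..} (\<lambda>t. exp (- (s * t)) * ray_transform c \<theta> G t)"
    unfolding set_integrable_def eq by (intro Bochner_Integration.integrable_divide integrable_Im I)
  have "(\<integral>t. (\<integral>r. f r t \<partial>lborel) \<partial>lborel) = (\<integral>r. (\<integral>t. f r t \<partial>lborel) \<partial>lborel)"
    by (rule lborel_pair.Fubini_integral[OF int])
  also have "\<dots> = ray_integral c \<theta> (\<lambda>z. G z / (of_real s - z))"
    unfolding outer ray_integral_def set_lebesgue_integral_def ..
  finally have "Im (\<integral>t. (\<integral>r. f r t \<partial>lborel) \<partial>lborel) = pi * Re (G (of_real s))"
    using ray_Cauchy_formula[OF c hol real q bound] by simp
  moreover have "(LINT t:{0<..}|lborel. exp (- (s * t)) * ray_transform c \<theta> G t) = Im (\<integral>t. (\<integral>r. f r t \<partial>lborel) \<partial>lborel) / pi"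
    unfolding set_lebesgue_integral_def eq using I by (simp add: integral_Im)
  ultimately show "(LINT t:{0<..}|lborel. exp (- (s * t)) * ray_transform c \<theta> G t) = Re (G (of_real s))" by simp
qed

section \<open>Hankel's formula for the reciprocal Gamma function\<close>

lemma powr_exp_bound:
  assumes k: "(k::real) > 0"
  obtains C where "\<And>x. 1 \<le> x \<Longrightarrow> x powr p * exp (- (k * x)) \<le> C"
proof -
  \<comment> \<open>\<open>(1 + k * x / n) ^ n \<le> exp (k * x)\<close> with an integer \<open>n \<ge> p\<close>\<close>
  define n where "n = Suc (nat \<lceil>p\<rceil>)"
  have n: "p \<le> real n" "n > 0" unfolding n_def by linarith+
  show ?thesis
  proof (rule that[of "(real n / k) ^ n"])
    fix x :: real assume x: "1 \<le> x"
    have "(k * x / real n) ^ n \<le> (1 + k * x / real n) ^ n"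
      using k x n by (intro power_mono) auto
    also have "\<dots> \<le> exp (k * x)"
      using k x n by (intro exp_ge_one_plus_x_over_n_power_n) (auto intro: order_trans[of _ 0])
    finally have "(k / real n * x) ^ n \<le> exp (k * x)" by simp
    then have 1: "x ^ n \<le> (real n / k) ^ n * exp (k * x)"
      using k n by (simp add: power_mult_distrib power_divide field_simps)
    have "x powr p \<le> x powr real n" using x n by (intro powr_mono) auto
    also have "\<dots> = x ^ n" using x by (simp add: powr_realpow)
    finally have "x powr p * exp (- (k * x)) \<le> (real n / k) ^ n * exp (k * x) * exp (- (k * x))"
      using 1 by (intro mult_right_mono) auto
    then show "x powr p * exp (- (k * x)) \<le> (real n / k) ^ n"
      unfolding mult.assoc by (simp flip: exp_add)
  qed
qed

lemma sublinear_powr_bound: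
  assumes "(k::real) > 0" "0 < \<alpha>" "\<alpha> < 1"
  obtains B where "\<And>x. 0 \<le> x \<Longrightarrow> x powr \<alpha> \<le> k * x + B"
proof -
  \<comment> \<open>the point beyond which \<open>x powr \<alpha> \<le> k * x\<close>\<close>
  define X where "X = k powr (- 1 / (1 - \<alpha>))"
  have X: "X > 0" using assms by (simp add: X_def)
  show ?thesis
  proof (rule that[of "X powr \<alpha>"])
    fix x :: real assume x: "0 \<le> x"
    show "x powr \<alpha> \<le> k * x + X powr \<alpha>"
    proof (cases "x \<le> X")
      case True
      then have "x powr \<alpha> \<le> X powr \<alpha>" using x assms by (intro powr_mono2) auto
      then show ?thesis using x assms by (simp add: add_increasing)
    next
      case False
      then have "x powr (\<alpha> - 1) \<le> X powr (\<alpha> - 1)" using X assms by (intro powr_mono2') auto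
      also have "\<dots> = k"
      proof -
        have "- 1 / (1 - \<alpha>) * (\<alpha> - 1) = 1" using assms by (simp add: field_simps)
        then show ?thesis using assms unfolding X_def powr_powr by simp
      qed
      finally have "x powr (\<alpha> - 1) * x \<le> k * x" using x by (intro mult_right_mono)
      moreover have "x powr (\<alpha> - 1) * x = x powr \<alpha>" using False X by (simp add: powr_diff)
      ultimately show ?thesis using powr_ge_zero[of X \<alpha>] by linarith
    qed
  qed
qed

text \<open>Along the ray \<open>exp (t * z)\<close> decays exponentially, which beats any power and also \<open>exp (\<bar>z\<bar> powr \<alpha>)\<close> for
  \<open>\<alpha> < 1\<close>. The latter dominates the partial sums of the exponential series.\<close>

lemma ray_exp_decay:
  assumes c: "0 < c" "pi / 2 < \<theta>" "\<theta> < pi" and t: "t > 0" and \<alpha>: "0 < \<alpha>" "\<alpha> < 1"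
  obtains K where "\<And>r. 0 \<le> r \<Longrightarrow> cmod (exp (of_real t * ray c \<theta> r)) *
    (cmod (ray c \<theta> r) powr p * exp (cmod (ray c \<theta> r) powr \<alpha>)) \<le> K * (1 + r) powr (- 2)"
proof -
  have th: "0 < \<theta>" using c pi_gt_zero by linarith
  define k where "k = - cos \<theta>"
  have k: "k > 0" using c cos_monotone_0_pi[of "pi / 2" \<theta>] by (simp add: k_def)
  obtain m where m: "m > 0" "\<And>r. 0 \<le> r \<Longrightarrow> m * (1 + r) \<le> cmod (ray c \<theta> r)"
    using norm_ray_lower[OF c(1) th c(3)] by blast
  define A where "A = max (m powr p) ((1 + c) powr p)"
  have A: "A \<ge> 0" unfolding A_def by (simp add: le_max_iff_disj)
  have pow: "cmod (ray c \<theta> r) powr p \<le> A * (1 + r) powr \<bar>p\<bar>" if r: "0 \<le> r" for r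
  proof (cases "p \<ge> 0")
    case True
    have "cmod (ray c \<theta> r) powr p \<le> ((1 + c) * (1 + r)) powr p"
      using norm_ray_upper[OF c(1) r, of \<theta>] True by (intro powr_mono2) auto
    also have "\<dots> = (1 + c) powr p * (1 + r) powr p" using c r by (simp add: powr_mult)
    also have "\<dots> \<le> A * (1 + r) powr \<bar>p\<bar>" using True A by (intro mult_mono) (auto simp: A_def)
    finally show ?thesis .
  next
    case False
    have "cmod (ray c \<theta> r) powr p \<le> (m * (1 + r)) powr p"
      using m(2)[OF r] m(1) r False by (intro powr_mono2') auto
    also have "\<dots> = m powr p * (1 + r) powr p" using m r by (simp add: powr_mult)
    also have "\<dots> \<le> A * (1 + r) powr \<bar>p\<bar>" using r A by (intro mult_mono powr_mono) (auto simp: A_def)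
    finally show ?thesis .
  qed
  define \<epsilon> where "\<epsilon> = t * k / (2 * (1 + c))"
  have \<epsilon>: "\<epsilon> > 0" using t k c by (simp add: \<epsilon>_def)
  obtain B where B: "\<And>x. 0 \<le> x \<Longrightarrow> x powr \<alpha> \<le> \<epsilon> * x + B"
    using sublinear_powr_bound[OF \<epsilon> \<alpha>] by blast
  have tk: "t * k / 2 > 0" using t k by simp
  obtain D where D: "\<And>x. 1 \<le> x \<Longrightarrow> x powr (\<bar>p\<bar> + 2) * exp (- (t * k / 2 * x)) \<le> D"
    using powr_exp_bound[OF tk] by blast
  show ?thesis
  proof (rule that[of "exp (t * c + t * k + B) * (A * D)"])
    fix r :: real assume r: "0 \<le> r"
    have "cmod (ray c \<theta> r) powr \<alpha> \<le> \<epsilon> * cmod (ray c \<theta> r) + B" by (rule B) simp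
    also have "\<epsilon> * cmod (ray c \<theta> r) \<le> \<epsilon> * ((1 + c) * (1 + r))"
      using norm_ray_upper[OF c(1) r, of \<theta>] \<epsilon> by (intro mult_left_mono) auto
    also have "\<epsilon> * ((1 + c) * (1 + r)) = t * k / 2 * (1 + r)"
    proof -
      have "1 + c \<noteq> 0" using c by simp
      then have "\<epsilon> * (1 + c) = t * k / 2" unfolding \<epsilon>_def by (simp add: divide_simps)
      then show ?thesis by (metis mult.assoc)
    qed
    finally have pa: "cmod (ray c \<theta> r) powr \<alpha> \<le> t * k / 2 * (1 + r) + B" by simp
    have e: "cmod (exp (of_real t * ray c \<theta> r)) = exp (t * c - t * k * r)"
      by (simp add: Re_ray k_def algebra_simps)
    have "cmod (exp (of_real t * ray c \<theta> r)) * (cmod (ray c \<theta> r) powr p * exp (cmod (ray c \<theta> r) powr \<alpha>))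
        \<le> exp (t * c - t * k * r) * (A * (1 + r) powr \<bar>p\<bar> * exp (t * k / 2 * (1 + r) + B))"
      unfolding e using pow[OF r] pa A by (intro mult_mono) auto
    also have "\<dots> = exp (t * c - t * k * r) * exp (t * k / 2 * (1 + r) + B) * (A * (1 + r) powr \<bar>p\<bar>)" by simp
    also have "exp (t * c - t * k * r) * exp (t * k / 2 * (1 + r) + B) = exp (t * c + t * k + B) * exp (- (t * k / 2 * (1 + r)))"
      unfolding exp_add[symmetric] by (rule arg_cong[where f = exp]) (simp add: field_simps)
    also have "exp (t * c + t * k + B) * exp (- (t * k / 2 * (1 + r))) * (A * (1 + r) powr \<bar>p\<bar>)
       = exp (t * c + t * k + B) * (A * ((1 + r) powr (\<bar>p\<bar> + 2) * exp (- (t * k / 2 * (1 + r))))) * (1 + r) powr (- 2)"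
      using r by (simp add: powr_add powr_minus field_simps)
    also have "\<dots> \<le> exp (t * c + t * k + B) * (A * D) * (1 + r) powr (- 2)"
      using D[of "1 + r"] r A by (intro mult_right_mono mult_left_mono) auto
    finally show "cmod (exp (of_real t * ray c \<theta> r)) * (cmod (ray c \<theta> r) powr p * exp (cmod (ray c \<theta> r) powr \<alpha>))
        \<le> exp (t * c + t * k + B) * (A * D) * (1 + r) powr (- 2)" .
  qed
qed

lemma ray_integrable_exp:
  assumes c: "0 < c" "pi / 2 < \<theta>" "\<theta> < pi" and t: "t > 0" and \<alpha>: "0 < \<alpha>" "\<alpha> < 1"
    and F: "continuous_on slit_plane F"
    and bound: "\<And>z. z \<in> sector \<theta> \<Longrightarrow> cmod (F z) \<le> C * (cmod z powr p * exp (cmod z powr \<alpha>))"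
  shows "ray_integrable c \<theta> (\<lambda>z. exp (of_real t * z) * F z)"
proof -
  have th: "0 < \<theta>" using c pi_gt_zero by linarith
  obtain K where K: "\<And>r. 0 \<le> r \<Longrightarrow> cmod (exp (of_real t * ray c \<theta> r)) *
    (cmod (ray c \<theta> r) powr p * exp (cmod (ray c \<theta> r) powr \<alpha>)) \<le> K * (1 + r) powr (- 2)"
    using ray_exp_decay[OF c t \<alpha>] by blast
  have C: "C \<ge> 0"
  proof -
    have "0 \<le> C * exp 1"
      using bound[of 1] th by (intro order_trans[OF norm_ge_zero[of "F 1"]]) (auto simp: sector_def)
    then show ?thesis by (simp add: zero_le_mult_iff)
  qed
  show ?thesis unfolding ray_integrable_def
  proof (rule set_integrable_halfline_bound[where p = 2 and C = "C * K"])
    show "(\<lambda>r. exp (of_real t * ray c \<theta> r) * F (ray c \<theta> r)) \<in> borel_measurable borel"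
      using borel_measurable_comp_ray[OF c(1) th c(3) F] by measurable
    fix r :: real assume r: "0 \<le> r"
    have "cmod (exp (of_real t * ray c \<theta> r) * F (ray c \<theta> r)) \<le> cmod (exp (of_real t * ray c \<theta> r)) *
      (C * (cmod (ray c \<theta> r) powr p * exp (cmod (ray c \<theta> r) powr \<alpha>)))"
      unfolding norm_mult by (intro mult_left_mono bound ray_in_sector[OF c(1) th c(3) r]) auto
    also have "\<dots> = C * (cmod (exp (of_real t * ray c \<theta> r)) * (cmod (ray c \<theta> r) powr p * exp (cmod (ray c \<theta> r) powr \<alpha>)))"
      by simp
    also have "\<dots> \<le> C * (K * (1 + r) powr (- 2))" by (intro mult_left_mono K r C)
    finally show "cmod (exp (of_real t * ray c \<theta> r) * F (ray c \<theta> r)) \<le> C * K * (1 + r) powr (- 2)" by simp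
  qed auto
qed

lemma norm_powr_of_real: "cmod (z powr of_real a) = cmod z powr a"
  by (subst norm_powr_real_powr') auto

lemma continuous_on_slit_powr: "continuous_on slit_plane (\<lambda>z. z powr of_real a)"
  by (intro holomorphic_on_imp_continuous_on holomorphic_intros) (auto simp: slit_plane_def)

lemma ray_integrable_exp_powr:
  assumes c: "0 < c" "pi / 2 < \<theta>" "\<theta> < pi" and t: "t > 0"
  shows "ray_integrable c \<theta> (\<lambda>z. exp (of_real t * z) * z powr of_real a)"
proof (rule ray_integrable_exp[OF c t, of "1/2" _ 1 a])
  show "cmod (z powr of_real a) \<le> 1 * (cmod z powr a * exp (cmod z powr (1 / 2)))" for z
    using mult_left_mono[of 1 "exp (cmod z powr (1 / 2))" "cmod z powr a"] by (simp add: norm_powr_of_real)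
qed (auto intro: continuous_on_slit_powr)

lemma slit_powr_real: "x > 0 \<Longrightarrow> of_real x powr of_real a = complex_of_real (x powr a)"
  by (simp add: powr_of_real)

text \<open>Translating the vertex of the ray changes the primitive at infinity by a horizontal segment on
  which the integrand is exponentially small.\<close>

lemma ray_transform_powr_vertex:
  assumes c: "0 < c1" "c1 \<le> c2" "pi / 2 < \<theta>" "\<theta> < pi"
  shows "ray_transform c1 \<theta> (\<lambda>z. z powr of_real a) 1 = ray_transform c2 \<theta> (\<lambda>z. z powr of_real a) 1"
proof -
  have th: "0 < \<theta>" using c pi_gt_zero by linarith
  have c2: "0 < c2" using c by simp
  have sin: "sin \<theta> > 0" using c th sin_gt_zero by simp
  define H where "H z = exp (of_real 1 * z) * z powr of_real a" for z :: complex
  have hol: "H holomorphic_on slit_plane"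
    unfolding H_def by (intro holomorphic_intros) (auto simp: slit_plane_def)
  have "Im (H (of_real x)) = 0" if "x > 0" for x
    using that by (simp add: H_def slit_powr_real exp_of_real flip: of_real_mult)
  then obtain A where A: "\<And>z. z \<in> slit_plane \<Longrightarrow> (A has_field_derivative H z) (at z)"
    and A_real: "\<And>x. x > 0 \<Longrightarrow> Im (A (of_real x)) = 0"
    using slit_plane_primitive[OF hol] by blast
  have lim: "((\<lambda>R. Im (A (ray c \<theta> R))) \<longlongrightarrow> Im (ray_integral c \<theta> H)) at_top" if "0 < c" for c
  proof -
    have "((\<lambda>R. Im (LINT r:{0..R}|lborel. H (ray c \<theta> r) * cis \<theta>)) \<longlongrightarrow> Im (ray_integral c \<theta> H)) at_top"
      unfolding H_def by (intro tendsto_Im ray_integral_limit ray_integrable_exp_powr that c) simp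
    moreover have "\<forall>\<^sub>F R in at_top. Im (LINT r:{0..R}|lborel. H (ray c \<theta> r) * cis \<theta>) = Im (A (ray c \<theta> R))"
      using eventually_ge_at_top[of 0]
    proof eventually_elim
      case (elim R)
      show ?case
        using ray_integral_FTC[OF that th c(4) elim A holomorphic_on_imp_continuous_on[OF hol]] A_real[OF that] by simp
    qed
    ultimately show ?thesis using tendsto_cong by force
  qed
  define K where "K R = (c2 - c1) * (exp (c2 + R * cos \<theta>) * ((R * sin \<theta>) powr a + (c2 + R) powr a))" for R
  have diff: "\<bar>Im (A (ray c2 \<theta> R)) - Im (A (ray c1 \<theta> R))\<bar> \<le> K R" if R: "R > 0" for R
  proof (cases "c1 = c2")
    case False
    have "\<exists>\<xi>. c1 < \<xi> \<and> \<xi> < c2 \<and> Im (A (ray c2 \<theta> R)) - Im (A (ray c1 \<theta> R)) = (c2 - c1) * Im (H (ray \<xi> \<theta> R))"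
    proof (rule MVT2)
      fix x assume x: "c1 \<le> x" "x \<le> c2"
      have "((\<lambda>c. ray c \<theta> R) has_vector_derivative 1) (at x)"
        unfolding ray_def by (auto intro!: derivative_eq_intros simp: has_vector_derivative_def scaleR_conv_of_real)
      from field_vector_diff_chain_at[OF this A[OF ray_in_slit_plane[OF _ th c(4)]]]
      have "((\<lambda>c. A (ray c \<theta> R)) has_vector_derivative H (ray x \<theta> R)) (at x)"
        using x c by (simp add: o_def)
      from bounded_linear.has_vector_derivative[OF bounded_linear_Im this]
      show "((\<lambda>c. Im (A (ray c \<theta> R))) has_real_derivative Im (H (ray x \<theta> R))) (at x)"
        unfolding has_real_derivative_iff_has_vector_derivative .
    qed (use c False in auto)
    then obtain \<xi> where \<xi>: "c1 < \<xi>" "\<xi> < c2"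
      "Im (A (ray c2 \<theta> R)) - Im (A (ray c1 \<theta> R)) = (c2 - c1) * Im (H (ray \<xi> \<theta> R))" by blast
    have lower: "R * sin \<theta> \<le> cmod (ray \<xi> \<theta> R)"
      using abs_Im_le_cmod[of "ray \<xi> \<theta> R"] R sin by (simp add: Im_ray)
    have "cmod (ray \<xi> \<theta> R) \<le> \<xi> + R"
      unfolding ray_def using \<xi> c R by (intro norm_triangle_le) (simp add: norm_mult)
    then have upper: "cmod (ray \<xi> \<theta> R) \<le> c2 + R" using \<xi> by simp
    have pow: "cmod (ray \<xi> \<theta> R) powr a \<le> (R * sin \<theta>) powr a + (c2 + R) powr a"
    proof (cases "a \<ge> 0")
      case True
      then have "cmod (ray \<xi> \<theta> R) powr a \<le> (c2 + R) powr a" using upper by (intro powr_mono2) auto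
      then show ?thesis by (simp add: add_increasing)
    next
      case False
      then have "cmod (ray \<xi> \<theta> R) powr a \<le> (R * sin \<theta>) powr a" using lower R sin by (intro powr_mono2') auto
      then show ?thesis by (simp add: add_increasing2)
    qed
    have "\<bar>Im (H (ray \<xi> \<theta> R))\<bar> \<le> cmod (H (ray \<xi> \<theta> R))" by (rule abs_Im_le_cmod)
    also have "\<dots> = exp (\<xi> + R * cos \<theta>) * cmod (ray \<xi> \<theta> R) powr a"
      by (simp add: H_def norm_mult norm_powr_of_real Re_ray)
    also have "\<dots> \<le> exp (c2 + R * cos \<theta>) * ((R * sin \<theta>) powr a + (c2 + R) powr a)"
      using \<xi> pow by (intro mult_mono) auto
    finally show ?thesis using c unfolding \<xi>(3) K_def by (simp add: abs_mult mult_left_mono)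
  qed (simp add: K_def)
  have cos: "cos \<theta> < 0" using c cos_monotone_0_pi[of "pi / 2" \<theta>] by simp
  have K0: "(K \<longlongrightarrow> 0) at_top"
  proof -
    have "((\<lambda>R. exp (c2 + R * cos \<theta>) * (R * sin \<theta>) powr a) \<longlongrightarrow> 0) at_top"
      "((\<lambda>R. exp (c2 + R * cos \<theta>) * (c2 + R) powr a) \<longlongrightarrow> 0) at_top"
      using cos sin c2 by real_asymp+
    then have "((\<lambda>R. (c2 - c1) * (exp (c2 + R * cos \<theta>) * (R * sin \<theta>) powr a + exp (c2 + R * cos \<theta>) * (c2 + R) powr a))
       \<longlongrightarrow> (c2 - c1) * (0 + 0)) at_top"
      by (intro tendsto_intros)
    then show ?thesis by (simp add: K_def[abs_def] distrib_left)
  qed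
  have "((\<lambda>R. Im (A (ray c2 \<theta> R)) - Im (A (ray c1 \<theta> R))) \<longlongrightarrow> 0) at_top"
  proof (rule tendsto_rabs_zero_cancel, rule tendsto_sandwich[OF _ _ tendsto_const K0])
    show "\<forall>\<^sub>F R in at_top. \<bar>Im (A (ray c2 \<theta> R)) - Im (A (ray c1 \<theta> R))\<bar> \<le> K R"
      using eventually_gt_at_top[of 0] by eventually_elim (rule diff)
  qed auto
  from tendsto_unique[OF trivial_limit_at_top_linorder this tendsto_diff[OF lim[OF c2] lim[OF c(1)]]]
  show ?thesis by (simp add: ray_transform_def H_def[abs_def])
qed

lemma ray_scale: "of_real t * ray c \<theta> r = ray (t * c) \<theta> (t * r)"
  by (simp add: ray_def algebra_simps)

lemma powr_of_real_mult:
  assumes "t > 0" "(z::complex) \<noteq> 0"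
  shows "(of_real t * z) powr of_real a = of_real (t powr a) * z powr of_real a"
proof -
  have "Ln (of_real t * z) = of_real (ln t) + Ln z"
    using assms by (simp add: Ln_times_of_real Ln_of_real)
  then show ?thesis using assms
    by (simp add: powr_def exp_add distrib_left flip: exp_of_real)
qed

text \<open>Rescaling the ray moves the vertex from \<open>c\<close> to \<open>t * c\<close>, so independence of the vertex is needed to read
  off the dependence on \<open>t\<close>.\<close>

lemma ray_transform_powr_scale:
  assumes c: "0 < c" "pi / 2 < \<theta>" "\<theta> < pi" and t: "t > 0"
  shows "ray_transform c \<theta> (\<lambda>z. z powr of_real (- a)) t = t powr (a - 1) * ray_transform (t * c) \<theta> (\<lambda>z. z powr of_real (- a)) 1"
proof -
  have th: "0 < \<theta>" using c pi_gt_zero by linarith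
  define F where "F r = indicator {0..} r *\<^sub>R (exp (ray (t * c) \<theta> r) * ray (t * c) \<theta> r powr of_real (- a) * cis \<theta>)" for r
  have Fs: "F (0 + t * r) = of_real (t powr (- a)) * (indicator {0..} r *\<^sub>R (exp (of_real t * ray c \<theta> r) * ray c \<theta> r powr of_real (- a) * cis \<theta>))" for r
  proof -
    have "ray c \<theta> r \<noteq> 0" using ray_in_slit_plane[OF c(1) th c(3), of r] by (auto simp: slit_plane_iff)
    from powr_of_real_mult[OF t this, of "- a"]
    show ?thesis using t unfolding F_def by (simp add: indicator_def zero_le_mult_iff flip: ray_scale)
  qed
  have "ray_integral (t * c) \<theta> (\<lambda>z. exp (of_real 1 * z) * z powr of_real (- a)) = (\<integral>r. F r \<partial>lborel)"
    unfolding ray_integral_def set_lebesgue_integral_def F_def by simp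
  also have "\<dots> = \<bar>t\<bar> *\<^sub>R (\<integral>r. F (0 + t * r) \<partial>lborel)"
    using t by (intro lborel_integral_real_affine) auto
  also have "\<dots> = of_real (t powr (1 - a)) * ray_integral c \<theta> (\<lambda>z. exp (of_real t * z) * z powr of_real (- a))"
  proof -
    have "\<bar>t\<bar> * t powr (- a) = t powr (1 - a)" using t by (simp add: powr_diff powr_minus divide_simps)
    then have "\<bar>t\<bar> *\<^sub>R (of_real (t powr (- a)) * w) = of_real (t powr (1 - a)) * w" for w :: complex
      by (metis mult.assoc of_real_mult scaleR_conv_of_real)
    then show ?thesis
      unfolding Fs ray_integral_def set_lebesgue_integral_def integral_mult_right_zero .
  qed
  finally have "ray_transform (t * c) \<theta> (\<lambda>z. z powr of_real (- a)) 1 = t powr (1 - a) * ray_transform c \<theta> (\<lambda>z. z powr of_real (- a)) t"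
    unfolding ray_transform_def by simp
  then show ?thesis using t by (simp add: powr_diff)
qed

lemma Gamma_laplace_integral:
  fixes a s :: real
  assumes "a > 0" "s > 0"
  shows "(LINT t:{0<..}|lborel. exp (- (s * t)) * t powr (a - 1)) = Gamma a * s powr (- a)"
    and "set_integrable lborel {0<..} (\<lambda>t. exp (- (s * t)) * t powr (a - 1))"
proof -
  have hi: "((\<lambda>t. t powr (a - 1) / exp t) has_integral Gamma a) {0..}" by (rule Gamma_integral_real[OF assms(1)])
  then have "(\<lambda>t. t powr (a - 1) / exp t) absolutely_integrable_on {0..}"
    by (intro nonnegative_absolutely_integrable_1) auto
  then have int: "set_integrable lborel {0..} (\<lambda>t. t powr (a - 1) / exp t)"
    unfolding set_integrable_def by (subst (asm) integrable_completion) auto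
  have val: "(LINT t:{0..}|lborel. t powr (a - 1) / exp t) = Gamma a"
    using set_borel_integral_eq_integral(2)[OF int] integral_unique[OF hi] by simp
  define F where "F t = indicator {0..} t *\<^sub>R (t powr (a - 1) / exp t)" for t :: real
  have Fs: "F (0 + s * t) = s powr (a - 1) * (indicator {0..} t *\<^sub>R (exp (- (s * t)) * t powr (a - 1)))" for t
    using assms by (auto simp: F_def indicator_def zero_le_mult_iff powr_mult exp_minus field_simps)
  have "Gamma a = \<bar>s\<bar> *\<^sub>R (\<integral>t. F (0 + s * t) \<partial>lborel)"
    using val lborel_integral_real_affine[of s F 0] assms by (simp add: set_lebesgue_integral_def F_def)
  then have "Gamma a = s powr a * (LINT t:{0..}|lborel. exp (- (s * t)) * t powr (a - 1))"
  proof -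
    assume *: "Gamma a = \<bar>s\<bar> *\<^sub>R (\<integral>t. F (0 + s * t) \<partial>lborel)"
    have "\<bar>s\<bar> * s powr (a - 1) = s powr a" using assms by (simp add: powr_diff)
    then show ?thesis
      using * unfolding Fs set_lebesgue_integral_def integral_mult_right_zero real_scaleR_def
      by (metis mult.assoc)
  qed
  then show "(LINT t:{0<..}|lborel. exp (- (s * t)) * t powr (a - 1)) = Gamma a * s powr (- a)"
    using assms by (simp add: set_integral_Ici_Ioi powr_minus divide_simps)
  have "integrable lborel (\<lambda>t. F (0 + s * t))"
    using int assms by (intro lborel_integrable_real_affine) (auto simp: set_integrable_def F_def[abs_def])
  then show "set_integrable lborel {0<..} (\<lambda>t. exp (- (s * t)) * t powr (a - 1))"
    unfolding Fs set_integral_Ici_Ioi(2)[symmetric] using assms by (simp add: set_integrable_def)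
qed

text \<open>For positive \<open>a\<close> scaling shows that the Bromwich integral of \<open>z powr (- a)\<close> is a multiple of
  \<open>t powr (a - 1)\<close>, and comparing Laplace transforms determines the factor.\<close>

lemma Hankel_pos:
  assumes c: "0 < c" "pi / 2 < \<theta>" "\<theta> < pi" and a: "a > 0"
  shows "ray_transform c \<theta> (\<lambda>z. z powr of_real (- a)) 1 = rGamma a"
proof -
  define G where "G z = z powr of_real (- a)" for z :: complex
  define J where "J = ray_transform c \<theta> G 1"
  have J: "ray_transform c \<theta> G t = t powr (a - 1) * J" if "t > 0" for t
  proof -
    have "ray_transform (t * c) \<theta> G 1 = J"
      unfolding J_def G_def using ray_transform_powr_vertex[of c "t * c" \<theta> "- a"] ray_transform_powr_vertex[of "t * c" c \<theta> "- a"] c that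
      by (cases "c \<le> t * c") auto
    then show ?thesis using ray_transform_powr_scale[OF c that] by (simp add: G_def[abs_def])
  qed
  have "Re (G (of_real (c + 1))) = (LINT t:{0<..}|lborel. exp (- ((c + 1) * t)) * ray_transform c \<theta> G t)"
  proof (rule laplace_ray_transform(2)[symmetric, of c _ \<theta> G a 1])
    show "G holomorphic_on slit_plane"
      unfolding G_def by (intro holomorphic_intros) (auto simp: slit_plane_def)
    show "Im (G (of_real x)) = 0" if "x > 0" for x unfolding G_def slit_powr_real[OF that] by simp
    show "cmod (G z) \<le> 1 * cmod z powr (- a)" for z unfolding G_def norm_powr_of_real by simp
  qed (use c a in auto)
  also have "\<dots> = (LINT t:{0<..}|lborel. (exp (- ((c + 1) * t)) * t powr (a - 1)) * J)"
    by (rule set_lebesgue_integral_cong) (auto simp: J)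
  also have "\<dots> = Gamma a * (c + 1) powr (- a) * J"
    using Gamma_laplace_integral(1)[of a "c + 1"] a c by simp
  also have "Re (G (of_real (c + 1))) = (c + 1) powr (- a)"
    unfolding G_def using c by (subst slit_powr_real) auto
  finally have "Gamma a * J = 1" using c by simp
  then show ?thesis unfolding J_def G_def[abs_def] rGamma_inverse_Gamma
    by (metis inverse_unique)
qed

text \<open>Integration by parts gives the recursion of \<open>rGamma\<close>, which extends the formula from \<open>a > 0\<close> to all real
  \<open>a\<close>.\<close>

lemma Hankel:
  assumes c: "0 < c" "pi / 2 < \<theta>" "\<theta> < pi"
  shows "ray_transform c \<theta> (\<lambda>z. z powr of_real (- a)) 1 = rGamma a"
proof -
  have th: "0 < \<theta>" using c pi_gt_zero by linarith
  have rec: "ray_transform c \<theta> (\<lambda>z. z powr of_real (- a)) 1 = a * ray_transform c \<theta> (\<lambda>z. z powr of_real (- (a + 1))) 1" for a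
  proof -
    define A where "A z = exp z * z powr of_real (- a)" for z :: complex
    define H where "H z = exp z * z powr of_real (- a) - of_real a * (exp z * z powr of_real (- (a + 1)))" for z :: complex
    have A: "(A has_field_derivative H z) (at z)" if "z \<in> slit_plane" for z
    proof -
      have "z \<noteq> 0" "z \<notin> \<real>\<^sub>\<le>\<^sub>0" using that by (auto simp: slit_plane_def)
      then show ?thesis unfolding A_def H_def
        by (auto intro!: derivative_eq_intros simp: algebra_simps minus_diff_commute)
    qed
    have cont: "continuous_on slit_plane H"
      unfolding H_def by (intro continuous_intros continuous_on_slit_powr)
    note int1 = ray_integrable_exp_powr[OF c, of 1 "- a", simplified]
    have int2: "ray_integrable c \<theta> (\<lambda>z. of_real a * (exp z * z powr of_real (- (a + 1))))"
      using ray_integrable_exp_powr[OF c, of 1 "- (a + 1)"] unfolding ray_integrable_def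
      by (intro set_integrable_mult_right) simp
    have intH: "ray_integrable c \<theta> H"
      using ray_integral_diff(2)[OF _ int2, of "\<lambda>z. exp z * z powr of_real (- a)"] int1 by (simp add: H_def[abs_def])
    have lim: "((\<lambda>R. Im (LINT r:{0..R}|lborel. H (ray c \<theta> r) * cis \<theta>)) \<longlongrightarrow> Im (ray_integral c \<theta> H)) at_top"
      by (intro tendsto_Im ray_integral_limit intH)
    have FTC: "\<forall>\<^sub>F R in at_top. Im (LINT r:{0..R}|lborel. H (ray c \<theta> r) * cis \<theta>) = Im (A (ray c \<theta> R))"
      using eventually_ge_at_top[of 0]
    proof eventually_elim
      case (elim R)
      have "Im (A (of_real c)) = 0" unfolding A_def using c
        by (subst slit_powr_real) (auto simp: exp_of_real)
      then show ?case
        using ray_integral_FTC[OF c(1) th c(3) elim A cont] by simp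
    qed
    obtain K where K: "\<And>r. 0 \<le> r \<Longrightarrow> cmod (exp (of_real 1 * ray c \<theta> r)) *
      (cmod (ray c \<theta> r) powr (- a) * exp (cmod (ray c \<theta> r) powr (1/2))) \<le> K * (1 + r) powr (- 2)"
      using ray_exp_decay[OF c, of 1 "1/2"] by auto
    have "((\<lambda>R. Im (A (ray c \<theta> R))) \<longlongrightarrow> 0) at_top"
    proof (rule tendsto_rabs_zero_cancel, rule tendsto_sandwich[OF _ _ tendsto_const])
      show "((\<lambda>R. K * (1 + R) powr (- 2)) \<longlongrightarrow> 0) at_top"
        by (rule tendsto_mult_right_zero) real_asymp
      show "\<forall>\<^sub>F R in at_top. \<bar>Im (A (ray c \<theta> R))\<bar> \<le> K * (1 + R) powr (- 2)"
        using eventually_ge_at_top[of 0]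
      proof eventually_elim
        case (elim R)
        have "\<bar>Im (A (ray c \<theta> R))\<bar> \<le> cmod (A (ray c \<theta> R))" by (rule abs_Im_le_cmod)
        also have "\<dots> = cmod (exp (ray c \<theta> R)) * (cmod (ray c \<theta> R) powr (- a) * 1)"
          unfolding A_def norm_mult norm_powr_of_real by simp
        also have "\<dots> \<le> cmod (exp (of_real 1 * ray c \<theta> R)) *
          (cmod (ray c \<theta> R) powr (- a) * exp (cmod (ray c \<theta> R) powr (1/2)))"
          by (intro mult_mono) auto
        also have "\<dots> \<le> K * (1 + R) powr (- 2)" by (rule K[OF elim])
        finally show ?case .
      qed
    qed auto
    with tendsto_cong[OF FTC] have "((\<lambda>R. Im (LINT r:{0..R}|lborel. H (ray c \<theta> r) * cis \<theta>)) \<longlongrightarrow> 0) at_top" by simp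
    from tendsto_unique[OF trivial_limit_at_top_linorder lim this]
    have "Im (ray_integral c \<theta> H) = 0" .
    moreover have "ray_integral c \<theta> H = ray_integral c \<theta> (\<lambda>z. exp z * z powr of_real (- a)) - of_real a * ray_integral c \<theta> (\<lambda>z. exp z * z powr of_real (- (a + 1)))"
      using ray_integral_diff(1)[OF _ int2, of "\<lambda>z. exp z * z powr of_real (- a)"] int1
      by (simp add: H_def[abs_def] flip: ray_integral_cmult)
    ultimately show ?thesis unfolding ray_transform_def by simp
  qed
  have "\<forall>a. a > - real n \<longrightarrow> ray_transform c \<theta> (\<lambda>z. z powr of_real (- a)) 1 = rGamma a" for n
  proof (induction n)
    case 0
    then show ?case using Hankel_pos[OF c] by simp
  next
    case (Suc n)
    show ?case
    proof (intro allI impI)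
      fix a assume "a > - real (Suc n)"
      then have "ray_transform c \<theta> (\<lambda>z. z powr of_real (- (a + 1))) 1 = rGamma (a + 1)"
        using Suc[rule_format, of "a + 1"] by simp
      then show "ray_transform c \<theta> (\<lambda>z. z powr of_real (- a)) 1 = rGamma a"
        using rec[of a] by (simp add: rGamma_plus1)
    qed
  qed
  moreover obtain n where "- a < real n" using reals_Archimedean2 by blast
  ultimately show ?thesis by (meson minus_less_iff)
qed

lemma ray_transform_powr:
  assumes c: "0 < c" "pi / 2 < \<theta>" "\<theta> < pi" and t: "t > 0"
  shows "ray_transform c \<theta> (\<lambda>z. z powr of_real (- a)) t = t powr (a - 1) * rGamma a"
  using ray_transform_powr_scale[OF c t, of a] Hankel[of "t * c" \<theta> a] c t by simp

section \<open>The Wright series\<close>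

text \<open>For \<open>\<delta> = 0\<close> this is the Laplace transform of the positive stable law of index \<open>\<alpha>\<close>; the factor
  \<open>z powr (- \<delta>)\<close> corresponds to a fractional integral of order \<open>\<delta>\<close>.\<close>

definition stable_symbol :: "real \<Rightarrow> real \<Rightarrow> complex \<Rightarrow> complex" where
  "stable_symbol \<alpha> \<delta> z = z powr of_real (- \<delta>) * exp (- (z powr of_real \<alpha>))"

lemma stable_symbol_holomorphic: "stable_symbol \<alpha> \<delta> holomorphic_on slit_plane"
  unfolding stable_symbol_def by (intro holomorphic_intros) (auto simp: slit_plane_def)

lemma stable_symbol_of_real:
  "x > 0 \<Longrightarrow> stable_symbol \<alpha> \<delta> (of_real x) = of_real (x powr (- \<delta>) * exp (- (x powr \<alpha>)))"
  unfolding stable_symbol_def by (simp only: slit_powr_real of_real_mult exp_of_real flip: of_real_minus)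

lemma Re_powr_of_real:
  assumes "z \<noteq> 0"
  shows "Re (z powr of_real a) = cmod z powr a * cos (a * Arg z)"
  using assms by (simp add: powr_def Re_exp Arg_eq_Im_Ln)

text \<open>In the sector the real part of \<open>z powr \<alpha>\<close> is at least a positive multiple of \<open>\<bar>z\<bar> powr \<alpha>\<close>, because
  \<open>\<alpha> * \<theta> < pi / 2\<close>. One extra negative power is therefore available, which gives a positive exponent of
  decay even for \<open>\<delta> = 0\<close>.\<close>

lemma stable_symbol_bound:
  assumes \<alpha>: "0 < \<alpha>" and \<theta>: "0 \<le> \<theta>" "\<alpha> * \<theta> < pi / 2"
  obtains C where "\<And>z. z \<in> sector \<theta> \<Longrightarrow> cmod (stable_symbol \<alpha> \<delta> z) \<le> C * cmod z powr (- (\<delta> + 1))"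
proof -
  define \<kappa> where "\<kappa> = cos (\<alpha> * \<theta>)"
  have \<kappa>: "\<kappa> > 0" unfolding \<kappa>_def using \<alpha> \<theta> mult_nonneg_nonneg[of \<alpha> \<theta>] by (intro cos_gt_zero_pi) linarith+
  obtain C0 where C0: "\<And>x. 1 \<le> x \<Longrightarrow> x powr (1 / \<alpha>) * exp (- (\<kappa> * x)) \<le> C0"
    using powr_exp_bound[OF \<kappa>] by blast
  define C where "C = max 1 C0"
  have C: "x * exp (- (\<kappa> * x powr \<alpha>)) \<le> C" if x: "x > 0" for x
  proof (cases "x \<le> 1")
    case True
    have "x * exp (- (\<kappa> * x powr \<alpha>)) \<le> 1 * 1" using x \<kappa> True by (intro mult_mono) auto
    then show ?thesis by (simp add: C_def)
  next
    case False
    then have "x powr \<alpha> \<ge> 1" using \<alpha> by (intro ge_one_powr_ge_zero) auto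
    from C0[OF this] have "x * exp (- (\<kappa> * x powr \<alpha>)) \<le> C0" using x \<alpha> by (simp add: powr_powr)
    then show ?thesis by (simp add: C_def)
  qed
  show ?thesis
  proof (rule that[of C])
    fix z assume z: "z \<in> sector \<theta>"
    then have nz: "z \<noteq> 0" and Arg: "0 \<le> Arg z" "Arg z \<le> \<theta>" by (auto simp: sector_def)
    have "\<kappa> \<le> cos (\<alpha> * Arg z)"
    proof -
      have "\<alpha> * \<theta> \<le> pi" using \<theta> pi_gt_zero by linarith
      then show ?thesis unfolding \<kappa>_def using Arg \<alpha> by (intro cos_monotone_0_pi_le mult_left_mono) auto
    qed
    then have Re: "\<kappa> * cmod z powr \<alpha> \<le> Re (z powr of_real \<alpha>)"
      unfolding Re_powr_of_real[OF nz] by (subst mult.commute) (rule mult_left_mono, auto)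
    have "cmod (stable_symbol \<alpha> \<delta> z) = cmod z powr (- \<delta>) * exp (- Re (z powr of_real \<alpha>))"
      unfolding stable_symbol_def norm_mult norm_powr_of_real by simp
    also have "\<dots> \<le> cmod z powr (- \<delta>) * exp (- (\<kappa> * cmod z powr \<alpha>))"
      using Re by (intro mult_left_mono) auto
    also have "cmod z powr (- \<delta>) = cmod z powr (- (\<delta> + 1)) * cmod z"
      using nz powr_add[of "cmod z" "- (\<delta> + 1)" 1] by simp
    also have "cmod z powr (- (\<delta> + 1)) * cmod z * exp (- (\<kappa> * cmod z powr \<alpha>)) \<le> cmod z powr (- (\<delta> + 1)) * C"
      unfolding mult.assoc using C[of "cmod z"] nz by (intro mult_left_mono) auto
    finally show "cmod (stable_symbol \<alpha> \<delta> z) \<le> C * cmod z powr (- (\<delta> + 1))" by (simp add: mult.commute)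
  qed
qed

lemma norm_exp_partial_sum_le:
  fixes w :: complex
  shows "cmod (\<Sum>k<N. w ^ k / fact k) \<le> exp (cmod w)"
proof -
  have "cmod (\<Sum>k<N. w ^ k / fact k) \<le> (\<Sum>k<N. cmod w ^ k / fact k)"
    by (rule order_trans[OF norm_sum]) (simp add: norm_divide norm_power)
  also have "\<dots> \<le> (\<Sum>k. cmod w ^ k / fact k)"
    using summable_exp_generic[of "cmod w"] by (intro sum_le_suminf) (auto simp: divide_inverse_commute)
  also have "\<dots> = exp (cmod w)" by (simp add: exp_def divide_inverse_commute)
  finally show ?thesis .
qed

text \<open>Expanding the exponential in the Bromwich integral and integrating term by term with Hankel's
  formula gives the Wright series.\<close>

lemma wright_series:
  assumes c: "0 < c" "pi / 2 < \<theta>" "\<theta> < pi" and t: "t > 0" and \<alpha>: "0 < \<alpha>" "\<alpha> < 1"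
  shows "(\<lambda>k. (- 1) ^ k * rGamma (\<delta> - \<alpha> * real k) * (t powr (- \<alpha>)) ^ k / fact k) sums
    (t powr (1 - \<delta>) * ray_transform c \<theta> (stable_symbol \<alpha> \<delta>) t)"
proof -
  have th: "0 < \<theta>" using c pi_gt_zero by linarith
  have nz: "ray c \<theta> r \<noteq> 0" for r
    using ray_in_slit_plane[OF c(1) th c(3), of r] by (auto simp: slit_plane_iff)
  obtain K where K: "\<And>r. 0 \<le> r \<Longrightarrow> cmod (exp (of_real t * ray c \<theta> r)) *
    (cmod (ray c \<theta> r) powr (- \<delta>) * exp (cmod (ray c \<theta> r) powr \<alpha>)) \<le> K * (1 + r) powr (- 2)"
    using ray_exp_decay[OF c t \<alpha>] by blast
  define T where "T k z = (- 1) ^ k / fact k * z powr of_real (- (\<delta> - \<alpha> * real k))" for k and z :: complex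
  define S where "S N z = (\<Sum>k<N. T k z)" for N z
  have T_eq: "T k z = z powr of_real (- \<delta>) * ((- (z powr of_real \<alpha>)) ^ k / fact k)" if "z \<noteq> 0" for k z
  proof -
    have "(z powr of_real \<alpha>) ^ k = z powr of_real (\<alpha> * real k)"
      using that by (simp add: powr_def exp_of_nat_mult[symmetric] mult_ac)
    then have "z powr of_real (- (\<delta> - \<alpha> * real k)) = z powr of_real (- \<delta>) * (z powr of_real \<alpha>) ^ k"
      by (simp flip: powr_add)
    then show ?thesis unfolding T_def
      by (subst (2) power_minus) simp
  qed
  have S_eq: "S N z = z powr of_real (- \<delta>) * (\<Sum>k<N. (- (z powr of_real \<alpha>)) ^ k / fact k)" if "z \<noteq> 0" for N z
    unfolding S_def sum_distrib_left using T_eq[OF that] by simp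
  have int_term: "ray_integrable c \<theta> (\<lambda>z. exp (of_real t * z) * z powr of_real a)" for a
    by (rule ray_integrable_exp_powr[OF c t])
  have transform_term: "Im (ray_integral c \<theta> (\<lambda>z. exp (of_real t * z) * T k z)) / pi
     = (- 1) ^ k / fact k * (t powr (\<delta> - \<alpha> * real k - 1) * rGamma (\<delta> - \<alpha> * real k))" for k
  proof -
    define u :: real where "u = (- 1) ^ k / fact k"
    have T_u: "T k z = of_real u * z powr of_real (- (\<delta> - \<alpha> * real k))" for z by (simp add: T_def u_def)
    have "ray_integral c \<theta> (\<lambda>z. exp (of_real t * z) * T k z)
       = of_real u * ray_integral c \<theta> (\<lambda>z. exp (of_real t * z) * z powr of_real (- (\<delta> - \<alpha> * real k)))"
      unfolding ray_integral_cmult[symmetric] by (rule ray_integral_cong) (simp add: T_u)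
    then have "Im (ray_integral c \<theta> (\<lambda>z. exp (of_real t * z) * T k z)) / pi
       = u * ray_transform c \<theta> (\<lambda>z. z powr of_real (- (\<delta> - \<alpha> * real k))) t"
      unfolding ray_transform_def by simp
    then show ?thesis unfolding ray_transform_powr[OF c t] u_def .
  qed
  have int_T: "ray_integrable c \<theta> (\<lambda>z. exp (of_real t * z) * T k z)" for k
  proof -
    have "ray_integrable c \<theta> (\<lambda>z. (- 1) ^ k / fact k * (exp (of_real t * z) * z powr of_real (- (\<delta> - \<alpha> * real k))))"
      using int_term unfolding ray_integrable_def by (rule set_integrable_mult_right)
    then show ?thesis by (simp add: T_def mult_ac)
  qed
  have transform_S: "ray_integrable c \<theta> (\<lambda>z. exp (of_real t * z) * S N z) \<and>
    ray_integral c \<theta> (\<lambda>z. exp (of_real t * z) * S N z) = (\<Sum>k<N. ray_integral c \<theta> (\<lambda>z. exp (of_real t * z) * T k z))" for N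
  proof (induction N)
    case 0
    then show ?case by (simp add: S_def ray_integrable_def ray_integral_def set_integrable_def)
  next
    case (Suc N)
    have "ray_integrable c \<theta> (\<lambda>z. - (exp (of_real t * z) * T N z))" "ray_integral c \<theta> (\<lambda>z. - (exp (of_real t * z) * T N z)) = - ray_integral c \<theta> (\<lambda>z. exp (of_real t * z) * T N z)"
      using int_T[of N] ray_integral_cmult[of c \<theta> "- 1" "\<lambda>z. exp (of_real t * z) * T N z"]
      by (simp_all add: ray_integrable_def set_integrable_def)
    with ray_integral_diff[OF conjunct1[OF Suc] this(1)] Suc show ?case
      by (simp add: S_def distrib_left)
  qed
  have lim: "(\<lambda>N. ray_integral c \<theta> (\<lambda>z. exp (of_real t * z) * S N z)) \<longlonglongrightarrow> ray_integral c \<theta> (\<lambda>z. exp (of_real t * z) * stable_symbol \<alpha> \<delta> z)"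
    unfolding ray_integral_def set_lebesgue_integral_def
  proof (rule integral_dominated_convergence)
    show "integrable lborel (\<lambda>r. indicator {0..} r *\<^sub>R (K * (1 + r) powr (- 2)))"
      using set_integrable_halfline_bound[of "\<lambda>r. K * (1 + r) powr (- 2)" 2 "\<bar>K\<bar>"]
      by (simp add: set_integrable_def abs_mult)
    show "(\<lambda>r. indicator {0..} r *\<^sub>R (exp (of_real t * ray c \<theta> r) * stable_symbol \<alpha> \<delta> (ray c \<theta> r) * cis \<theta>)) \<in> borel_measurable lborel"
      using borel_measurable_comp_ray[OF c(1) th c(3) holomorphic_on_imp_continuous_on[OF stable_symbol_holomorphic], of \<alpha> \<delta>]
      by measurable
    show "(\<lambda>r. indicator {0..} r *\<^sub>R (exp (of_real t * ray c \<theta> r) * S N (ray c \<theta> r) * cis \<theta>)) \<in> borel_measurable lborel" for N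
    proof -
      have "set_integrable lborel {0..} (\<lambda>r. (exp (of_real t * ray c \<theta> r) * S N (ray c \<theta> r)) * cis \<theta>)"
        using transform_S[of N] unfolding ray_integrable_def by (intro set_integrable_mult_left) simp
      then show ?thesis unfolding set_integrable_def by (rule borel_measurable_integrable)
    qed
    show "AE r in lborel. (\<lambda>N. indicator {0..} r *\<^sub>R (exp (of_real t * ray c \<theta> r) * S N (ray c \<theta> r) * cis \<theta>))
      \<longlonglongrightarrow> indicator {0..} r *\<^sub>R (exp (of_real t * ray c \<theta> r) * stable_symbol \<alpha> \<delta> (ray c \<theta> r) * cis \<theta>)"
    proof (intro AE_I2 tendsto_intros)
      fix r
      have "(\<lambda>k. (- (ray c \<theta> r powr of_real \<alpha>)) ^ k / fact k) sums exp (- (ray c \<theta> r powr of_real \<alpha>))"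
        using exp_converges[of "- (ray c \<theta> r powr of_real \<alpha>)"] by (simp add: scaleR_conv_of_real divide_inverse_commute)
      then show "(\<lambda>N. S N (ray c \<theta> r)) \<longlonglongrightarrow> stable_symbol \<alpha> \<delta> (ray c \<theta> r)"
        unfolding S_eq[OF nz] stable_symbol_def sums_def by (intro tendsto_intros)
    qed
    show "AE r in lborel. norm (indicator {0..} r *\<^sub>R (exp (of_real t * ray c \<theta> r) * S N (ray c \<theta> r) * cis \<theta>))
       \<le> indicator {0..} r *\<^sub>R (K * (1 + r) powr (- 2))" for N
    proof (intro AE_I2)
      fix r :: real
      have "cmod (exp (of_real t * ray c \<theta> r) * S N (ray c \<theta> r) * cis \<theta>) \<le> K * (1 + r) powr (- 2)" if r: "0 \<le> r"
      proof -
        have "cmod (S N (ray c \<theta> r)) \<le> cmod (ray c \<theta> r) powr (- \<delta>) * exp (cmod (- (ray c \<theta> r powr of_real \<alpha>)))"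
          unfolding S_eq[OF nz] norm_mult norm_powr_of_real by (intro mult_left_mono norm_exp_partial_sum_le) auto
        also have "\<dots> = cmod (ray c \<theta> r) powr (- \<delta>) * exp (cmod (ray c \<theta> r) powr \<alpha>)"
          unfolding norm_minus_cancel norm_powr_of_real ..
        finally have "cmod (exp (of_real t * ray c \<theta> r)) * cmod (S N (ray c \<theta> r)) \<le> cmod (exp (of_real t * ray c \<theta> r)) *
          (cmod (ray c \<theta> r) powr (- \<delta>) * exp (cmod (ray c \<theta> r) powr \<alpha>))"
          by (intro mult_left_mono) auto
        from order_trans[OF this K[OF r]] show ?thesis by (simp add: norm_mult)
      qed
      then show "norm (indicator {0..} r *\<^sub>R (exp (of_real t * ray c \<theta> r) * S N (ray c \<theta> r) * cis \<theta>))
        \<le> indicator {0..} r *\<^sub>R (K * (1 + r) powr (- 2))" by (simp add: indicator_def)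
    qed
  qed
  have "(\<lambda>N. Im (ray_integral c \<theta> (\<lambda>z. exp (of_real t * z) * S N z)) / pi) \<longlonglongrightarrow> ray_transform c \<theta> (stable_symbol \<alpha> \<delta>) t"
    unfolding ray_transform_def by (intro tendsto_intros lim) simp
  moreover have "Im (ray_integral c \<theta> (\<lambda>z. exp (of_real t * z) * S N z)) / pi
     = (\<Sum>k<N. (- 1) ^ k / fact k * (t powr (\<delta> - \<alpha> * real k - 1) * rGamma (\<delta> - \<alpha> * real k)))" for N
    using transform_S[of N] by (simp add: sum_divide_distrib transform_term)
  ultimately have "(\<lambda>k. (- 1) ^ k / fact k * (t powr (\<delta> - \<alpha> * real k - 1) * rGamma (\<delta> - \<alpha> * real k))) sums ray_transform c \<theta> (stable_symbol \<alpha> \<delta>) t"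
    by (simp add: sums_def)
  then have "(\<lambda>k. t powr (1 - \<delta>) * ((- 1) ^ k / fact k * (t powr (\<delta> - \<alpha> * real k - 1) * rGamma (\<delta> - \<alpha> * real k)))) sums
     (t powr (1 - \<delta>) * ray_transform c \<theta> (stable_symbol \<alpha> \<delta>) t)"
    by (rule sums_mult)
  moreover have "t powr (1 - \<delta>) * ((- 1) ^ k / fact k * (t powr (\<delta> - \<alpha> * real k - 1) * rGamma (\<delta> - \<alpha> * real k)))
     = (- 1) ^ k * rGamma (\<delta> - \<alpha> * real k) * (t powr (- \<alpha>)) ^ k / fact k" for k
  proof -
    have "t powr (1 - \<delta>) * t powr (\<delta> - \<alpha> * real k - 1) = t powr (- \<alpha> * real k)"
      by (simp flip: powr_add)
    also have "\<dots> = (t powr (- \<alpha>)) ^ k" using t by (simp add: powr_powr flip: powr_realpow)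
    finally have "(t powr (- \<alpha>)) ^ k = t powr (1 - \<delta>) * t powr (\<delta> - \<alpha> * real k - 1)" ..
    then show ?thesis by (simp only: divide_inverse mult_ac)
  qed
  ultimately show ?thesis by (simp only:)
qed

section \<open>Complete monotonicity and positivity\<close>

text \<open>Complete monotonicity up to order \<open>n\<close> on the positive half-line. The alternating derivatives enter as
  witnesses of an inductive predicate, so that products, shifts and equations \<open>F' = - p * F\<close> are handled by
  induction on the order.\<close>

fun completely_monotone :: "nat \<Rightarrow> (real \<Rightarrow> real) \<Rightarrow> bool" where
  "completely_monotone 0 f \<longleftrightarrow> (\<forall>x>0. 0 \<le> f x)"
| "completely_monotone (Suc n) f \<longleftrightarrow> (\<forall>x>0. 0 \<le> f x) \<and>
    (\<exists>g. (\<forall>x>0. (f has_real_derivative - g x) (at x)) \<and> completely_monotone n g)"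

lemma completely_monotone_SucI:
  assumes "\<And>x. x > 0 \<Longrightarrow> (f has_real_derivative - g x) (at x)" "completely_monotone n g"
    and "\<forall>x>0. 0 \<le> f x"
  shows "completely_monotone (Suc n) f"
  using assms by auto

lemma completely_monotone_nonneg: "completely_monotone n f \<Longrightarrow> x > 0 \<Longrightarrow> 0 \<le> f x"
  by (cases n) auto

lemma completely_monotone_SucD: "completely_monotone (Suc n) f \<Longrightarrow> completely_monotone n f"
proof (induction n arbitrary: f)
  case (Suc n)
  then obtain g where "\<forall>x>0. (f has_real_derivative - g x) (at x)" "completely_monotone (Suc n) g"
    unfolding completely_monotone.simps(2)[of "Suc n"] by blast
  moreover have "\<forall>x>0. 0 \<le> f x" using Suc.prems by simp
  ultimately show ?case using Suc.IH[of g] by auto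
qed simp

lemma completely_monotone_add:
  "completely_monotone n f \<Longrightarrow> completely_monotone n g \<Longrightarrow> completely_monotone n (\<lambda>x. f x + g x)"
proof (induction n arbitrary: f g)
  case (Suc n)
  from Suc.prems obtain f1 g1 where
    f1: "\<forall>x>0. (f has_real_derivative - f1 x) (at x)" "completely_monotone n f1" and
    g1: "\<forall>x>0. (g has_real_derivative - g1 x) (at x)" "completely_monotone n g1" by auto
  show ?case
  proof (rule completely_monotone_SucI)
    fix x :: real assume x: "x > 0"
    show "((\<lambda>x. f x + g x) has_real_derivative - (f1 x + g1 x)) (at x)"
      using DERIV_add[OF f1(1)[rule_format, OF x] g1(1)[rule_format, OF x]] by simp
  next
    show "completely_monotone n (\<lambda>x. f1 x + g1 x)" by (intro Suc.IH f1 g1)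
    show "\<forall>x>0. 0 \<le> f x + g x" using Suc.prems by simp
  qed
qed simp

lemma completely_monotone_mult:
  "completely_monotone n f \<Longrightarrow> completely_monotone n g \<Longrightarrow> completely_monotone n (\<lambda>x. f x * g x)"
proof (induction n arbitrary: f g)
  case (Suc n)
  from Suc.prems obtain f1 g1 where
    f1: "\<forall>x>0. (f has_real_derivative - f1 x) (at x)" "completely_monotone n f1" and
    g1: "\<forall>x>0. (g has_real_derivative - g1 x) (at x)" "completely_monotone n g1" by auto
  show ?case
  proof (rule completely_monotone_SucI)
    fix x :: real assume x: "x > 0"
    show "((\<lambda>x. f x * g x) has_real_derivative - (f1 x * g x + f x * g1 x)) (at x)"
      using DERIV_mult[OF f1(1)[rule_format, OF x] g1(1)[rule_format, OF x]] by (simp add: algebra_simps)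
  next
    show "completely_monotone n (\<lambda>x. f1 x * g x + f x * g1 x)"
      by (intro completely_monotone_add Suc.IH Suc.prems[THEN completely_monotone_SucD] f1 g1)
    show "\<forall>x>0. 0 \<le> f x * g x" using Suc.prems by simp
  qed
qed simp

lemma completely_monotone_powr:
  "0 \<le> a \<Longrightarrow> 0 \<le> p \<Longrightarrow> completely_monotone n (\<lambda>x. a * x powr (- p))"
proof (induction n arbitrary: a p)
  case (Suc n)
  have "((\<lambda>x. a * x powr (- p)) has_real_derivative - (a * p * x powr (- (p + 1)))) (at x)" if "x > 0" for x
    using that by (auto intro!: derivative_eq_intros)
  moreover have "completely_monotone n (\<lambda>x. a * p * x powr (- (p + 1)))"
    using Suc.prems by (intro Suc.IH) auto
  moreover have "\<forall>x>0. 0 \<le> a * x powr (- p)" using Suc.prems by simp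
  ultimately show ?case by (rule completely_monotone_SucI)
qed simp

text \<open>The derivative is \<open>- p * F\<close> with \<open>p\<close> a sum of negative powers, so complete monotonicity propagates from
  each order to the next by the product rule.\<close>

lemma completely_monotone_stable:
  assumes "0 < \<alpha>" "\<alpha> < 1" "0 \<le> \<delta>"
  shows "completely_monotone n (\<lambda>x. x powr (- \<delta>) * exp (- (x powr \<alpha>)))"
proof (induction n)
  case (Suc n)
  let ?F = "\<lambda>x. x powr (- \<delta>) * exp (- (x powr \<alpha>))"
  let ?p = "\<lambda>x. \<delta> * x powr (- 1) + \<alpha> * x powr (- (1 - \<alpha>))"
  have "(?F has_real_derivative - (?p x * ?F x)) (at x)" if "x > 0" for x
  proof -
    have 1: "x powr (- \<delta> - 1) = x powr (- \<delta>) * x powr (- 1)" using powr_add[of x "- \<delta>" "- 1"] by simp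
    have 2: "x powr (\<alpha> - 1) = x powr (- (1 - \<alpha>))" by simp
    have d1: "((\<lambda>x. x powr (- \<delta>)) has_real_derivative - \<delta> * x powr (- \<delta> - 1)) (at x)"
      by (rule has_real_derivative_powr[OF that])
    have d2: "((\<lambda>x. - (x powr \<alpha>)) has_real_derivative - (\<alpha> * x powr (\<alpha> - 1))) (at x)"
      by (rule DERIV_minus[OF has_real_derivative_powr[OF that]])
    show ?thesis
      by (rule DERIV_cong[OF DERIV_mult[OF d1 DERIV_chain2[OF DERIV_exp d2]]])
        (simp only: 1 2, algebra)
  qed
  moreover have "completely_monotone n (\<lambda>x. ?p x * ?F x)"
    using assms by (intro completely_monotone_mult completely_monotone_add completely_monotone_powr Suc) auto
  moreover have "\<forall>x>0. 0 \<le> ?F x" by simp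
  ultimately show ?case by (rule completely_monotone_SucI)
qed simp

lemma completely_monotone_diff:
  "completely_monotone (Suc n) f \<Longrightarrow> completely_monotone n (\<lambda>x. f x - f (x + 1))"
proof (induction n arbitrary: f)
  case 0
  then obtain g where g: "\<forall>x>0. (f has_real_derivative - g x) (at x)" "\<forall>x>0. 0 \<le> g x" by auto
  have "f (x + 1) \<le> f x" if "x > 0" for x
  proof (rule DERIV_nonpos_imp_nonincreasing[of x "x + 1" f])
    fix y assume "x \<le> y"
    then show "\<exists>z. (f has_real_derivative z) (at y) \<and> z \<le> 0"
      using g that by (intro exI[of _ "- g y"]) simp
  qed simp
  then show ?case by simp
next
  case (Suc n)
  then obtain g where g: "\<forall>x>0. (f has_real_derivative - g x) (at x)" "completely_monotone (Suc n) g"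
    unfolding completely_monotone.simps(2)[of "Suc n"] by blast
  have "((\<lambda>x. f x - f (x + 1)) has_real_derivative - (g x - g (x + 1))) (at x)" if "x > 0" for x
  proof -
    have "((\<lambda>x. f (x + 1)) has_real_derivative - g (x + 1)) (at x)"
      using g(1) that DERIV_shift[of f "- g (x + 1)" x 1] by simp
    moreover have "(f has_real_derivative - g x) (at x)" using g that by simp
    ultimately show ?thesis by (auto intro!: derivative_eq_intros)
  qed
  moreover have "completely_monotone n (\<lambda>x. g x - g (x + 1))" by (rule Suc.IH[OF g(2)])
  moreover have "\<forall>x>0. 0 \<le> f x - f (x + 1)"
  proof -
    have "f (x + 1) \<le> f x" if "x > 0" for x
    proof (rule DERIV_nonpos_imp_nonincreasing[of x "x + 1" f])
      fix y assume "x \<le> y"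
      then have "y > 0" using that by simp
      then show "\<exists>z. (f has_real_derivative z) (at y) \<and> z \<le> 0"
        using g(1) completely_monotone_nonneg[OF g(2), of y] by (intro exI[of _ "- g y"]) simp
    qed simp
    then show ?thesis by simp
  qed
  ultimately show ?case by (rule completely_monotone_SucI)
qed

text \<open>Alternating differences of the Laplace transform are integrals of \<open>g\<close> against the Bernstein
  polynomials in \<open>exp (- t)\<close>, so complete monotonicity of the transform makes these nonnegative.\<close>

lemma laplace_Bernstein_nonneg:
  assumes int: "\<And>s. s > 0 \<Longrightarrow> set_integrable lborel {0<..} (\<lambda>t. exp (- (s * t)) * g t)"
    and F: "\<And>s. s > 0 \<Longrightarrow> (LINT t:{0<..}|lborel. exp (- (s * t)) * g t) = F s"
    and cm: "\<And>n. completely_monotone n F" and s: "s > 0"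
  shows "set_integrable lborel {0<..} (\<lambda>t. exp (- (s * t)) * (1 - exp (- t)) ^ m * g t)"
    and "0 \<le> (LINT t:{0<..}|lborel. exp (- (s * t)) * (1 - exp (- t)) ^ m * g t)"
proof -
  have "(\<forall>s>0. set_integrable lborel {0<..} (\<lambda>t. exp (- (s * t)) * (1 - exp (- t)) ^ m * g t)) \<and>
    (\<exists>F. (\<forall>n. completely_monotone n F) \<and>
      (\<forall>s>0. (LINT t:{0<..}|lborel. exp (- (s * t)) * (1 - exp (- t)) ^ m * g t) = F s))"
  proof (induction m)
    case 0
    then show ?case using int F cm by auto
  next
    case (Suc m)
    then obtain F where I: "\<And>s. s > 0 \<Longrightarrow> set_integrable lborel {0<..} (\<lambda>t. exp (- (s * t)) * (1 - exp (- t)) ^ m * g t)"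
      and F: "\<And>n. completely_monotone n F"
        "\<And>s. s > 0 \<Longrightarrow> (LINT t:{0<..}|lborel. exp (- (s * t)) * (1 - exp (- t)) ^ m * g t) = F s" by blast
    have eq: "exp (- (s * t)) * (1 - exp (- t)) ^ Suc m * g t
      = exp (- (s * t)) * (1 - exp (- t)) ^ m * g t - exp (- ((s + 1) * t)) * (1 - exp (- t)) ^ m * g t" for s t
    proof -
      have "exp (- ((s + 1) * t)) = exp (- (s * t)) * exp (- t)"
        by (simp add: algebra_simps flip: exp_add)
      then show ?thesis by (simp add: algebra_simps)
    qed
    have "set_integrable lborel {0<..} (\<lambda>t. exp (- (s * t)) * (1 - exp (- t)) ^ Suc m * g t)" if "s > 0" for s
      unfolding eq using that by (intro set_integral_diff I) auto
    moreover have "(LINT t:{0<..}|lborel. exp (- (s * t)) * (1 - exp (- t)) ^ Suc m * g t) = F s - F (s + 1)" if "s > 0" for s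
      unfolding eq using that by (subst set_integral_diff) (auto intro: I simp: F(2))
    moreover have "completely_monotone n (\<lambda>s. F s - F (s + 1))" for n
      by (intro completely_monotone_diff F)
    ultimately show ?case by blast
  qed
  then show "set_integrable lborel {0<..} (\<lambda>t. exp (- (s * t)) * (1 - exp (- t)) ^ m * g t)"
    and "0 \<le> (LINT t:{0<..}|lborel. exp (- (s * t)) * (1 - exp (- t)) ^ m * g t)"
    using s by (auto simp: completely_monotone_nonneg)
qed

text \<open>Uniform approximation of \<open>h\<close> by its Bernstein polynomials, which have nonnegative coefficients.\<close>

lemma laplace_continuous_nonneg:
  assumes int: "\<And>s. s > 0 \<Longrightarrow> set_integrable lborel {0<..} (\<lambda>t. exp (- (s * t)) * g t)"
    and F: "\<And>s. s > 0 \<Longrightarrow> (LINT t:{0<..}|lborel. exp (- (s * t)) * g t) = F s"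
    and cm: "\<And>n. completely_monotone n F"
    and h: "continuous_on UNIV h" "\<And>x. 0 \<le> h x"
  shows "set_integrable lborel {0<..} (\<lambda>t. h (exp (- t)) * (exp (- t) * g t))"
    and "0 \<le> (LINT t:{0<..}|lborel. h (exp (- t)) * (exp (- t) * g t))"
proof -
  have int1: "set_integrable lborel {0<..} (\<lambda>t. exp (- t) * g t)" using int[of 1] by simp
  have [measurable]: "h \<in> borel_measurable borel" by (rule borel_measurable_continuous_onI[OF h(1)])
  define I where "I = (LINT t:{0<..}|lborel. \<bar>exp (- t) * g t\<bar>)"
  have I: "I \<ge> 0" unfolding I_def set_lebesgue_integral_def by (intro integral_nonneg_AE AE_I2) auto
  have "compact (h ` {0..1})" using h by (intro compact_continuous_image continuous_on_subset[OF h(1)]) auto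
  then obtain M where M: "\<And>x. x \<in> {0..1} \<Longrightarrow> h x \<le> M"
    using compact_imp_bounded[THEN bounded_has_Sup(1)] by (metis image_eqI empty_iff)
  have meas: "(\<lambda>t. indicator {0<..} t *\<^sub>R (exp (- t) * g t)) \<in> borel_measurable lborel"
    using int1 unfolding set_integrable_def by (rule borel_measurable_integrable)
  show int_h: "set_integrable lborel {0<..} (\<lambda>t. h (exp (- t)) * (exp (- t) * g t))"
    unfolding set_integrable_def
  proof (rule Bochner_Integration.integrable_bound)
    show "integrable lborel (\<lambda>t. M * (indicator {0<..} t *\<^sub>R (exp (- t) * g t)))"
      using int1 unfolding set_integrable_def by (rule integrable_mult_right)
    have "(\<lambda>t. h (exp (- t)) * (indicator {0<..} t *\<^sub>R (exp (- t) * g t))) \<in> borel_measurable lborel"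
      using meas by measurable
    then show "(\<lambda>t. indicator {0<..} t *\<^sub>R (h (exp (- t)) * (exp (- t) * g t))) \<in> borel_measurable lborel"
      by (simp add: mult_ac)
    show "AE t in lborel. norm (indicator {0<..} t *\<^sub>R (h (exp (- t)) * (exp (- t) * g t)))
       \<le> norm (M * (indicator {0<..} t *\<^sub>R (exp (- t) * g t)))"
    proof (intro AE_I2)
      fix t :: real
      have "\<bar>h (exp (- t))\<bar> \<le> \<bar>M\<bar>" if "t > 0"
        using M[of "exp (- t)"] h(2)[of "exp (- t)"] that by simp
      then show "norm (indicator {0<..} t *\<^sub>R (h (exp (- t)) * (exp (- t) * g t)))
       \<le> norm (M * (indicator {0<..} t *\<^sub>R (exp (- t) * g t)))"
        by (simp add: indicator_def abs_mult mult_right_mono)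
    qed
  qed
  have approx: "- (e * I) \<le> (LINT t:{0<..}|lborel. h (exp (- t)) * (exp (- t) * g t))" if e: "e > 0" for e
  proof -
    obtain n where n: "\<And>x. x \<in> {0..1} \<Longrightarrow> \<bar>h x - (\<Sum>k\<le>n. h (real k / real n) * Bernstein n k x)\<bar> < e"
      using Bernstein_Weierstrass[of h e] e continuous_on_subset[OF h(1)] by blast
    define B where "B x = (\<Sum>k\<le>n. h (real k / real n) * Bernstein n k x)" for x
    define T where "T k t = h (real k / real n) * real (n choose k) * (exp (- ((real k + 1) * t)) * (1 - exp (- t)) ^ (n - k) * g t)" for k t
    have T: "set_integrable lborel {0<..} (T k)" "0 \<le> (LINT t:{0<..}|lborel. T k t)" for k
      unfolding T_def using laplace_Bernstein_nonneg[OF int F cm, of "real k + 1" "n - k"] h(2)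
      by (auto intro!: mult_nonneg_nonneg)
    have B_eq: "B (exp (- t)) * (exp (- t) * g t) = (\<Sum>k\<le>n. T k t)" for t
    proof -
      have "exp (- ((real k + 1) * t)) = exp (- t) ^ k * exp (- t)" for k
        by (simp add: algebra_simps flip: exp_of_nat_mult exp_add)
      then show ?thesis unfolding B_def sum_distrib_right T_def Bernstein_def
        by (intro sum.cong refl) (simp add: mult_ac)
    qed
    have int_B: "set_integrable lborel {0<..} (\<lambda>t. B (exp (- t)) * (exp (- t) * g t))"
      unfolding B_eq using T(1) unfolding set_integrable_def scaleR_sum_right
      by (intro Bochner_Integration.integrable_sum) auto
    have "0 \<le> (LINT t:{0<..}|lborel. B (exp (- t)) * (exp (- t) * g t))"
    proof -
      have "(LINT t:{0<..}|lborel. B (exp (- t)) * (exp (- t) * g t)) = (\<Sum>k\<le>n. LINT t:{0<..}|lborel. T k t)"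
        unfolding B_eq using T(1) unfolding set_lebesgue_integral_def set_integrable_def scaleR_sum_right
        by (intro Bochner_Integration.integral_sum) auto
      then show ?thesis using T(2) by (simp add: sum_nonneg)
    qed
    moreover have "(LINT t:{0<..}|lborel. B (exp (- t)) * (exp (- t) * g t)) - (LINT t:{0<..}|lborel. h (exp (- t)) * (exp (- t) * g t))
       \<le> e * I"
    proof -
      have "(LINT t:{0<..}|lborel. B (exp (- t)) * (exp (- t) * g t)) - (LINT t:{0<..}|lborel. h (exp (- t)) * (exp (- t) * g t))
        = (LINT t:{0<..}|lborel. B (exp (- t)) * (exp (- t) * g t) - h (exp (- t)) * (exp (- t) * g t))"
        using int_B int_h by (rule set_integral_diff(2)[symmetric])
      also have "\<dots> \<le> (LINT t:{0<..}|lborel. e * \<bar>exp (- t) * g t\<bar>)"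
      proof (rule set_integral_mono)
        show "set_integrable lborel {0<..} (\<lambda>t. B (exp (- t)) * (exp (- t) * g t) - h (exp (- t)) * (exp (- t) * g t))"
          using int_B int_h by (rule set_integral_diff)
        show "set_integrable lborel {0<..} (\<lambda>t. e * \<bar>exp (- t) * g t\<bar>)"
          using int1 by (intro set_integrable_mult_right set_integrable_abs)
        fix t :: real assume "t \<in> {0<..}"
        then have "\<bar>B (exp (- t)) - h (exp (- t))\<bar> \<le> e"
          using n[of "exp (- t)"] by (simp add: B_def abs_minus_commute)
        then have "\<bar>B (exp (- t)) - h (exp (- t))\<bar> * \<bar>exp (- t) * g t\<bar> \<le> e * \<bar>exp (- t) * g t\<bar>"
          by (intro mult_right_mono) auto
        then show "B (exp (- t)) * (exp (- t) * g t) - h (exp (- t)) * (exp (- t) * g t) \<le> e * \<bar>exp (- t) * g t\<bar>"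
          unfolding left_diff_distrib[symmetric] abs_mult[symmetric] by linarith
      qed
      finally show ?thesis by (simp add: I_def)
    qed
    ultimately show ?thesis by linarith
  qed
  show "0 \<le> (LINT t:{0<..}|lborel. h (exp (- t)) * (exp (- t) * g t))"
  proof (rule field_le_epsilon)
    fix e :: real assume e: "0 < e"
    have "- (e / (I + 1) * I) \<le> (LINT t:{0<..}|lborel. h (exp (- t)) * (exp (- t) * g t))"
      using e I by (intro approx) auto
    moreover have "e / (I + 1) * I \<le> e" using e I by (simp add: field_simps)
    ultimately show "0 \<le> (LINT t:{0<..}|lborel. h (exp (- t)) * (exp (- t) * g t)) + e" by linarith
  qed
qed

text \<open>The direction of Bernstein's theorem that is needed here: test against a bump in \<open>exp (- t)\<close> supported
  where \<open>g\<close> would be negative.\<close>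

lemma completely_monotone_laplace_nonneg:
  assumes int: "\<And>s. s > 0 \<Longrightarrow> set_integrable lborel {0<..} (\<lambda>t. exp (- (s * t)) * g t)"
    and F: "\<And>s. s > 0 \<Longrightarrow> (LINT t:{0<..}|lborel. exp (- (s * t)) * g t) = F s"
    and cm: "\<And>n. completely_monotone n F"
    and cont: "continuous_on {0<..} g" and t0: "t0 > 0"
  shows "0 \<le> g t0"
proof (rule ccontr)
  assume neg: "\<not> 0 \<le> g t0"
  have "isCont g t0" using cont t0 by (simp add: continuous_on_eq_continuous_at)
  then have "\<forall>\<^sub>F t in at t0. g t < 0"
    using neg by (auto simp: isCont_def intro: order_tendstoD)
  then obtain d0 where d0: "d0 > 0" "\<And>t. dist t t0 < d0 \<Longrightarrow> g t < 0"
    using neg unfolding eventually_at by (metis UNIV_I linorder_not_le)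
  define d where "d = min d0 t0"
  have d: "d > 0" "d \<le> t0" "\<And>t. \<bar>t - t0\<bar> < d \<Longrightarrow> g t < 0"
    using d0 t0 by (auto simp: d_def dist_real_def)
  define h where "h x = max 0 (min (x - exp (- (t0 + d))) (exp (- (t0 - d)) - x))" for x
  have h: "continuous_on UNIV h" "\<And>x. 0 \<le> h x"
    unfolding h_def by (auto intro!: continuous_intros)
  define \<phi> where "\<phi> t = - (indicator {0<..} t *\<^sub>R (h (exp (- t)) * (exp (- t) * g t)))" for t
  have h_pos: "h (exp (- t)) > 0 \<longleftrightarrow> \<bar>t - t0\<bar> < d" for t
  proof -
    have "h (exp (- t)) > 0 \<longleftrightarrow> exp (- (t0 + d)) < exp (- t) \<and> exp (- t) < exp (- (t0 - d))"
      unfolding h_def less_max_iff_disj min_less_iff_conj by auto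
    then show ?thesis by auto
  qed
  have \<phi>_nonneg: "0 \<le> \<phi> t" for t
  proof (cases "\<bar>t - t0\<bar> < d")
    case True
    then show ?thesis using d(3)[of t] h(2)[of "exp (- t)"]
      by (auto simp: \<phi>_def indicator_def mult_le_0_iff zero_le_mult_iff less_imp_le)
  next
    case False
    then have "h (exp (- t)) = 0" using h_pos[of t] h(2)[of "exp (- t)"] by auto
    then show ?thesis by (simp add: \<phi>_def)
  qed
  note I = laplace_continuous_nonneg[OF int F cm h]
  have int_\<phi>: "integrable lborel \<phi>" unfolding \<phi>_def using I(1) unfolding set_integrable_def by (rule integrable_minus)
  have "(\<integral>t. \<phi> t \<partial>lborel) \<le> 0" unfolding \<phi>_def using I(2) unfolding set_lebesgue_integral_def by simp
  moreover have "0 \<le> (\<integral>t. \<phi> t \<partial>lborel)" by (intro integral_nonneg_AE AE_I2 \<phi>_nonneg)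
  ultimately have "(\<integral>t. \<phi> t \<partial>lborel) = 0" by simp
  then have "AE t in lborel. \<phi> t = 0"
    using integral_nonneg_eq_0_iff_AE[OF int_\<phi>] \<phi>_nonneg by simp
  moreover have "\<phi> t \<noteq> 0" if "t \<in> {t0 - d<..<t0 + d}" for t
  proof -
    have "\<bar>t - t0\<bar> < d" "t > 0" using that d by auto
    then show ?thesis using h_pos[of t] d(3)[of t] by (simp add: \<phi>_def)
  qed
  ultimately have "AE t in lborel. t \<notin> {t0 - d<..<t0 + d}" by (auto elim!: eventually_mono)
  then have "emeasure lborel {t0 - d<..<t0 + d} = 0"
    by (subst (asm) AE_iff_measurable[of "{t0 - d<..<t0 + d}"]) auto
  then show False using d by simp
qed

section \<open>The density and its Laplace transform\<close>

lemma nn_integral_powr_substitution: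
  fixes f h :: "real \<Rightarrow> real"
  assumes \<alpha>: "\<alpha> > 0" and u: "u > 0" and [measurable]: "f \<in> borel_measurable borel"
    and f0: "\<And>x. x > 0 \<Longrightarrow> 0 \<le> f x"
    and h: "set_integrable lborel {0<..} h"
    and eq: "\<And>t. t > 0 \<Longrightarrow> u * (\<alpha> * t powr (\<alpha> - 1)) * f (u * t powr \<alpha>) = h t"
  shows "(\<integral>\<^sup>+x. ennreal (f x) * indicator {0<..} x \<partial>lborel) = ennreal (LINT t:{0<..}|lborel. h t)"
proof -
  let ?g = "\<lambda>t. u * t powr \<alpha>" and ?d = "\<lambda>t. u * (\<alpha> * t powr (\<alpha> - 1))"
  have img: "?g ` {0<..} = {0<..}"
  proof (intro equalityI subsetI)
    fix x :: real assume "x \<in> {0<..}"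
    then have "x = ?g ((x / u) powr (1 / \<alpha>))" "(x / u) powr (1 / \<alpha>) > 0"
      using u \<alpha> by (auto simp: powr_powr)
    then show "x \<in> ?g ` {0<..}" by blast
  qed (use u in auto)
  have "f absolutely_integrable_on (?g ` {0<..}) \<and> integral (?g ` {0<..}) f = (LINT t:{0<..}|lborel. h t)"
  proof (rule iffD1[OF has_absolute_integral_change_of_variables_1'[where g' = ?d]])
    show "(?g has_real_derivative ?d x) (at x within {0<..})" if "x \<in> {0<..}" for x
      by (intro DERIV_cmult has_field_derivative_at_within[OF has_real_derivative_powr]) (use that in auto)
    show "inj_on ?g {0<..}"
    proof (rule inj_onI)
      fix x y assume "x \<in> {0<..}" "y \<in> {0<..}" "?g x = ?g y"
      then have "(x powr \<alpha>) powr (1 / \<alpha>) = (y powr \<alpha>) powr (1 / \<alpha>)" "x > 0" "y > 0" using u by auto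
      then show "x = y" using \<alpha> by (simp add: powr_powr)
    qed
    have hi: "h absolutely_integrable_on {0<..}"
      using h unfolding set_integrable_def by (subst integrable_completion) (auto dest: borel_measurable_integrable)
    have abs: "\<bar>?d t\<bar> * f (?g t) = h t" if "t \<in> {0<..}" for t
      using eq[of t] that u \<alpha> by (simp add: abs_mult)
    have "integral {0<..} (\<lambda>t. \<bar>?d t\<bar> * f (?g t)) = integral {0<..} h" by (rule integral_cong) (rule abs)
    moreover have "(\<lambda>t. \<bar>?d t\<bar> * f (?g t)) absolutely_integrable_on {0<..}"
      by (subst set_integrable_cong[OF refl refl abs]) (use hi in auto)
    ultimately show "(\<lambda>t. \<bar>?d t\<bar> * f (?g t)) absolutely_integrable_on {0<..} \<and>
       integral {0<..} (\<lambda>t. \<bar>?d t\<bar> * f (?g t)) = (LINT t:{0<..}|lborel. h t)"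
      using set_borel_integral_eq_integral(2)[OF h] by simp
  qed auto
  then have f: "f absolutely_integrable_on {0<..}" "integral {0<..} f = (LINT t:{0<..}|lborel. h t)"
    unfolding img by auto
  have "f integrable_on {0<..}" using f(1) by (rule set_lebesgue_integral_eq_integral)
  with f(2) have hasf: "(f has_integral (LINT t:{0<..}|lborel. h t)) {0<..}" by (simp add: has_integral_iff)
  have "0 \<le> f x" if "x \<in> {0<..}" for x using f0 that by simp
  from nn_integral_has_integral_lebesgue[OF this hasf]
  have "(\<integral>\<^sup>+x. ennreal (indicator {0<..} x * f x) \<partial>lborel) = ennreal (LINT t:{0<..}|lborel. h t)"
    by (simp add: nn_integral_completion)
  moreover have "ennreal (indicator {0<..} x * f x) = ennreal (f x) * indicator {0<..} x" for x
    by (simp add: indicator_def)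
  ultimately show ?thesis by simp
qed

locale gauss_laguerre =
  fixes \<alpha> \<beta> :: real
  assumes \<alpha>_pos: "0 < \<alpha>" and \<alpha>_less_1: "\<alpha> < 1" and \<beta>_ge: "1 - 1 / \<alpha> \<le> \<beta>"
begin

definition "b = \<alpha> * \<beta> + 1"
definition "\<delta> = b - \<alpha>"

lemma \<delta>_nonneg: "0 \<le> \<delta>"
  using \<alpha>_pos \<beta>_ge by (simp add: \<delta>_def b_def field_simps)

lemma b_pos: "0 < b"
  using \<delta>_nonneg \<alpha>_pos by (simp add: \<delta>_def)

lemma Gamma_b_pos: "0 < Gamma b"
  by (rule Gamma_real_pos[OF b_pos])

abbreviation "dens \<equiv> (gauss_laguerre_lambda \<alpha> \<beta> :: real \<Rightarrow> real)"

text \<open>Midpoint of the admissible interval of angles.\<close>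

definition "angle = (pi / 2 + min pi (pi / (2 * \<alpha>))) / 2"

lemma angle: "pi / 2 < angle" "angle < pi" "\<alpha> * angle < pi / 2"
proof -
  have "pi / 2 < pi / (2 * \<alpha>)" using \<alpha>_pos \<alpha>_less_1 by (simp add: field_simps)
  then have *: "pi / 2 < min pi (pi / (2 * \<alpha>))" by simp
  then show "pi / 2 < angle" "angle < pi" by (simp_all add: angle_def min_def split: if_splits)
  have "(p + m) / 2 < x" if "p < m" "m \<le> x" for p m x :: real using that by simp
  from this[OF * min.cobounded2] have "angle < pi / (2 * \<alpha>)" unfolding angle_def .
  then show "\<alpha> * angle < pi / 2" using \<alpha>_pos by (simp add: field_simps)
qed

lemma lambda_sums:
  assumes c: "0 < c" and t: "t > 0"
  shows "(\<lambda>k. (- 1) ^ k * rGamma (\<delta> - \<alpha> * real k) / fact k * (t powr (- \<alpha>)) ^ k) sums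
    (t powr (1 - \<delta>) * ray_transform c angle (stable_symbol \<alpha> \<delta>) t)"
  using wright_series[OF c angle(1,2) t \<alpha>_pos \<alpha>_less_1, of \<delta>] by (simp add: mult_ac)

lemma lambda_eq: "dens y = Gamma b * (\<Sum>k. (- 1) ^ k * rGamma (\<delta> - \<alpha> * real k) / fact k * y ^ k)"
proof -
  have "1 - (\<alpha> * real k + \<alpha> * (1 - \<beta>)) = \<delta> - \<alpha> * real k" for k
    by (simp add: \<delta>_def b_def algebra_simps)
  then show ?thesis unfolding gauss_laguerre_lambda_def by (simp only: of_real_eq_id id_apply b_def times_divide_eq_left)
qed

lemma lambda_ray_transform:
  assumes c: "0 < c" and t: "t > 0"
  shows "dens (t powr (- \<alpha>)) = Gamma b * (t powr (1 - \<delta>) * ray_transform c angle (stable_symbol \<alpha> \<delta>) t)"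
  unfolding lambda_eq using lambda_sums[OF c t] by (simp add: sums_iff)

text \<open>Every positive number has the form \<open>t powr (- \<alpha>)\<close>, so the power series converges everywhere.\<close>

lemma lambda_continuous: "continuous_on UNIV dens"
proof -
  have "isCont (\<lambda>y. \<Sum>k. (- 1) ^ k * rGamma (\<delta> - \<alpha> * real k) / fact k * y ^ k) x" for x :: real
  proof (rule isCont_powser)
    define t where "t = (\<bar>x\<bar> + 1) powr (- 1 / \<alpha>)"
    have t: "t > 0" "t powr (- \<alpha>) = \<bar>x\<bar> + 1" using \<alpha>_pos by (simp_all add: t_def powr_powr)
    show "summable (\<lambda>k. (- 1) ^ k * rGamma (\<delta> - \<alpha> * real k) / fact k * (\<bar>x\<bar> + 1) ^ k)"
      using lambda_sums[of 1 t] t by (simp add: sums_iff)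
  qed simp
  then show ?thesis unfolding lambda_eq[abs_def]
    by (auto intro!: continuous_intros simp: continuous_on_eq_continuous_at)
qed

lemma borel_measurable_lambda [measurable]: "dens \<in> borel_measurable borel"
  by (rule borel_measurable_continuous_onI[OF lambda_continuous])

lemma lambda_laplace:
  assumes s: "s > 0"
  shows "set_integrable lborel {0<..} (\<lambda>t. exp (- (s * t)) * (t powr (\<delta> - 1) * dens (t powr (- \<alpha>))))"
    and "(LINT t:{0<..}|lborel. exp (- (s * t)) * (t powr (\<delta> - 1) * dens (t powr (- \<alpha>)))) =
      Gamma b * (s powr (- \<delta>) * exp (- (s powr \<alpha>)))"
proof -
  \<comment> \<open>the vertex may be any point of the interval from \<open>0\<close> to \<open>s\<close>, as \<open>\<lambda>\<close> does not depend on it\<close>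
  define c where "c = s / 2"
  have c: "0 < c" "c < s" using s by (simp_all add: c_def)
  have eq: "exp (- (s * t)) * (t powr (\<delta> - 1) * dens (t powr (- \<alpha>)))
     = Gamma b * (exp (- (s * t)) * ray_transform c angle (stable_symbol \<alpha> \<delta>) t)" if "t > 0" for t
  proof -
    have "t powr (\<delta> - 1) * t powr (1 - \<delta>) = 1" using that by (simp flip: powr_add)
    then show ?thesis unfolding lambda_ray_transform[OF c(1) that] by (simp add: algebra_simps)
  qed
  have "0 \<le> angle" using angle(1) pi_gt_zero by linarith
  then obtain C where C: "\<And>z. z \<in> sector angle \<Longrightarrow> cmod (stable_symbol \<alpha> \<delta> z) \<le> C * cmod z powr (- (\<delta> + 1))"
    using stable_symbol_bound[OF \<alpha>_pos _ angle(3)] by blast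
  have real: "Im (stable_symbol \<alpha> \<delta> (of_real x)) = 0" if "x > 0" for x
    unfolding stable_symbol_of_real[OF that] by (rule Im_complex_of_real)
  have \<delta>1: "\<delta> + 1 > 0" using \<delta>_nonneg by simp
  note L = laplace_ray_transform[OF c angle(1,2) stable_symbol_holomorphic real \<delta>1 C]
  show "set_integrable lborel {0<..} (\<lambda>t. exp (- (s * t)) * (t powr (\<delta> - 1) * dens (t powr (- \<alpha>))))"
    using set_integrable_mult_right[OF L(1), of "Gamma b"]
    by (subst set_integrable_cong[OF refl refl eq]) auto
  have "(LINT t:{0<..}|lborel. exp (- (s * t)) * (t powr (\<delta> - 1) * dens (t powr (- \<alpha>))))
     = (LINT t:{0<..}|lborel. Gamma b * (exp (- (s * t)) * ray_transform c angle (stable_symbol \<alpha> \<delta>) t))"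
    by (rule set_lebesgue_integral_cong) (auto simp: eq)
  also have "\<dots> = Gamma b * (s powr (- \<delta>) * exp (- (s powr \<alpha>)))"
    using L(2) stable_symbol_of_real[OF s, of \<alpha> \<delta>] by simp
  finally show "(LINT t:{0<..}|lborel. exp (- (s * t)) * (t powr (\<delta> - 1) * dens (t powr (- \<alpha>)))) =
      Gamma b * (s powr (- \<delta>) * exp (- (s powr \<alpha>)))" .
qed

lemma lambda_nonneg:
  assumes y: "y > 0"
  shows "0 \<le> dens y"
proof -
  define t where "t = y powr (- 1 / \<alpha>)"
  have t: "t > 0" "t powr (- \<alpha>) = y" using \<alpha>_pos y by (simp_all add: t_def powr_powr)
  have "0 \<le> t powr (\<delta> - 1) * dens (t powr (- \<alpha>))"
  proof (rule completely_monotone_laplace_nonneg[where g = "\<lambda>t. t powr (\<delta> - 1) * dens (t powr (- \<alpha>))"])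
    show "completely_monotone n (\<lambda>s. Gamma b * s powr (- 0) * (s powr (- \<delta>) * exp (- (s powr \<alpha>))))" for n
      using Gamma_b_pos \<delta>_nonneg \<alpha>_pos \<alpha>_less_1
      by (intro completely_monotone_mult completely_monotone_stable completely_monotone_powr) auto
    show "continuous_on {0<..} (\<lambda>t. t powr (\<delta> - 1) * dens (t powr (- \<alpha>)))"
      by (intro continuous_intros continuous_on_compose2[OF lambda_continuous]) auto
  qed (use lambda_laplace t in auto)
  then show ?thesis using t by (simp add: zero_le_mult_iff)
qed

abbreviation "ew \<equiv> gauss_laguerre_weight \<alpha> \<beta>"

lemma ew_nonneg: "0 \<le> ew x"
  using Gamma_b_pos \<alpha>_pos unfolding gauss_laguerre_weight_def b_def by simp

lemma ew_pos: "x > 0 \<Longrightarrow> 0 < ew x"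
  using Gamma_b_pos \<alpha>_pos unfolding gauss_laguerre_weight_def b_def by simp

lemma borel_measurable_ew [measurable]: "ew \<in> borel_measurable borel"
  unfolding gauss_laguerre_weight_def[abs_def] by measurable

text \<open>The density of the product of the invariant law with an independent variable of density
  \<open>\<lambda>\<close>: the substitution \<open>x = u * t powr \<alpha>\<close> turns it into the Laplace transform above.\<close>

lemma product_density:
  assumes a: "a > 0" and u: "u > 0"
  shows "(\<integral>\<^sup>+x. ennreal (ew (a * x) * (dens (u / x) / x)) * indicator {0<..} x \<partial>lborel) = ennreal (exp (- (a * u)))"
proof -
  define f where "f x = ew (a * x) * (dens (u / x) / x)" for x
  define s where "s = (a * u) powr (1 / \<alpha>)"
  have s: "s > 0" using a u by (simp add: s_def)
  have s\<alpha>: "s powr \<alpha> = a * u" using a u \<alpha>_pos by (simp add: s_def powr_powr)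
  have eq: "u * (\<alpha> * t powr (\<alpha> - 1)) * f (u * t powr \<alpha>)
    = (s powr \<delta> / Gamma b) * (exp (- (s * t)) * (t powr (\<delta> - 1) * dens (t powr (- \<alpha>))))" if t: "t > 0" for t
  proof -
    have au: "a * (u * t powr \<alpha>) = (s * t) powr \<alpha>"
      using s t by (simp add: powr_mult s\<alpha>)
    have root: "(a * (u * t powr \<alpha>)) powr (1 / \<alpha>) = s * t"
      unfolding au using s t \<alpha>_pos by (simp add: powr_powr)
    have pow: "(a * (u * t powr \<alpha>)) powr (\<beta> + 1 / \<alpha> - 1) = s powr \<delta> * t powr \<delta>"
    proof -
      have "\<alpha> * (\<beta> + 1 / \<alpha> - 1) = \<delta>" using \<alpha>_pos by (simp add: \<delta>_def b_def field_simps)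
      then show ?thesis unfolding au powr_powr using s t by (simp add: powr_mult)
    qed
    have lam: "u / (u * t powr \<alpha>) = t powr (- \<alpha>)" using u by (simp add: powr_minus field_simps)
    have "f (u * t powr \<alpha>) = s powr \<delta> * t powr \<delta> * exp (- (s * t)) / (\<alpha> * Gamma b) * (dens (t powr (- \<alpha>)) / (u * t powr \<alpha>))"
      unfolding f_def gauss_laguerre_weight_def root pow lam by (simp add: b_def)
    then have "u * (\<alpha> * t powr (\<alpha> - 1)) * f (u * t powr \<alpha>)
      = u * (\<alpha> * t powr (\<alpha> - 1)) * (s powr \<delta> * t powr \<delta> * exp (- (s * t)) / (\<alpha> * Gamma b) * (dens (t powr (- \<alpha>)) / (u * t powr \<alpha>)))"
      by simp
    also have "\<dots> = (s powr \<delta> / Gamma b) * (exp (- (s * t)) * ((t powr (\<alpha> - 1) * t powr \<delta> / t powr \<alpha>) * dens (t powr (- \<alpha>))))"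
      using u \<alpha>_pos Gamma_b_pos by (simp add: divide_simps)
    also have "t powr (\<alpha> - 1) * t powr \<delta> / t powr \<alpha> = t powr (\<delta> - 1)"
      by (simp flip: powr_add powr_diff)
    finally show ?thesis .
  qed
  define h where "h t = (s powr \<delta> / Gamma b) * (exp (- (s * t)) * (t powr (\<delta> - 1) * dens (t powr (- \<alpha>))))" for t
  have h: "set_integrable lborel {0<..} h"
    unfolding h_def by (intro set_integrable_mult_right lambda_laplace s)
  have hval: "(LINT t:{0<..}|lborel. h t) = exp (- (a * u))"
    unfolding h_def set_integral_mult_right lambda_laplace(2)[OF s] s\<alpha>
    using Gamma_b_pos s by (simp add: powr_minus field_simps)
  have [measurable]: "f \<in> borel_measurable borel" unfolding f_def by measurable
  have "0 \<le> f x" if "x > 0" for x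
    using that u lambda_nonneg[of "u / x"] by (simp add: f_def ew_nonneg)
  from nn_integral_powr_substitution[OF \<alpha>_pos u _ this h, unfolded h_def, OF _ _ eq]
  have "(\<integral>\<^sup>+x. ennreal (f x) * indicator {0<..} x \<partial>lborel) = ennreal (exp (- (a * u)))"
    using hval by (simp add: h_def)
  then show ?thesis by (simp add: f_def)
qed

end

section \<open>Factorisation of the exponential law\<close>

lemma sets_weighted [simp, measurable_cong]: "sets (weighted w) = sets (restrict_space borel {0<..})"
  by (simp add: weighted_def sets_restrict_space)

lemma space_weighted [simp]: "space (weighted w) = {0<..}"
  by (simp add: weighted_def space_restrict_space)

lemma measurable_weighted_iff:
  "f \<in> borel_measurable (weighted w) \<longleftrightarrow> f \<in> borel_measurable (restrict_space borel {0<..})"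
  by (rule arg_cong[where f = "\<lambda>S. f \<in> S"], rule measurable_cong_sets) simp_all

lemma borel_measurable_weightedI:
  "f \<in> borel_measurable borel \<Longrightarrow> f \<in> borel_measurable (weighted w)"
  unfolding measurable_weighted_iff by (rule measurable_restrict_space1)

lemma nn_integral_weighted:
  assumes w: "w \<in> borel_measurable borel" and f: "f \<in> borel_measurable (weighted w)"
  shows "(\<integral>\<^sup>+x. f x \<partial>weighted w) = (\<integral>\<^sup>+x. ennreal (w x) * (f x * indicator {0<..} x) \<partial>lborel)"
proof -
  have w': "(\<lambda>x. ennreal (w x)) \<in> borel_measurable (restrict_space lborel {0<..})"
    using w by (intro measurable_restrict_space1) simp
  have f': "f \<in> borel_measurable (restrict_space lborel {0<..})"
    using f by (simp add: measurable_weighted_iff cong: measurable_cong_sets)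
  have "(\<integral>\<^sup>+x. f x \<partial>weighted w) = (\<integral>\<^sup>+x. ennreal (w x) * f x \<partial>restrict_space lborel {0<..})"
    unfolding weighted_def by (rule nn_integral_density[OF w' f'])
  also have "\<dots> = (\<integral>\<^sup>+x. ennreal (w x) * f x * indicator {0<..} x \<partial>lborel)"
    by (rule nn_integral_restrict_space) simp
  finally show ?thesis by (simp add: mult.assoc)
qed

lemma integral_weighted:
  fixes f :: "real \<Rightarrow> real"
  assumes w: "w \<in> borel_measurable borel" and pos: "\<And>x. x > 0 \<Longrightarrow> w x \<ge> 0"
    and f: "f \<in> borel_measurable (weighted w)"
  shows "integrable (weighted w) f \<longleftrightarrow> set_integrable lborel {0<..} (\<lambda>x. f x * w x)"
    and "(\<integral>x. f x \<partial>weighted w) = (LINT x:{0<..}|lborel. f x * w x)"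
proof -
  have w': "w \<in> borel_measurable (restrict_space lborel {0<..})"
    using w by (intro measurable_restrict_space1) simp
  have f': "f \<in> borel_measurable (restrict_space lborel {0<..})"
    using f by (simp add: measurable_weighted_iff cong: measurable_cong_sets)
  have nn: "AE x in restrict_space lborel {0<..}. 0 \<le> w x"
    by (subst AE_restrict_space_iff) (auto simp: pos)
  have "integrable (weighted w) f \<longleftrightarrow> integrable (restrict_space lborel {0<..}) (\<lambda>x. w x *\<^sub>R f x)"
    unfolding weighted_def by (rule integrable_density[OF f' w' nn])
  also have "\<dots> \<longleftrightarrow> set_integrable lborel {0<..} (\<lambda>x. f x * w x)"
    by (subst integrable_restrict_space) (simp_all add: set_integrable_def mult.commute)
  finally show "integrable (weighted w) f \<longleftrightarrow> set_integrable lborel {0<..} (\<lambda>x. f x * w x)" .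
  have "(\<integral>x. f x \<partial>weighted w) = (\<integral>x. w x *\<^sub>R f x \<partial>restrict_space lborel {0<..})"
    unfolding weighted_def by (rule integral_density[OF f' w' nn])
  also have "\<dots> = (LINT x:{0<..}|lborel. f x * w x)"
    by (subst integral_restrict_space) (simp_all add: set_lebesgue_integral_def mult.commute)
  finally show "(\<integral>x. f x \<partial>weighted w) = (LINT x:{0<..}|lborel. f x * w x)" .
qed

lemma measurable_mult_halfline:
  "(\<lambda>(x, y). x * y) \<in> weighted v \<Otimes>\<^sub>M weighted w \<rightarrow>\<^sub>M (restrict_space borel {0<..} :: real measure)"
proof (rule measurable_restrict_space2)
  show "(\<lambda>(x, y). x * y) \<in> space (weighted v \<Otimes>\<^sub>M weighted w) \<rightarrow> {0<..}"
    by (auto simp: space_pair_measure)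
  have id: "(\<lambda>x. x) \<in> borel_measurable (weighted u)" for u
    by (rule borel_measurable_weightedI) simp
  have "fst \<in> borel_measurable (weighted v \<Otimes>\<^sub>M weighted w)"
    by (rule measurable_compose[OF measurable_fst id])
  moreover have "snd \<in> borel_measurable (weighted v \<Otimes>\<^sub>M weighted w)"
    by (rule measurable_compose[OF measurable_snd id])
  ultimately show "(\<lambda>(x, y). x * y) \<in> borel_measurable (weighted v \<Otimes>\<^sub>M weighted w)"
    by (simp add: case_prod_beta')
qed

lemma measurable_scale_halfline:
  assumes "x > 0" and f: "f \<in> borel_measurable (restrict_space borel {0<..})"
  shows "(\<lambda>y. f (x * y)) \<in> borel_measurable (restrict_space borel {0<..} :: real measure)"
proof (rule measurable_compose[OF _ f])
  show "(*) x \<in> restrict_space borel {0<..} \<rightarrow>\<^sub>M restrict_space borel {0<..}"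
    using assms by (intro measurable_restrict_space3) auto
qed

context gauss_laguerre
begin

text \<open>\<open>M\<close> is the invariant law of the Gauss-Laguerre semigroup, \<open>N\<close> the law with density \<open>\<lambda>\<close>, and \<open>E 1\<close> the
  standard exponential law.\<close>

definition "M = weighted ew"
definition "N = weighted dens"
definition "E a = weighted (\<lambda>u. exp (- (a * u)))"

lemma laguerre_eq_E: "weighted laguerre_weight = E 1"
  by (simp add: E_def laguerre_weight_def[abs_def])

lemma sets_MNE [measurable_cong]: "sets M = sets (restrict_space borel {0<..})"
  "sets N = sets (restrict_space borel {0<..})" "sets (E a) = sets (restrict_space borel {0<..})"
  by (simp_all add: M_def N_def E_def)

lemma space_MNE [simp]: "space M = {0<..}" "space N = {0<..}" "space (E a) = {0<..}"
  by (simp_all add: M_def N_def E_def)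

text \<open>The weight \<open>ew (a * x) / ew x\<close> replaces the invariant density by a dilated copy; in this form the
  factorisation is used for injectivity.\<close>

lemma nn_integral_product_weighted:
  assumes a: "a > 0" and F: "F \<in> borel_measurable (restrict_space borel {0<..})"
  shows "(\<integral>\<^sup>+x. ennreal (ew (a * x) / ew x) * (\<integral>\<^sup>+y. F (x * y) \<partial>N) \<partial>M) = (\<integral>\<^sup>+u. F u \<partial>E a)"
proof -
  define G where "G x = F x * indicator {0<..} x" for x
  have [measurable]: "G \<in> borel_measurable borel"
    unfolding G_def using F by (subst (asm) borel_measurable_restrict_space_iff_ennreal) auto
  have inner: "(\<integral>\<^sup>+y. F (x * y) \<partial>N) = (\<integral>\<^sup>+u. ennreal (dens (u / x) / x) * G u \<partial>lborel)" if x: "x > 0" for x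
  proof -
    have "(\<integral>\<^sup>+y. F (x * y) \<partial>N) = (\<integral>\<^sup>+y. ennreal (dens y) * (F (x * y) * indicator {0<..} y) \<partial>lborel)"
      unfolding N_def using measurable_scale_halfline[OF x F]
      by (intro nn_integral_weighted borel_measurable_lambda) (simp add: measurable_weighted_iff)
    also have "\<dots> = (\<integral>\<^sup>+y. ennreal (dens y) * G (x * y) \<partial>lborel)"
      using x by (intro nn_integral_cong) (auto simp: G_def indicator_def zero_less_mult_iff)
    also have "\<dots> = ennreal \<bar>1 / x\<bar> * (\<integral>\<^sup>+u. ennreal (dens (0 + 1 / x * u)) * G (x * (0 + 1 / x * u)) \<partial>lborel)"
      using x by (intro nn_integral_real_affine) auto
    also have "\<dots> = (\<integral>\<^sup>+u. ennreal \<bar>1 / x\<bar> * (ennreal (dens (u / x)) * G u) \<partial>lborel)"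
      using x by (subst nn_integral_cmult[symmetric]) auto
    also have "\<dots> = (\<integral>\<^sup>+u. ennreal (dens (u / x) / x) * G u \<partial>lborel)"
      using x by (intro nn_integral_cong) (auto simp: G_def indicator_def lambda_nonneg ennreal_mult' mult_ac divide_inverse)
    finally show ?thesis .
  qed
  have meas_inner: "(\<lambda>x. \<integral>\<^sup>+y. F (x * y) \<partial>N) \<in> borel_measurable M"
  proof -
    have "(\<lambda>x. \<integral>\<^sup>+u. ennreal (dens (u / x) / x) * G u \<partial>lborel) \<in> borel_measurable borel"
      by measurable
    then have "(\<lambda>x. \<integral>\<^sup>+u. ennreal (dens (u / x) / x) * G u \<partial>lborel) \<in> borel_measurable M"
      unfolding M_def by (rule borel_measurable_weightedI)
    then show ?thesis by (rule measurable_cong[THEN iffD2, rotated]) (auto intro: inner)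
  qed
  have "(\<integral>\<^sup>+x. ennreal (ew (a * x) / ew x) * (\<integral>\<^sup>+y. F (x * y) \<partial>N) \<partial>M)
      = (\<integral>\<^sup>+x. ennreal (ew x) * (ennreal (ew (a * x) / ew x) * (\<integral>\<^sup>+y. F (x * y) \<partial>N) * indicator {0<..} x) \<partial>lborel)"
    unfolding M_def
  proof (rule nn_integral_weighted[OF borel_measurable_ew])
    have "(\<lambda>x. ennreal (ew (a * x) / ew x)) \<in> borel_measurable (weighted ew)"
      by (rule borel_measurable_weightedI) measurable
    moreover have "(\<lambda>x. \<integral>\<^sup>+y. F (x * y) \<partial>N) \<in> borel_measurable (weighted ew)"
      using meas_inner by (simp add: M_def)
    ultimately show "(\<lambda>x. ennreal (ew (a * x) / ew x) * (\<integral>\<^sup>+y. F (x * y) \<partial>N)) \<in> borel_measurable (weighted ew)"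
      by (rule borel_measurable_times_ennreal)
  qed
  also have "\<dots> = (\<integral>\<^sup>+x. (\<integral>\<^sup>+u. ennreal (ew (a * x) * (dens (u / x) / x)) * indicator {0<..} x * G u \<partial>lborel) \<partial>lborel)"
  proof (intro nn_integral_cong)
    fix x :: real
    show "ennreal (ew x) * (ennreal (ew (a * x) / ew x) * (\<integral>\<^sup>+y. F (x * y) \<partial>N) * indicator {0<..} x)
      = (\<integral>\<^sup>+u. ennreal (ew (a * x) * (dens (u / x) / x)) * indicator {0<..} x * G u \<partial>lborel)"
    proof (cases "x > 0")
      case True
      have "ennreal (ew x) * ennreal (ew (a * x) / ew x) = ennreal (ew (a * x))"
        using ew_pos[OF True] ew_nonneg[of "a * x"] by (simp flip: ennreal_mult)
      then have "ennreal (ew x) * (ennreal (ew (a * x) / ew x) * (\<integral>\<^sup>+y. F (x * y) \<partial>N) * indicator {0<..} x)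
         = ennreal (ew (a * x)) * (\<integral>\<^sup>+u. ennreal (dens (u / x) / x) * G u \<partial>lborel)"
        using True by (simp add: inner flip: mult.assoc)
      also have "\<dots> = (\<integral>\<^sup>+u. ennreal (ew (a * x)) * (ennreal (dens (u / x) / x) * G u) \<partial>lborel)"
        by (subst nn_integral_cmult[symmetric]) auto
      also have "\<dots> = (\<integral>\<^sup>+u. ennreal (ew (a * x) * (dens (u / x) / x)) * indicator {0<..} x * G u \<partial>lborel)"
        using True by (simp only: ennreal_mult'[OF ew_nonneg] indicator_simps greaterThan_iff mult_1_right mult.assoc)
      finally show ?thesis .
    qed simp
  qed
  also have "\<dots> = (\<integral>\<^sup>+u. (\<integral>\<^sup>+x. ennreal (ew (a * x) * (dens (u / x) / x)) * indicator {0<..} x * G u \<partial>lborel) \<partial>lborel)"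
    by (intro lborel_pair.Fubini') measurable
  also have "\<dots> = (\<integral>\<^sup>+u. ennreal (exp (- (a * u))) * (F u * indicator {0<..} u) \<partial>lborel)"
  proof (intro nn_integral_cong)
    fix u :: real
    have "(\<integral>\<^sup>+x. ennreal (ew (a * x) * (dens (u / x) / x)) * indicator {0<..} x * G u \<partial>lborel)
      = (\<integral>\<^sup>+x. ennreal (ew (a * x) * (dens (u / x) / x)) * indicator {0<..} x \<partial>lborel) * G u"
      by (rule nn_integral_multc) measurable
    also have "\<dots> = ennreal (exp (- (a * u))) * (F u * indicator {0<..} u)"
      using product_density[OF a, of u] by (cases "u > 0") (simp_all add: G_def)
    finally show "(\<integral>\<^sup>+x. ennreal (ew (a * x) * (dens (u / x) / x)) * indicator {0<..} x * G u \<partial>lborel)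
       = ennreal (exp (- (a * u))) * (F u * indicator {0<..} u)" .
  qed
  also have "\<dots> = (\<integral>\<^sup>+u. F u \<partial>E a)"
    unfolding E_def using F by (intro nn_integral_weighted[symmetric]) (auto simp: measurable_weighted_iff)
  finally show ?thesis .
qed

lemma nn_integral_product:
  assumes F: "F \<in> borel_measurable (restrict_space borel {0<..})"
  shows "(\<integral>\<^sup>+x. (\<integral>\<^sup>+y. F (x * y) \<partial>N) \<partial>M) = (\<integral>\<^sup>+u. F u \<partial>E 1)"
proof -
  have "(\<integral>\<^sup>+x. (\<integral>\<^sup>+y. F (x * y) \<partial>N) \<partial>M) = (\<integral>\<^sup>+x. ennreal (ew (1 * x) / ew x) * (\<integral>\<^sup>+y. F (x * y) \<partial>N) \<partial>M)"
  proof (rule nn_integral_cong)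
    fix x assume "x \<in> space M"
    then have "ew x > 0" by (simp add: ew_pos)
    then show "(\<integral>\<^sup>+y. F (x * y) \<partial>N) = ennreal (ew (1 * x) / ew x) * (\<integral>\<^sup>+y. F (x * y) \<partial>N)" by simp
  qed
  then show ?thesis using nn_integral_product_weighted[OF _ F, of 1] by simp
qed

text \<open>Moments of the invariant law, by the substitution \<open>x = t powr \<alpha>\<close> in the Gamma integral.\<close>

lemma M_moment: "(\<integral>\<^sup>+x. ennreal (x ^ n) \<partial>M) = ennreal (Gamma (\<alpha> * real n + b) / Gamma b)"
proof -
  define p where "p = \<alpha> * real n + b"
  have p: "p > 0" using b_pos \<alpha>_pos by (simp add: p_def add_nonneg_pos)
  define f where "f x = x ^ n * ew x" for x
  define h where "h t = exp (- (1 * t)) * t powr (p - 1) / Gamma b" for t :: real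
  have eq: "1 * (\<alpha> * t powr (\<alpha> - 1)) * f (1 * t powr \<alpha>) = h t" if t: "t > 0" for t
  proof -
    have e: "\<alpha> * (\<beta> + 1 / \<alpha> - 1) = b - \<alpha>" using \<alpha>_pos by (simp add: b_def field_simps)
    have "(t powr \<alpha>) ^ n = t powr (\<alpha> * real n)" using t by (simp add: powr_powr flip: powr_realpow)
    then have "1 * (\<alpha> * t powr (\<alpha> - 1)) * f (1 * t powr \<alpha>) = \<alpha> * t powr (\<alpha> - 1) * (t powr (\<alpha> * real n) * (t powr (b - \<alpha>) * exp (- t) / (\<alpha> * Gamma b)))"
      unfolding f_def gauss_laguerre_weight_def using t \<alpha>_pos by (simp add: powr_powr e b_def)
    also have "\<dots> = (t powr (\<alpha> - 1) * (t powr (\<alpha> * real n) * t powr (b - \<alpha>))) * exp (- t) / Gamma b"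
      using \<alpha>_pos by (simp add: field_simps)
    also have "t powr (\<alpha> - 1) * (t powr (\<alpha> * real n) * t powr (b - \<alpha>)) = t powr (p - 1)"
      by (simp add: p_def algebra_simps flip: powr_add)
    finally show ?thesis by (simp add: h_def mult.commute)
  qed
  have h: "set_integrable lborel {0<..} h"
    unfolding h_def using Gamma_laplace_integral(2)[OF p, of 1] by (intro set_integrable_divide) simp
  have hval: "(LINT t:{0<..}|lborel. h t) = Gamma p / Gamma b"
    unfolding h_def using Gamma_laplace_integral(1)[OF p, of 1] by simp
  have [measurable]: "f \<in> borel_measurable borel" unfolding f_def by measurable
  have "0 \<le> f x" if "x > 0" for x using that by (simp add: f_def ew_nonneg)
  from nn_integral_powr_substitution[OF \<alpha>_pos zero_less_one _ this h eq]
  have "(\<integral>\<^sup>+x. ennreal (f x) * indicator {0<..} x \<partial>lborel) = ennreal (Gamma p / Gamma b)"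
    using hval by simp
  moreover have "(\<integral>\<^sup>+x. ennreal (x ^ n) \<partial>M) = (\<integral>\<^sup>+x. ennreal (ew x) * (ennreal (x ^ n) * indicator {0<..} x) \<partial>lborel)"
    unfolding M_def by (intro nn_integral_weighted borel_measurable_ew borel_measurable_weightedI) measurable
  moreover have "ennreal (ew x) * (ennreal (x ^ n) * indicator {0<..} x) = ennreal (f x) * indicator {0<..} x" for x
    by (simp add: f_def indicator_def ew_nonneg mult.commute flip: ennreal_mult)
  ultimately show ?thesis by (simp add: p_def)
qed

lemma prob_space_M: "prob_space M"
proof (rule prob_spaceI)
  show "emeasure M (space M) = 1" using M_moment[of 0] Gamma_b_pos by (simp del: space_MNE)
qed

lemma E_moment: "(\<integral>\<^sup>+u. ennreal (u ^ n) \<partial>E 1) = ennreal (fact n)"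
proof -
  have int: "set_integrable lborel {0<..} (\<lambda>t::real. exp (- (1 * t)) * t powr (real (Suc n) - 1))"
    and val: "(LINT t:{0<..}|lborel. exp (- (1 * t)) * t powr (real (Suc n) - 1)) = fact n"
    using Gamma_laplace_integral[of "real (Suc n)" 1] Gamma_fact[of n, where 'a = real] by (simp_all add: add.commute)
  have "(\<integral>\<^sup>+u. ennreal (u ^ n) \<partial>E 1) = (\<integral>\<^sup>+u. ennreal (exp (- (1 * u))) * (ennreal (u ^ n) * indicator {0<..} u) \<partial>lborel)"
    unfolding E_def by (intro nn_integral_weighted borel_measurable_weightedI) auto
  also have "\<dots> = (\<integral>\<^sup>+u. ennreal (indicator {0<..} u *\<^sub>R (exp (- (1 * u)) * u powr (real (Suc n) - 1))) \<partial>lborel)"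
    by (intro nn_integral_cong) (auto simp: indicator_def powr_realpow simp flip: ennreal_mult)
  also have "\<dots> = ennreal (fact n)"
    using int val unfolding set_integrable_def set_lebesgue_integral_def
    by (subst nn_integral_eq_integral) auto
  finally show ?thesis .
qed

text \<open>Divide the moments of the exponential law by those of the invariant law.\<close>

lemma N_moment: "(\<integral>\<^sup>+y. ennreal (y ^ n) \<partial>N) = ennreal (fact n * Gamma b / Gamma (\<alpha> * real n + b))"
proof -
  have p: "Gamma (\<alpha> * real n + b) > 0" using b_pos \<alpha>_pos by (intro Gamma_real_pos) (simp add: add_nonneg_pos)
  have meas: "(\<lambda>x. ennreal (x ^ n)) \<in> borel_measurable (restrict_space borel {0<..} :: real measure)"
    by (intro measurable_restrict_space1) measurable
  have meas': "(\<lambda>x. ennreal (x ^ n)) \<in> borel_measurable M" "(\<lambda>x. ennreal (x ^ n)) \<in> borel_measurable N"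
    using meas by (simp_all cong: measurable_cong_sets add: sets_MNE)
  have "ennreal (fact n) = (\<integral>\<^sup>+x. (\<integral>\<^sup>+y. ennreal ((x * y) ^ n) \<partial>N) \<partial>M)"
    using nn_integral_product[OF meas] E_moment[of n] by simp
  also have "\<dots> = (\<integral>\<^sup>+x. ennreal (x ^ n) * (\<integral>\<^sup>+y. ennreal (y ^ n) \<partial>N) \<partial>M)"
  proof (rule nn_integral_cong)
    fix x assume x: "x \<in> space M"
    have "(\<integral>\<^sup>+y. ennreal ((x * y) ^ n) \<partial>N) = (\<integral>\<^sup>+y. ennreal (x ^ n) * ennreal (y ^ n) \<partial>N)"
      using x by (intro nn_integral_cong) (auto simp: power_mult_distrib ennreal_mult)
    then show "(\<integral>\<^sup>+y. ennreal ((x * y) ^ n) \<partial>N) = ennreal (x ^ n) * (\<integral>\<^sup>+y. ennreal (y ^ n) \<partial>N)"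
      using meas' by (simp add: nn_integral_cmult)
  qed
  also have "\<dots> = ennreal (Gamma (\<alpha> * real n + b) / Gamma b) * (\<integral>\<^sup>+y. ennreal (y ^ n) \<partial>N)"
    using meas' by (simp add: nn_integral_multc M_moment)
  finally have eq: "ennreal (fact n) = ennreal (Gamma (\<alpha> * real n + b) / Gamma b) * (\<integral>\<^sup>+y. ennreal (y ^ n) \<partial>N)" .
  have inv: "ennreal (Gamma b / Gamma (\<alpha> * real n + b)) * ennreal (Gamma (\<alpha> * real n + b) / Gamma b) = 1"
    using p Gamma_b_pos by (simp flip: ennreal_mult)
  have "ennreal (Gamma b / Gamma (\<alpha> * real n + b)) * ennreal (fact n) = (\<integral>\<^sup>+y. ennreal (y ^ n) \<partial>N)"
    unfolding eq by (simp add: inv flip: mult.assoc)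
  then show ?thesis using p Gamma_b_pos by (simp add: mult.commute flip: ennreal_mult)
qed

lemma prob_space_N: "prob_space N"
proof (rule prob_spaceI)
  show "emeasure N (space N) = 1" using N_moment[of 0] Gamma_b_pos by (simp del: space_MNE)
qed

lemma prob_space_E: "prob_space (E 1)"
proof (rule prob_spaceI)
  show "emeasure (E 1) (space (E 1)) = 1" using E_moment[of 0] by (simp del: space_MNE)
qed

end

section \<open>Approximation in the space of square-integrable functions\<close>

definition square_integrable :: "'a measure \<Rightarrow> ('a \<Rightarrow> real) set" where
  "square_integrable M = {f \<in> borel_measurable M. integrable M (\<lambda>x. (f x)\<^sup>2)}"

definition norm2 :: "'a measure \<Rightarrow> ('a \<Rightarrow> real) \<Rightarrow> real" where
  "norm2 M f = sqrt (\<integral>x. (f x)\<^sup>2 \<partial>M)"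

lemma L2_eq_square_integrable: "L2 w = square_integrable (weighted w)"
  by (simp add: L2_def square_integrable_def)

lemma L2_norm_eq_norm2: "L2_norm w = norm2 (weighted w)"
  by (simp add: L2_norm_def norm2_def fun_eq_iff)

lemma square_integrableD:
  assumes "f \<in> square_integrable M"
  shows "f \<in> borel_measurable M" "integrable M (\<lambda>x. (f x)\<^sup>2)"
  using assms by (auto simp: square_integrable_def)

lemma square_integrable_bound:
  assumes g: "g \<in> square_integrable M" and f: "f \<in> borel_measurable M" and le: "AE x in M. \<bar>f x\<bar> \<le> \<bar>g x\<bar>"
  shows "f \<in> square_integrable M"
proof -
  have "integrable M (\<lambda>x. (f x)\<^sup>2)"
  proof (rule Bochner_Integration.integrable_bound[OF square_integrableD(2)[OF g]])
    show "AE x in M. norm ((f x)\<^sup>2) \<le> norm ((g x)\<^sup>2)"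
      using le by eventually_elim (simp add: abs_le_square_iff)
  qed (use f in measurable)
  then show ?thesis using f by (simp add: square_integrable_def)
qed

lemma square_integrable_cmult: "f \<in> square_integrable M \<Longrightarrow> (\<lambda>x. c * f x) \<in> square_integrable M"
  by (auto simp: square_integrable_def power_mult_distrib)

lemma square_integrable_add:
  assumes f: "f \<in> square_integrable M" and g: "g \<in> square_integrable M"
  shows "(\<lambda>x. f x + g x) \<in> square_integrable M"
proof -
  note [measurable] = square_integrableD(1)[OF f] square_integrableD(1)[OF g]
  have "integrable M (\<lambda>x. (f x + g x)\<^sup>2)"
  proof (rule Bochner_Integration.integrable_bound)
    show "integrable M (\<lambda>x. 2 * (f x)\<^sup>2 + 2 * (g x)\<^sup>2)"
      using f g by (auto simp: square_integrable_def)
    show "AE x in M. norm ((f x + g x)\<^sup>2) \<le> norm (2 * (f x)\<^sup>2 + 2 * (g x)\<^sup>2)"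
    proof (intro AE_I2)
      fix x
      have "0 \<le> (f x - g x)\<^sup>2" by simp
      then have "(f x + g x)\<^sup>2 \<le> 2 * (f x)\<^sup>2 + 2 * (g x)\<^sup>2" by (simp add: power2_sum power2_diff)
      then show "norm ((f x + g x)\<^sup>2) \<le> norm (2 * (f x)\<^sup>2 + 2 * (g x)\<^sup>2)" by simp
    qed
  qed measurable
  then show ?thesis by (simp add: square_integrable_def)
qed

lemma square_integrable_diff:
  assumes "f \<in> square_integrable M" "g \<in> square_integrable M"
  shows "(\<lambda>x. f x - g x) \<in> square_integrable M"
  using square_integrable_add[OF assms(1) square_integrable_cmult[OF assms(2), of "- 1"]] by simp

lemma integrable_mult_square_integrable:
  assumes f: "f \<in> square_integrable M" and g: "g \<in> square_integrable M"
  shows "integrable M (\<lambda>x. f x * g x)"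
proof -
  have "integrable M (\<lambda>x. ((f x + g x)\<^sup>2 - (f x)\<^sup>2 - (g x)\<^sup>2) / 2)"
    using square_integrableD(2)[OF square_integrable_add[OF f g]] square_integrableD(2)[OF f] square_integrableD(2)[OF g]
    by (intro integrable_divide Bochner_Integration.integrable_diff)
  moreover have "((f x + g x)\<^sup>2 - (f x)\<^sup>2 - (g x)\<^sup>2) / 2 = f x * g x" for x by (simp add: power2_sum)
  ultimately show ?thesis by simp
qed

lemma (in finite_measure) integrable_square_integrable:
  assumes f: "f \<in> square_integrable M"
  shows "integrable M f"
proof -
  have "(\<lambda>_. 1) \<in> square_integrable M" by (simp add: square_integrable_def)
  from integrable_mult_square_integrable[OF f this] show ?thesis by simp
qed

lemma norm2_nonneg [simp]: "0 \<le> norm2 M f"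
  by (simp add: norm2_def integral_nonneg_AE)

lemma norm2_power2: "(norm2 M f)\<^sup>2 = (\<integral>x. (f x)\<^sup>2 \<partial>M)"
  by (simp add: norm2_def integral_nonneg_AE)

lemma norm2_cong_AE:
  assumes "f \<in> borel_measurable M" "g \<in> borel_measurable M" "AE x in M. f x = g x"
  shows "norm2 M f = norm2 M g"
  unfolding norm2_def using assms by (intro arg_cong[where f = sqrt] integral_cong_AE) auto

lemma norm2_cmult: "norm2 M (\<lambda>x. c * f x) = \<bar>c\<bar> * norm2 M f"
  by (simp add: norm2_def power_mult_distrib real_sqrt_mult)

lemma norm2_minus_commute: "norm2 M (\<lambda>x. f x - g x) = norm2 M (\<lambda>x. g x - f x)"
  by (simp add: norm2_def power2_commute)

lemma square_integrable_Cauchy_Schwarz: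
  assumes f: "f \<in> square_integrable M" and g: "g \<in> square_integrable M"
  shows "\<bar>\<integral>x. f x * g x \<partial>M\<bar> \<le> norm2 M f * norm2 M g"
proof -
  define A B C where "A = (\<integral>x. (f x)\<^sup>2 \<partial>M)" and "B = (\<integral>x. (g x)\<^sup>2 \<partial>M)" and "C = (\<integral>x. f x * g x \<partial>M)"
  have quad: "0 \<le> t\<^sup>2 * A + 2 * t * C + B" for t
  proof -
    have "0 \<le> (\<integral>x. (t * f x + g x)\<^sup>2 \<partial>M)" by (simp add: integral_nonneg_AE)
    also have "\<dots> = (\<integral>x. t\<^sup>2 * (f x)\<^sup>2 + 2 * t * (f x * g x) + (g x)\<^sup>2 \<partial>M)"
      by (intro Bochner_Integration.integral_cong refl) (simp add: power2_sum power_mult_distrib)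
    also have "\<dots> = t\<^sup>2 * A + 2 * t * C + B"
      unfolding A_def B_def C_def
      using f g integrable_mult_square_integrable[OF f g] by (simp add: square_integrable_def)
    finally show ?thesis .
  qed
  have AB: "A \<ge> 0" "B \<ge> 0" unfolding A_def B_def by (simp_all add: integral_nonneg_AE)
  have "C\<^sup>2 \<le> A * B"
  proof (cases "A = 0")
    case True
    have "C = 0"
    proof (rule ccontr)
      assume "C \<noteq> 0"
      then show False using quad[of "- (B + 1) / (2 * C)"] True by (simp add: field_simps)
    qed
    then show ?thesis using True by simp
  next
    case False
    then have "A > 0" using AB by simp
    have "(- C / A)\<^sup>2 * A + 2 * (- C / A) * C + B = B - C\<^sup>2 / A"
      using \<open>A > 0\<close> by (simp add: power2_eq_square field_simps)
    with quad[of "- C / A"] have "C\<^sup>2 / A \<le> B" by simp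
    then show ?thesis using \<open>A > 0\<close> by (simp add: field_simps)
  qed
  then have "sqrt (C\<^sup>2) \<le> sqrt (A * B)" by (rule real_sqrt_le_mono)
  then show ?thesis by (simp add: norm2_def A_def B_def C_def real_sqrt_mult)
qed

lemma norm2_triangle:
  assumes f: "f \<in> square_integrable M" and g: "g \<in> square_integrable M"
  shows "norm2 M (\<lambda>x. f x + g x) \<le> norm2 M f + norm2 M g"
proof (rule power2_le_imp_le)
  have "(norm2 M (\<lambda>x. f x + g x))\<^sup>2 = (\<integral>x. (f x)\<^sup>2 + 2 * (f x * g x) + (g x)\<^sup>2 \<partial>M)"
    unfolding norm2_power2 by (simp add: power2_sum algebra_simps)
  also have "\<dots> = (norm2 M f)\<^sup>2 + 2 * (\<integral>x. f x * g x \<partial>M) + (norm2 M g)\<^sup>2"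
    unfolding norm2_power2
    using f g integrable_mult_square_integrable[OF f g] by (simp add: square_integrable_def)
  also have "\<dots> \<le> (norm2 M f + norm2 M g)\<^sup>2"
    using square_integrable_Cauchy_Schwarz[OF f g] by (simp add: power2_sum)
  finally show "(norm2 M (\<lambda>x. f x + g x))\<^sup>2 \<le> (norm2 M f + norm2 M g)\<^sup>2" .
qed simp

lemma norm2_triangle_diff:
  assumes "f \<in> square_integrable M" "g \<in> square_integrable M" "h \<in> square_integrable M"
  shows "norm2 M (\<lambda>x. f x - h x) \<le> norm2 M (\<lambda>x. f x - g x) + norm2 M (\<lambda>x. g x - h x)"
  using norm2_triangle[OF square_integrable_diff[OF assms(1,2)] square_integrable_diff[OF assms(2,3)]] by simp

lemma norm2_eq_0_AE:
  assumes f: "f \<in> square_integrable M" and "norm2 M f = 0"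
  shows "AE x in M. f x = 0"
proof -
  have "(\<integral>x. (f x)\<^sup>2 \<partial>M) = 0" using assms(2) norm2_power2[of M f] by simp
  then show ?thesis
    using integral_nonneg_eq_0_iff_AE[OF square_integrableD(2)[OF f]] by simp
qed

lemma norm2_dominated_convergence:
  assumes g: "g \<in> square_integrable M" and f: "f \<in> borel_measurable M"
    and u: "\<And>n. u n \<in> borel_measurable M"
    and lim: "AE x in M. (\<lambda>n. u n x) \<longlonglongrightarrow> f x" and bound: "\<And>n. AE x in M. \<bar>u n x\<bar> \<le> g x"
  shows "f \<in> square_integrable M" and "(\<lambda>n. norm2 M (\<lambda>x. f x - u n x)) \<longlonglongrightarrow> 0"
proof -
  note [measurable] = f u square_integrableD(1)[OF g]
  have bound_all: "AE x in M. \<forall>n. \<bar>u n x\<bar> \<le> g x" using bound by (simp add: AE_all_countable)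
  have fg: "AE x in M. \<bar>f x\<bar> \<le> g x"
    using lim bound_all
  proof eventually_elim
    case (elim x)
    then show ?case by (intro LIMSEQ_le_const2[OF tendsto_rabs]) auto
  qed
  then have "AE x in M. \<bar>f x\<bar> \<le> \<bar>g x\<bar>" by eventually_elim simp
  from square_integrable_bound[OF g f this] show "f \<in> square_integrable M" .
  have "(\<lambda>n. \<integral>x. (f x - u n x)\<^sup>2 \<partial>M) \<longlonglongrightarrow> (\<integral>x. 0 \<partial>M)"
  proof (rule integral_dominated_convergence)
    show "integrable M (\<lambda>x. 4 * (g x)\<^sup>2)" using square_integrableD(2)[OF g] by simp
    show "AE x in M. (\<lambda>n. (f x - u n x)\<^sup>2) \<longlonglongrightarrow> 0"
      using lim
    proof eventually_elim
      case (elim x)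
      have "(\<lambda>n. (f x - u n x)\<^sup>2) \<longlonglongrightarrow> (f x - f x)\<^sup>2" by (intro tendsto_intros elim)
      then show ?case by simp
    qed
    show "AE x in M. norm ((f x - u n x)\<^sup>2) \<le> 4 * (g x)\<^sup>2" for n
      using fg bound_all
    proof eventually_elim
      case (elim x)
      have "\<bar>f x - u n x\<bar> \<le> 2 * g x" using elim(1) elim(2)[rule_format, of n] by linarith
      then have "(f x - u n x)\<^sup>2 \<le> (2 * g x)\<^sup>2" by (metis abs_ge_zero power2_abs power_mono)
      then show ?case by (simp add: power_mult_distrib)
    qed
  qed measurable
  then have "(\<lambda>n. sqrt (\<integral>x. (f x - u n x)\<^sup>2 \<partial>M)) \<longlonglongrightarrow> sqrt 0" by (intro tendsto_intros) simp
  then show "(\<lambda>n. norm2 M (\<lambda>x. f x - u n x)) \<longlonglongrightarrow> 0" by (simp add: norm2_def)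
qed

lemma exp_partial_sum_le:
  assumes "0 \<le> (x::real)"
  shows "(\<Sum>j<n. x ^ j / fact j) \<le> exp x"
proof -
  have sums: "(\<lambda>n. x ^ n / fact n) sums exp x"
    using exp_converges[of x] by (simp add: divide_inverse mult.commute)
  have "(\<Sum>j<n. x ^ j / fact j) \<le> (\<Sum>j. x ^ j / fact j)"
    using assms by (intro sum_le_suminf sums_summable[OF sums]) auto
  then show ?thesis using sums_unique[OF sums] by simp
qed

lemma power_le_fact_exp:
  assumes "0 \<le> (x::real)"
  shows "x ^ k / fact k \<le> exp x"
proof -
  have "x ^ k / fact k \<le> (\<Sum>j<Suc k. x ^ j / fact j)"
    using assms by (intro member_le_sum) auto
  then show ?thesis using exp_partial_sum_le[OF assms, of "Suc k"] by linarith
qed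

text \<open>A linear space of square-integrable functions on the half-line; its closure is \<open>L2_limits\<close>. The
  functions are representatives, so no quotient by null functions is taken.\<close>

locale L2_subspace = finite_measure M for M :: "real measure" +
  fixes A :: "(real \<Rightarrow> real) set"
  assumes sets_M: "sets M = sets (restrict_space borel {0<..})"
    and A_L2: "A \<subseteq> square_integrable M"
    and A_0: "(\<lambda>_. 0) \<in> A"
    and A_add: "\<And>f g. f \<in> A \<Longrightarrow> g \<in> A \<Longrightarrow> (\<lambda>x. f x + g x) \<in> A"
    and A_cmult: "\<And>f c. f \<in> A \<Longrightarrow> (\<lambda>x. c * f x) \<in> A"
begin

definition L2_limits :: "(real \<Rightarrow> real) set" where
  "L2_limits = {f \<in> square_integrable M. \<forall>\<epsilon>>0. \<exists>h\<in>A. norm2 M (\<lambda>x. f x - h x) < \<epsilon>}"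

lemma L2_limitsD: "f \<in> L2_limits \<Longrightarrow> f \<in> square_integrable M"
  by (simp add: L2_limits_def)

lemma L2_limitsE:
  assumes "f \<in> L2_limits" "\<epsilon> > 0"
  obtains h where "h \<in> A" "norm2 M (\<lambda>x. f x - h x) < \<epsilon>"
  using assms unfolding L2_limits_def by blast

lemma space_M: "space M = {0<..}"
  using sets_eq_imp_space_eq[OF sets_M] by (simp add: space_restrict_space)

lemma borel_measurable_M: "f \<in> borel_measurable borel \<Longrightarrow> f \<in> borel_measurable M"
  by (subst measurable_cong_sets[OF sets_M refl]) (rule measurable_restrict_space1)

lemma L2_limits_base: "f \<in> A \<Longrightarrow> f \<in> L2_limits"
  using A_L2 by (auto simp: L2_limits_def norm2_def intro!: bexI[of _ f])

lemma L2_limits_closed: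
  assumes f: "f \<in> square_integrable M" and "\<And>\<epsilon>. \<epsilon> > 0 \<Longrightarrow> \<exists>g\<in>L2_limits. norm2 M (\<lambda>x. f x - g x) < \<epsilon>"
  shows "f \<in> L2_limits"
  unfolding L2_limits_def
proof (intro CollectI conjI allI impI f)
  fix \<epsilon> :: real assume "\<epsilon> > 0"
  then obtain g where g: "g \<in> L2_limits" "norm2 M (\<lambda>x. f x - g x) < \<epsilon> / 2"
    using assms(2)[of "\<epsilon> / 2"] by auto
  have "\<epsilon> / 2 > 0" using \<open>\<epsilon> > 0\<close> by simp
  then obtain h where h: "h \<in> A" "norm2 M (\<lambda>x. g x - h x) < \<epsilon> / 2"
    by (rule L2_limitsE[OF g(1)])
  have "norm2 M (\<lambda>x. f x - h x) < \<epsilon>"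
    using norm2_triangle_diff[OF f L2_limitsD[OF g(1)] subsetD[OF A_L2 h(1)]] g h by simp
  then show "\<exists>h\<in>A. norm2 M (\<lambda>x. f x - h x) < \<epsilon>" using h by blast
qed

lemma L2_limits_add:
  assumes f: "f \<in> L2_limits" and g: "g \<in> L2_limits"
  shows "(\<lambda>x. f x + g x) \<in> L2_limits"
  unfolding L2_limits_def
proof (intro CollectI conjI allI impI square_integrable_add L2_limitsD f g)
  fix \<epsilon> :: real assume "\<epsilon> > 0"
  then have \<epsilon>2: "\<epsilon> / 2 > 0" by simp
  obtain h where h: "h \<in> A" "norm2 M (\<lambda>x. f x - h x) < \<epsilon> / 2" by (rule L2_limitsE[OF f \<epsilon>2])
  obtain k where k: "k \<in> A" "norm2 M (\<lambda>x. g x - k x) < \<epsilon> / 2" by (rule L2_limitsE[OF g \<epsilon>2])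
  have "norm2 M (\<lambda>x. (f x - h x) + (g x - k x)) < \<epsilon>"
    using norm2_triangle[OF square_integrable_diff[OF L2_limitsD[OF f] subsetD[OF A_L2 h(1)]]
        square_integrable_diff[OF L2_limitsD[OF g] subsetD[OF A_L2 k(1)]]] h k by simp
  then have "norm2 M (\<lambda>x. (f x + g x) - (h x + k x)) < \<epsilon>" by (simp add: algebra_simps)
  then show "\<exists>h\<in>A. norm2 M (\<lambda>x. f x + g x - h x) < \<epsilon>" by (rule bexI[OF _ A_add[OF h(1) k(1)]])
qed

lemma L2_limits_cmult:
  assumes f: "f \<in> L2_limits"
  shows "(\<lambda>x. c * f x) \<in> L2_limits"
  unfolding L2_limits_def
proof (intro CollectI conjI allI impI square_integrable_cmult L2_limitsD f)
  fix \<epsilon> :: real assume \<epsilon>: "\<epsilon> > 0"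
  then have "\<epsilon> / (\<bar>c\<bar> + 1) > 0" by simp
  then obtain h where h: "h \<in> A" "norm2 M (\<lambda>x. f x - h x) < \<epsilon> / (\<bar>c\<bar> + 1)"
    by (rule L2_limitsE[OF f])
  have "norm2 M (\<lambda>x. c * f x - c * h x) = \<bar>c\<bar> * norm2 M (\<lambda>x. f x - h x)"
    using norm2_cmult[of M c "\<lambda>x. f x - h x"] by (simp add: right_diff_distrib)
  also have "\<dots> \<le> \<bar>c\<bar> * (\<epsilon> / (\<bar>c\<bar> + 1))" using h by (intro mult_left_mono) auto
  also have "\<dots> < \<epsilon>" using \<epsilon> by (simp add: field_simps)
  finally show "\<exists>h\<in>A. norm2 M (\<lambda>x. c * f x - h x) < \<epsilon>" by (rule bexI[OF _ A_cmult[OF h(1)]])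
qed

lemma L2_limits_sum:
  "finite I \<Longrightarrow> (\<And>i. i \<in> I \<Longrightarrow> f i \<in> L2_limits) \<Longrightarrow> (\<lambda>x. \<Sum>i\<in>I. f i x) \<in> L2_limits"
proof (induction I rule: finite_induct)
  case empty
  show ?case using L2_limits_base[OF A_0] by simp
next
  case (insert i I)
  then show ?case using L2_limits_add[of "f i" "\<lambda>x. \<Sum>i\<in>I. f i x"] by simp
qed

lemma L2_limits_dominated:
  assumes g: "g \<in> square_integrable M" and f: "f \<in> borel_measurable M"
    and u: "\<And>n. u n \<in> L2_limits"
    and lim: "AE x in M. (\<lambda>n. u n x) \<longlonglongrightarrow> f x" and bound: "\<And>n. AE x in M. \<bar>u n x\<bar> \<le> g x"
  shows "f \<in> L2_limits"
proof (rule L2_limits_closed)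
  note D = norm2_dominated_convergence[OF g f square_integrableD(1)[OF L2_limitsD[OF u]] lim bound]
  show "f \<in> square_integrable M" by (rule D(1))
  fix \<epsilon> :: real assume "\<epsilon> > 0"
  with D(2) have "\<forall>\<^sub>F n in sequentially. norm2 M (\<lambda>x. f x - u n x) < \<epsilon>" by (rule order_tendstoD)
  then obtain n where "norm2 M (\<lambda>x. f x - u n x) < \<epsilon>" by (auto simp: eventually_sequentially)
  then show "\<exists>g\<in>L2_limits. norm2 M (\<lambda>x. f x - g x) < \<epsilon>" using u by blast
qed

lemma const_square_integrable: "(\<lambda>_. c) \<in> square_integrable M"
  by (simp add: square_integrable_def)

context
  fixes a :: real
  assumes a: "a > 0" and exp_limits: "\<And>k. (\<lambda>x. exp (- (a * x)) ^ k) \<in> L2_limits"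
begin

lemma continuous_exp_limits:
  assumes h: "continuous_on UNIV h"
  shows "(\<lambda>x. h (exp (- (a * x)))) \<in> L2_limits"
proof (rule L2_limits_closed)
  have meas: "(\<lambda>x. h (exp (- (a * x)))) \<in> borel_measurable M"
    by (intro borel_measurable_M borel_measurable_continuous_onI continuous_on_compose2[OF h] continuous_intros) auto
  have "compact (h ` {0..1})" using h by (intro compact_continuous_image continuous_on_subset[OF h]) auto
  then obtain B where B0: "\<forall>y\<in>h ` {0..1}. norm y \<le> B"
    using compact_imp_bounded[of "h ` {0..1}"] unfolding bounded_iff by blast
  have B: "\<bar>h x\<bar> \<le> B" if "x \<in> {0..1}" for x using bspec[OF B0 imageI[OF that]] by simp
  have exp01: "exp (- (a * x)) \<in> {0..1}" if "x \<in> space M" for x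
    using that a by (simp add: space_M)
  show hL2: "(\<lambda>x. h (exp (- (a * x)))) \<in> square_integrable M"
  proof (rule square_integrable_bound[OF const_square_integrable meas])
    show "AE x in M. \<bar>h (exp (- (a * x)))\<bar> \<le> \<bar>B\<bar>"
      using B[OF exp01] by (intro AE_I2) (meson abs_ge_self order_trans)
  qed
  fix \<epsilon> :: real assume \<epsilon>: "\<epsilon> > 0"
  define m where "m = measure M (space M) + 1"
  have m: "m > 0" by (simp add: m_def add_nonneg_pos)
  define e where "e = \<epsilon> / (2 * sqrt m)"
  have e: "e > 0" using \<epsilon> m by (simp add: e_def)
  obtain n where n: "\<And>x. x \<in> {0..1} \<Longrightarrow> \<bar>h x - (\<Sum>k\<le>n. h (real k / real n) * Bernstein n k x)\<bar> < e"
    using Bernstein_Weierstrass[of h e] e continuous_on_subset[OF h] by blast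
  define p :: "real poly" where "p = (\<Sum>k\<le>n. smult (h (real k / real n) * real (n choose k)) ([:0, 1:] ^ k * [:1, - 1:] ^ (n - k)))"
  have p: "poly p x = (\<Sum>k\<le>n. h (real k / real n) * Bernstein n k x)" for x
    unfolding p_def Bernstein_def poly_sum by (intro sum.cong refl) (simp add: poly_power mult_ac)
  have "(\<lambda>x. \<Sum>k\<le>degree p. coeff p k * exp (- (a * x)) ^ k) \<in> L2_limits"
    by (intro L2_limits_sum L2_limits_cmult exp_limits) simp
  then have pL: "(\<lambda>x. poly p (exp (- (a * x)))) \<in> L2_limits" by (simp add: poly_altdef)
  have "norm2 M (\<lambda>x. h (exp (- (a * x))) - poly p (exp (- (a * x)))) < \<epsilon>"
  proof -
    have "(norm2 M (\<lambda>x. h (exp (- (a * x))) - poly p (exp (- (a * x)))))\<^sup>2 \<le> (\<integral>x. e\<^sup>2 \<partial>M)"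
      unfolding norm2_power2
    proof (rule integral_mono)
      show "integrable M (\<lambda>x. (h (exp (- (a * x))) - poly p (exp (- (a * x))))\<^sup>2)"
        by (rule square_integrableD(2)[OF square_integrable_diff[OF hL2 L2_limitsD[OF pL]]])
      fix x assume "x \<in> space M"
      from n[OF exp01[OF this]] show "(h (exp (- (a * x))) - poly p (exp (- (a * x))))\<^sup>2 \<le> e\<^sup>2"
        by (intro abs_le_square_iff[THEN iffD1]) (simp add: p)
    qed simp
    also have "\<dots> \<le> m * e\<^sup>2" by (simp add: m_def mult_right_mono)
    also have "\<dots> = (\<epsilon> / 2)\<^sup>2" using m by (simp add: e_def power_divide power_mult_distrib)
    finally have "norm2 M (\<lambda>x. h (exp (- (a * x))) - poly p (exp (- (a * x)))) \<le> \<epsilon> / 2"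
      by (rule power2_le_imp_le) (use \<epsilon> in simp)
    then show ?thesis using \<epsilon> by simp
  qed
  then show "\<exists>g\<in>L2_limits. norm2 M (\<lambda>x. h (exp (- (a * x))) - g x) < \<epsilon>" by (rule bexI[OF _ pL])
qed

text \<open>The indicator of an initial interval is a pointwise limit of continuous functions of \<open>exp (- (a * x))\<close>.\<close>

lemma indicator_initial_limits: "indicator {0<..c} \<in> L2_limits"
proof (rule L2_limits_dominated[where g = "\<lambda>_. 1"])
  define v where "v = exp (- (a * c))"
  define u where "u n x = max 0 (min 1 (1 + real n * (exp (- (a * x)) - v)))" for n x
  show "u n \<in> L2_limits" for n
    unfolding u_def by (rule continuous_exp_limits) (intro continuous_intros)
  show "AE x in M. \<bar>u n x\<bar> \<le> 1" for n by (simp add: u_def)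
  show "indicator {0<..c} \<in> borel_measurable M" by (rule borel_measurable_M) simp
  show "AE x in M. (\<lambda>n. u n x) \<longlonglongrightarrow> indicator {0<..c} x"
  proof (rule AE_I2)
    fix x assume x: "x \<in> space M"
    show "(\<lambda>n. u n x) \<longlonglongrightarrow> indicator {0<..c} x"
    proof (cases "x \<le> c")
      case True
      then have "exp (- (a * x)) - v \<ge> 0" using a by (simp add: v_def)
      then have "u n x = 1" for n by (simp add: u_def)
      then show ?thesis using x True by (simp add: space_M)
    next
      case False
      then have d: "v - exp (- (a * x)) > 0" using a by (simp add: v_def)
      have "\<forall>\<^sub>F n in sequentially. real n \<ge> 1 / (v - exp (- (a * x)))"
        using filterlim_real_sequentially by (simp add: filterlim_at_top)
      then have "\<forall>\<^sub>F n in sequentially. u n x = 0"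
      proof eventually_elim
        case (elim n)
        then have "real n * (v - exp (- (a * x))) \<ge> 1" using d by (simp add: field_simps)
        then show ?case by (simp add: u_def algebra_simps)
      qed
      then have "(\<lambda>n. u n x) \<longlonglongrightarrow> 0" by (rule tendsto_eventually)
      then show ?thesis using False by simp
    qed
  qed
qed (rule const_square_integrable)

text \<open>The initial intervals are stable under intersection and generate the Borel sets, and the sets with an
  approximable indicator are closed under complements and disjoint unions.\<close>

lemma indicator_limits:
  assumes "B \<in> sets M"
  shows "indicator B \<in> L2_limits"
proof -
  have gen: "sets M = sigma_sets {0<..} (range (\<lambda>c. {0<..c}))"
  proof -
    have "sets (borel :: real measure) = sigma_sets UNIV (range (\<lambda>c. {..c}))"
      by (subst borel_eq_atMost) (simp add: sets_measure_of)
    moreover have "(\<inter>) {0<..} ` sigma_sets UNIV (range (\<lambda>c::real. {..c})) = sigma_sets {0<..} ((\<inter>) {0<..} ` range (\<lambda>c::real. {..c}))"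
    proof (rule sigma_sets_Int)
      show "{0<..} \<in> sigma_sets UNIV (range (\<lambda>c::real. {..c}))"
        using calculation by (metis borel_open open_greaterThan)
    qed simp
    ultimately have "sets M = sigma_sets {0<..} ((\<inter>) {0<..} ` range (\<lambda>c::real. {..c}))"
      unfolding sets_M sets_restrict_space by simp
    moreover have "(\<inter>) {0<..} ` range (\<lambda>c::real. {..c}) = range (\<lambda>c. {0<..c})"
      by (auto simp: image_image intro!: image_cong)
    ultimately show ?thesis by simp
  qed
  have "Int_stable (range (\<lambda>c::real. {0<..c}))"
  proof (rule Int_stableI_image)
    fix c d :: real
    have "{0<..c} \<inter> {0<..d} = {0<..min c d}" by auto
    then show "\<exists>k\<in>UNIV. {0<..c} \<inter> {0<..d} = {0<..k}" by blast
  qed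
  moreover have "range (\<lambda>c::real. {0<..c}) \<subseteq> Pow {0<..}" by auto
  moreover have "B \<in> sigma_sets {0<..} (range (\<lambda>c. {0<..c}))" using assms gen by simp
  ultimately show ?thesis
  proof (induction rule: sigma_sets_induct_disjoint)
    case (basic B)
    then show ?case using indicator_initial_limits by auto
  next
    case empty
    then show ?case using L2_limits_base[OF A_0] by simp
  next
    case (compl B)
    have one: "(\<lambda>_. 1) \<in> L2_limits" using continuous_exp_limits[of "\<lambda>_. 1"] by simp
    have gL: "(\<lambda>x. 1 + - 1 * indicator B x) \<in> L2_limits" by (intro L2_limits_add one L2_limits_cmult compl)
    have zero: "norm2 M (\<lambda>x. indicator ({0<..} - B) x - (1 + - 1 * indicator B x)) = 0"
    proof -
      have "indicator ({0<..} - B) x - (1 + - 1 * indicator B x) = (0::real)" if "x > 0" for x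
        using that by (cases "x \<in> B") simp_all
      then have "(\<integral>x. (indicator ({0<..} - B) x - (1 + - 1 * indicator B x))\<^sup>2 \<partial>M) = (\<integral>x. (0::real) \<partial>M)"
        by (intro Bochner_Integration.integral_cong refl) (simp only: space_M greaterThan_iff zero_power2)
      then show ?thesis by (simp add: norm2_def)
    qed
    show ?case
    proof (rule L2_limits_closed)
      show "\<exists>g\<in>L2_limits. norm2 M (\<lambda>x. indicator ({0<..} - B) x - g x) < \<epsilon>" if "\<epsilon> > 0" for \<epsilon>
        using that zero by (intro bexI[OF _ gL]) simp
    show "indicator ({0<..} - B) \<in> square_integrable M"
    proof (rule square_integrable_bound[OF const_square_integrable[of 1]])
      have "{0<..} - B \<in> sets M" using compl(1) gen space_M by (metis sets.compl_sets)
      then show "indicator ({0<..} - B) \<in> borel_measurable M" by simp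
    qed (simp add: indicator_def)
    qed
  next
    case (union B)
    have sum: "(\<Sum>i<n. indicator (B i) x) = (indicator (\<Union>i<n. B i) x :: real)" for n x
      using union(1) by (intro indicator_UN_disjoint[symmetric]) (auto intro: disjoint_family_on_mono)
    show ?case
    proof (rule L2_limits_dominated[where g = "\<lambda>_. 1" and u = "\<lambda>n x. \<Sum>i<n. indicator (B i) x"])
      show "(\<lambda>x. \<Sum>i<n. indicator (B i) x) \<in> L2_limits" for n
        using union by (intro L2_limits_sum) auto
      have B: "B i \<in> sets M" for i using union(2) gen by auto
      then show "indicator (\<Union>i. B i) \<in> borel_measurable M" by simp
      show "AE x in M. (\<lambda>n. \<Sum>i<n. indicator (B i) x) \<longlonglongrightarrow> (indicator (\<Union>i. B i) x :: real)"
        unfolding sum by (intro AE_I2 LIMSEQ_indicator_UN)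
      show "AE x in M. \<bar>\<Sum>i<n. indicator (B i) x\<bar> \<le> (1::real)" for n
        unfolding sum by (intro AE_I2) (simp add: indicator_def)
    qed (rule const_square_integrable)
  qed
qed

lemma all_limits_nonneg:
  assumes "f \<in> borel_measurable M" "\<And>x. 0 \<le> f x"
  shows "f \<in> square_integrable M \<longrightarrow> f \<in> L2_limits"
  using assms
proof (induction rule: borel_measurable_induct_real)
  case (set B)
  then show ?case using indicator_limits by blast
next
  case (mult u c)
  show ?case
  proof
    assume *: "(\<lambda>x. c * u x) \<in> square_integrable M"
    show "(\<lambda>x. c * u x) \<in> L2_limits"
    proof (cases "c = 0")
      case True
      then show ?thesis using L2_limits_base[OF A_0] by simp
    next
      case False
      then have "u \<in> square_integrable M"
        using square_integrable_cmult[OF *, of "1 / c"] by simp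
      then show ?thesis using mult by (intro L2_limits_cmult) blast
    qed
  qed
next
  case (add u v)
  show ?case
  proof
    assume *: "(\<lambda>x. v x + u x) \<in> square_integrable M"
    have "u \<in> square_integrable M" "v \<in> square_integrable M"
      by (rule square_integrable_bound[OF *]; use add in \<open>simp add: abs_of_nonneg\<close>)+
    then show "(\<lambda>x. v x + u x) \<in> L2_limits" using add by (intro L2_limits_add) blast+
  qed
next
  case (seq U)
  have le: "U n x \<le> f x" if "x \<in> space M" for n x
  proof (rule incseq_le)
    show "incseq (\<lambda>n. U n x)" using seq(3) by (auto simp: incseq_def le_fun_def)
    show "(\<lambda>n. U n x) \<longlonglongrightarrow> f x" by (rule seq(4)[OF that])
  qed
  show ?case
  proof
    assume f: "f \<in> square_integrable M"
    have "U n \<in> square_integrable M" for n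
    proof (rule square_integrable_bound[OF f seq(1)], rule AE_I2)
      fix x assume "x \<in> space M"
      with le[OF this, of n] seq(2)[of n x] show "\<bar>U n x\<bar> \<le> \<bar>f x\<bar>" by linarith
    qed
    then have UL: "U n \<in> L2_limits" for n using seq(5) by blast
    show "f \<in> L2_limits"
    proof (rule L2_limits_dominated[OF f square_integrableD(1)[OF f] UL])
      show "AE x in M. (\<lambda>n. U n x) \<longlonglongrightarrow> f x" by (intro AE_I2 seq(4))
      show "AE x in M. \<bar>U n x\<bar> \<le> f x" for n by (intro AE_I2) (simp add: le seq(2))
    qed
  qed
qed

lemma all_limits:
  assumes f: "f \<in> square_integrable M"
  shows "f \<in> L2_limits"
proof -
  note [measurable] = square_integrableD(1)[OF f]
  have *: "(\<lambda>x. max 0 (c * f x)) \<in> L2_limits" if "\<bar>c\<bar> = 1" for c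
  proof -
    have "(\<lambda>x. max 0 (c * f x)) \<in> square_integrable M"
    proof (rule square_integrable_bound[OF f])
      have "\<bar>max 0 (c * f x)\<bar> \<le> \<bar>f x\<bar>" for x
      proof -
        have "\<bar>c * f x\<bar> = \<bar>f x\<bar>" using that by (simp add: abs_mult)
        then show ?thesis by linarith
      qed
      then show "AE x in M. \<bar>max 0 (c * f x)\<bar> \<le> \<bar>f x\<bar>" by simp
    qed measurable
    then show ?thesis using all_limits_nonneg[of "\<lambda>x. max 0 (c * f x)"] by simp
  qed
  have "(\<lambda>x. max 0 (1 * f x) + - 1 * max 0 (- 1 * f x)) \<in> L2_limits"
    by (intro L2_limits_add L2_limits_cmult *) auto
  moreover have "max 0 (1 * f x) + - 1 * max 0 (- 1 * f x) = f x" for x by simp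
  ultimately show ?thesis by (simp only:)
qed

end

text \<open>Polynomials approximate \<open>x ^ m * exp (- (a * x)) ^ k\<close> successively in \<open>k\<close>: each further factor
  \<open>exp (- (a * x))\<close> is a Taylor series whose partial sums are dominated by \<open>exp (a * x)\<close>.\<close>

lemma polynomials_dense:
  assumes c: "c > 0" and exp_int: "integrable M (\<lambda>x. exp (c * x))"
    and polys: "\<And>p. poly p \<in> A"
    and f: "f \<in> square_integrable M"
  shows "f \<in> L2_limits"
proof -
  \<comment> \<open>the dominating function \<open>x ^ m * exp (a * x)\<close> is squared, and half of \<open>c\<close> is kept to absorb the power\<close>
  define a where "a = c / 4"
  have a: "a > 0" using c by (simp add: a_def)
  have dom: "(\<lambda>x. x ^ m * exp (a * x)) \<in> square_integrable M" for m
  proof -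
    have "integrable M (\<lambda>x. (x ^ m * exp (a * x))\<^sup>2)"
    proof (rule Bochner_Integration.integrable_bound)
      show "integrable M (\<lambda>x. (fact (2 * m) * (2 / c) ^ (2 * m)) * exp (c * x))"
        using exp_int by simp
      show "(\<lambda>x. (x ^ m * exp (a * x))\<^sup>2) \<in> borel_measurable M" by (rule borel_measurable_M) measurable
      show "AE x in M. norm ((x ^ m * exp (a * x))\<^sup>2) \<le> norm ((fact (2 * m) * (2 / c) ^ (2 * m)) * exp (c * x))"
      proof (rule AE_I2)
        fix x assume "x \<in> space M"
        then have x: "x > 0" by (simp add: space_M)
        have "(c / 2 * x) ^ (2 * m) / fact (2 * m) \<le> exp (c / 2 * x)"
          using c x by (intro power_le_fact_exp) simp
        then have "x ^ (2 * m) \<le> fact (2 * m) * (2 / c) ^ (2 * m) * exp (c / 2 * x)"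
          using c by (simp add: power_mult_distrib power_divide field_simps)
        then have "x ^ (2 * m) * exp (c / 2 * x) \<le> fact (2 * m) * (2 / c) ^ (2 * m) * exp (c / 2 * x) * exp (c / 2 * x)"
          by (intro mult_right_mono) auto
        also have "\<dots> = fact (2 * m) * (2 / c) ^ (2 * m) * exp (c * x)"
          unfolding mult.assoc exp_add[symmetric] by simp
        also have "x ^ (2 * m) * exp (c / 2 * x) = (x ^ m * exp (a * x))\<^sup>2"
          by (simp add: a_def power_mult_distrib power2_eq_square mult_2 power_add flip: exp_add)
        finally show "norm ((x ^ m * exp (a * x))\<^sup>2) \<le> norm ((fact (2 * m) * (2 / c) ^ (2 * m)) * exp (c * x))"
          by (simp add: abs_mult)
      qed
    qed
    then show ?thesis by (simp add: square_integrable_def borel_measurable_M)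
  qed
  have "\<forall>m. (\<lambda>x. x ^ m * exp (- (a * x)) ^ k) \<in> L2_limits" for k
  proof (induction k)
    case 0
    have "poly (monom 1 m) \<in> A" for m :: nat by (rule polys)
    then show ?case by (auto intro!: L2_limits_base simp: poly_monom[abs_def])
  next
    case (Suc k)
    show ?case
    proof
      fix m
      define u where "u n x = (\<Sum>j<n. ((- a) ^ j / fact j) * (x ^ (m + j) * exp (- (a * x)) ^ k))" for n x
      have u_eq: "u n x = x ^ m * exp (- (a * x)) ^ k * (\<Sum>j<n. (- (a * x)) ^ j / fact j)" for n x
        unfolding u_def sum_distrib_left by (intro sum.cong refl) (simp only: minus_mult_left power_mult_distrib power_add divide_inverse mult_ac)
      show "(\<lambda>x. x ^ m * exp (- (a * x)) ^ Suc k) \<in> L2_limits"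
      proof (rule L2_limits_dominated[OF dom[of m], of _ u])
        show "(\<lambda>x. x ^ m * exp (- (a * x)) ^ Suc k) \<in> borel_measurable M"
          by (rule borel_measurable_M) measurable
        show "u n \<in> L2_limits" for n
          unfolding u_def using Suc by (intro L2_limits_sum L2_limits_cmult) auto
        show "AE x in M. (\<lambda>n. u n x) \<longlonglongrightarrow> x ^ m * exp (- (a * x)) ^ Suc k"
        proof (rule AE_I2)
          fix x
          have "(\<lambda>n. \<Sum>j<n. (- (a * x)) ^ j / fact j) \<longlonglongrightarrow> exp (- (a * x))"
            using exp_converges[of "- (a * x)"] by (simp add: sums_def divide_inverse_commute)
          then have "(\<lambda>n. u n x) \<longlonglongrightarrow> x ^ m * exp (- (a * x)) ^ k * exp (- (a * x))"
            unfolding u_eq by (intro tendsto_intros)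
          then show "(\<lambda>n. u n x) \<longlonglongrightarrow> x ^ m * exp (- (a * x)) ^ Suc k" by (simp add: mult_ac)
        qed
        show "AE x in M. \<bar>u n x\<bar> \<le> x ^ m * exp (a * x)" for n
        proof (rule AE_I2)
          fix x assume "x \<in> space M"
          then have x: "x > 0" by (simp add: space_M)
          have "\<bar>\<Sum>j<n. (- (a * x)) ^ j / fact j\<bar> \<le> (\<Sum>j<n. (a * x) ^ j / fact j)"
            using a x by (intro order_trans[OF sum_abs] sum_mono) (simp add: abs_mult power_abs)
          also have "\<dots> \<le> exp (a * x)" using a x by (intro exp_partial_sum_le) simp
          finally have *: "\<bar>\<Sum>j<n. (- (a * x)) ^ j / fact j\<bar> \<le> exp (a * x)" .
          have "\<bar>u n x\<bar> = x ^ m * exp (- (a * x)) ^ k * \<bar>\<Sum>j<n. (- (a * x)) ^ j / fact j\<bar>"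
            unfolding u_eq abs_mult using x by simp
          also have "\<dots> \<le> x ^ m * 1 * exp (a * x)"
            using * a x by (intro mult_mono power_le_one) auto
          finally show "\<bar>u n x\<bar> \<le> x ^ m * exp (a * x)" by simp
        qed
      qed
    qed
  qed
  from spec[OF this, of 0] show ?thesis by (intro all_limits[OF a _ f]) simp
qed

end

section \<open>Contractivity and injectivity of the operator\<close>

context gauss_laguerre
begin

abbreviation "Lam \<equiv> gauss_laguerre_Lambda \<alpha> \<beta>"

lemma L2_eq: "L2 laguerre_weight = square_integrable (E 1)" "L2 ew = square_integrable M"
  by (simp_all add: L2_eq_square_integrable laguerre_eq_E M_def)

lemma norm2_eq: "L2_norm laguerre_weight = norm2 (E 1)" "L2_norm ew = norm2 M"
  by (simp_all add: L2_norm_eq_norm2 laguerre_eq_E M_def)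

lemma borel_measurable_MNE:
  "f \<in> borel_measurable M \<longleftrightarrow> f \<in> borel_measurable (restrict_space borel {0<..})"
  "f \<in> borel_measurable N \<longleftrightarrow> f \<in> borel_measurable (restrict_space borel {0<..})"
  "f \<in> borel_measurable (E a) \<longleftrightarrow> f \<in> borel_measurable (restrict_space borel {0<..})"
  unfolding M_def N_def E_def by (rule measurable_weighted_iff)+

lemma borel_measurable_MNE_I:
  assumes "f \<in> borel_measurable borel"
  shows "f \<in> borel_measurable M" "f \<in> borel_measurable N" "f \<in> borel_measurable (E a)"
  unfolding M_def N_def E_def using assms by (rule borel_measurable_weightedI)+

lemma AE_M_pos: "AE x in M. x > 0"
  by (rule AE_I2) simp

lemma Lam_eq_integral:
  assumes f: "f \<in> borel_measurable (restrict_space borel {0<..})" and x: "x > 0"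
  shows "Lam f x = (\<integral>y. f (x * y) \<partial>N)"
    and "set_integrable lborel {0<..} (\<lambda>y. f (x * y) * dens y) \<longleftrightarrow> integrable N (\<lambda>y. f (x * y))"
proof -
  have "(\<lambda>y. f (x * y)) \<in> borel_measurable (weighted dens)"
    unfolding measurable_weighted_iff by (rule measurable_scale_halfline[OF x f])
  note I = integral_weighted[OF borel_measurable_lambda lambda_nonneg this]
  show "Lam f x = (\<integral>y. f (x * y) \<partial>N)"
    unfolding gauss_laguerre_Lambda_def mult_operator_def N_def using I(2) by simp
  show "set_integrable lborel {0<..} (\<lambda>y. f (x * y) * dens y) \<longleftrightarrow> integrable N (\<lambda>y. f (x * y))"
    unfolding N_def using I(1) by simp
qed

lemma measurable_product_comp:
  assumes f: "f \<in> (restrict_space borel {0<..} :: real measure) \<rightarrow>\<^sub>M K"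
  shows "(\<lambda>(x, y). f (x * y)) \<in> M \<Otimes>\<^sub>M N \<rightarrow>\<^sub>M K"
  using measurable_compose[OF measurable_mult_halfline f, of ew dens]
  by (simp add: M_def N_def case_prod_beta')

lemma borel_measurable_Lam:
  assumes f: "f \<in> borel_measurable (restrict_space borel {0<..})"
  shows "Lam f \<in> borel_measurable M"
proof -
  interpret N: prob_space N by (rule prob_space_N)
  have "(\<lambda>x. \<integral>y. f (x * y) \<partial>N) \<in> borel_measurable M"
    by (rule N.borel_measurable_lebesgue_integral[OF measurable_product_comp[OF f]])
  then show ?thesis
    by (rule measurable_cong[THEN iffD1, rotated]) (simp add: Lam_eq_integral(1)[OF f])
qed

text \<open>Tonelli and the factorisation: the second moments of the sections have the finite mean \<open>\<integral> f\<^sup>2 dE\<close>.\<close>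

lemma AE_section_integrable:
  assumes f: "f \<in> square_integrable (E 1)"
  shows "AE x in M. integrable N (\<lambda>y. (f (x * y))\<^sup>2)"
proof -
  interpret N: prob_space N by (rule prob_space_N)
  note fm = square_integrableD(1)[OF f, unfolded borel_measurable_MNE]
  have sq: "(\<lambda>u. ennreal ((f u)\<^sup>2)) \<in> borel_measurable (restrict_space borel {0<..})"
    using fm by measurable
  have "(\<lambda>x. \<integral>\<^sup>+y. ennreal ((f (x * y))\<^sup>2) \<partial>N) \<in> borel_measurable M"
    by (rule N.borel_measurable_nn_integral[OF measurable_product_comp[OF sq]])
  moreover have "(\<integral>\<^sup>+x. (\<integral>\<^sup>+y. ennreal ((f (x * y))\<^sup>2) \<partial>N) \<partial>M) \<noteq> \<infinity>"
    using square_integrableD(2)[OF f] unfolding nn_integral_product[OF sq]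
    by (simp add: real_integrable_def)
  ultimately have "AE x in M. (\<integral>\<^sup>+y. ennreal ((f (x * y))\<^sup>2) \<partial>N) \<noteq> \<infinity>"
    by (rule nn_integral_PInf_AE)
  then show ?thesis using AE_M_pos
  proof eventually_elim
    case (elim x)
    show ?case
    proof (rule integrableI_bounded)
      have "(\<lambda>y. f (x * y)) \<in> borel_measurable N"
        unfolding borel_measurable_MNE by (rule measurable_scale_halfline[OF elim(2) fm])
      then show "(\<lambda>y. (f (x * y))\<^sup>2) \<in> borel_measurable N" by measurable
    qed (use elim(1) in \<open>simp add: less_top\<close>)
  qed
qed

lemma section_integrable:
  assumes f: "f \<in> borel_measurable (restrict_space borel {0<..})" and x: "x > 0"
    and int: "integrable N (\<lambda>y. (f (x * y))\<^sup>2)"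
  shows "integrable N (\<lambda>y. f (x * y))" "(Lam f x)\<^sup>2 \<le> (\<integral>y. (f (x * y))\<^sup>2 \<partial>N)"
proof -
  interpret N: prob_space N by (rule prob_space_N)
  have "(\<lambda>y. f (x * y)) \<in> borel_measurable N"
    unfolding borel_measurable_MNE by (rule measurable_scale_halfline[OF x f])
  then have sec: "(\<lambda>y. f (x * y)) \<in> square_integrable N" using int by (simp add: square_integrable_def)
  then show "integrable N (\<lambda>y. f (x * y))" by (rule N.integrable_square_integrable)
  have "(\<lambda>_. 1) \<in> square_integrable N" by (simp add: square_integrable_def)
  from square_integrable_Cauchy_Schwarz[OF sec this]
  have "\<bar>Lam f x\<bar> \<le> norm2 N (\<lambda>y. f (x * y))"
    using N.prob_space by (simp add: Lam_eq_integral(1)[OF f x] norm2_def del: space_MNE)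
  then have "\<bar>Lam f x\<bar>\<^sup>2 \<le> (norm2 N (\<lambda>y. f (x * y)))\<^sup>2" by (rule power_mono) simp
  then show "(Lam f x)\<^sup>2 \<le> (\<integral>y. (f (x * y))\<^sup>2 \<partial>N)" by (simp add: norm2_power2)
qed

text \<open>Jensen's inequality for the probability density and the factorisation of the exponential law
  make the operator a contraction.\<close>

lemma Lam_contraction:
  assumes f: "f \<in> square_integrable (E 1)"
  shows "Lam f \<in> square_integrable M" "norm2 M (Lam f) \<le> norm2 (E 1) f"
proof -
  note fm = square_integrableD(1)[OF f, unfolded borel_measurable_MNE]
  have sq: "(\<lambda>u. ennreal ((f u)\<^sup>2)) \<in> borel_measurable (restrict_space borel {0<..})"
    using fm by measurable
  have "(\<integral>\<^sup>+x. ennreal ((Lam f x)\<^sup>2) \<partial>M) \<le> (\<integral>\<^sup>+x. (\<integral>\<^sup>+y. ennreal ((f (x * y))\<^sup>2) \<partial>N) \<partial>M)"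
  proof (rule nn_integral_mono_AE)
    show "AE x in M. ennreal ((Lam f x)\<^sup>2) \<le> (\<integral>\<^sup>+y. ennreal ((f (x * y))\<^sup>2) \<partial>N)"
      using AE_section_integrable[OF f] AE_M_pos
    proof eventually_elim
      case (elim x)
      then show ?case using section_integrable(2)[OF fm _ elim(1)]
        by (simp add: nn_integral_eq_integral ennreal_leI)
    qed
  qed
  also have "\<dots> = (\<integral>\<^sup>+u. ennreal ((f u)\<^sup>2) \<partial>E 1)" by (rule nn_integral_product[OF sq])
  also have "\<dots> = ennreal (\<integral>u. (f u)\<^sup>2 \<partial>E 1)"
    by (rule nn_integral_eq_integral[OF square_integrableD(2)[OF f]]) simp
  finally have le: "(\<integral>\<^sup>+x. ennreal ((Lam f x)\<^sup>2) \<partial>M) \<le> ennreal (\<integral>u. (f u)\<^sup>2 \<partial>E 1)" .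
  note meas = borel_measurable_Lam[OF fm]
  have int: "integrable M (\<lambda>x. (Lam f x)\<^sup>2)"
  proof (rule integrableI_bounded)
    show "(\<lambda>x. (Lam f x)\<^sup>2) \<in> borel_measurable M" using meas by measurable
    show "(\<integral>\<^sup>+x. ennreal (norm ((Lam f x)\<^sup>2)) \<partial>M) < \<infinity>" using le by (simp add: le_less_trans)
  qed
  then show "Lam f \<in> square_integrable M" using meas by (simp add: square_integrable_def)
  have "ennreal (\<integral>x. (Lam f x)\<^sup>2 \<partial>M) \<le> ennreal (\<integral>u. (f u)\<^sup>2 \<partial>E 1)"
    using le nn_integral_eq_integral[OF int] by simp
  then have "(\<integral>x. (Lam f x)\<^sup>2 \<partial>M) \<le> (\<integral>u. (f u)\<^sup>2 \<partial>E 1)"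
    by (simp add: integral_nonneg_AE)
  then show "norm2 M (Lam f) \<le> norm2 (E 1) f" by (simp add: norm2_def)
qed

lemma Lam_linear:
  assumes f: "f \<in> square_integrable (E 1)" and g: "g \<in> square_integrable (E 1)"
  shows "AE x in M. Lam (\<lambda>x. a * f x + c * g x) x = a * Lam f x + c * Lam g x"
proof -
  note fm = square_integrableD(1)[OF f, unfolded borel_measurable_MNE]
  note gm = square_integrableD(1)[OF g, unfolded borel_measurable_MNE]
  have hm: "(\<lambda>x. a * f x + c * g x) \<in> borel_measurable (restrict_space borel {0<..})"
    using fm gm by measurable
  show ?thesis
    using AE_section_integrable[OF f] AE_section_integrable[OF g] AE_M_pos
  proof eventually_elim
    case (elim x)
    then show ?case
      using section_integrable(1)[OF fm elim(3,1)] section_integrable(1)[OF gm elim(3,2)]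
      by (simp add: Lam_eq_integral(1) fm gm hm)
  qed
qed

lemma AE_set_integrable_section:
  assumes f: "f \<in> square_integrable (E 1)"
  shows "AE x in M. set_integrable lborel {0<..} (\<lambda>y. f (x * y) * dens y)"
proof -
  note fm = square_integrableD(1)[OF f, unfolded borel_measurable_MNE]
  show ?thesis
    using AE_section_integrable[OF f] AE_M_pos
  proof eventually_elim
    case (elim x)
    then show ?case using section_integrable(1)[OF fm elim(2,1)] Lam_eq_integral(2)[OF fm elim(2)] by simp
  qed
qed

lemma distr_product_weighted:
  assumes a: "a > 0"
  shows "distr (density (M \<Otimes>\<^sub>M N) (\<lambda>(x, y). ennreal (ew (a * x) / ew x))) (restrict_space borel {0<..}) (\<lambda>(x, y). x * y) = E a"
proof (rule measure_eqI)
  interpret N: prob_space N by (rule prob_space_N)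
  let ?k = "\<lambda>x. ennreal (ew (a * x) / ew x)"
  let ?D = "distr (density (M \<Otimes>\<^sub>M N) (\<lambda>(x, y). ?k x)) (restrict_space borel {0<..}) (\<lambda>(x, y). x * y)"
  have k: "?k \<in> borel_measurable M" by (rule borel_measurable_MNE_I) measurable
  have k': "(\<lambda>(x, y). ?k x) \<in> borel_measurable (M \<Otimes>\<^sub>M N)"
    using measurable_compose[OF measurable_fst k] by (simp add: case_prod_beta')
  have mult: "(\<lambda>(x, y). x * y) \<in> M \<Otimes>\<^sub>M N \<rightarrow>\<^sub>M restrict_space borel {0<..}"
    using measurable_mult_halfline[of ew dens] by (simp add: M_def N_def)
  show "sets ?D = sets (E a)"
    by (simp add: sets_MNE)
  fix B assume "B \<in> sets ?D"
  then have B: "B \<in> sets (restrict_space borel {0<..})" by simp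
  then have ind: "indicator B \<in> borel_measurable (restrict_space borel {0<..} :: real measure)" by simp
  have "emeasure ?D B
    = (\<integral>\<^sup>+u. indicator B u \<partial>?D)"
    using B by simp
  also have "\<dots> = (\<integral>\<^sup>+z. indicator B (case z of (x, y) \<Rightarrow> x * y) \<partial>density (M \<Otimes>\<^sub>M N) (\<lambda>(x, y). ?k x))"
    using mult ind by (intro nn_integral_distr) auto
  also have "\<dots> = (\<integral>\<^sup>+z. (case z of (x, y) \<Rightarrow> ?k x) * indicator B (case z of (x, y) \<Rightarrow> x * y) \<partial>(M \<Otimes>\<^sub>M N))"
    using k' measurable_compose[OF mult ind] by (intro nn_integral_density) auto
  also have "\<dots> = (\<integral>\<^sup>+x. \<integral>\<^sup>+y. ?k x * indicator B (x * y) \<partial>N \<partial>M)"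
  proof -
    have "(\<lambda>z. (case z of (x, y) \<Rightarrow> ?k x) * indicator B (case z of (x, y) \<Rightarrow> x * y)) \<in> borel_measurable (M \<Otimes>\<^sub>M N)"
      using k' measurable_compose[OF mult ind] by (rule borel_measurable_times_ennreal)
    from N.nn_integral_fst[OF this] show ?thesis by simp
  qed
  also have "\<dots> = (\<integral>\<^sup>+x. ?k x * (\<integral>\<^sup>+y. indicator B (x * y) \<partial>N) \<partial>M)"
  proof (rule nn_integral_cong)
    fix x assume "x \<in> space M"
    then have "(\<lambda>y. indicator B (x * y) :: ennreal) \<in> borel_measurable N"
      unfolding borel_measurable_MNE using ind by (intro measurable_scale_halfline) auto
    then show "(\<integral>\<^sup>+y. ?k x * indicator B (x * y) \<partial>N) = ?k x * (\<integral>\<^sup>+y. indicator B (x * y) \<partial>N)"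
      by (rule nn_integral_cmult)
  qed
  also have "\<dots> = (\<integral>\<^sup>+u. indicator B u \<partial>E a)"
    by (rule nn_integral_product_weighted[OF a ind])
  also have "\<dots> = emeasure (E a) B" using B by (simp add: sets_MNE)
  finally show "emeasure ?D B = emeasure (E a) B" .
qed

lemma integrable_product:
  fixes h :: "real \<Rightarrow> real"
  assumes h: "integrable (E 1) h"
  shows "integrable (M \<Otimes>\<^sub>M N) (\<lambda>(x, y). h (x * y))"
proof -
  interpret N: prob_space N by (rule prob_space_N)
  have hm: "h \<in> borel_measurable (restrict_space borel {0<..})"
    using borel_measurable_integrable[OF h] unfolding borel_measurable_MNE .
  then have nm: "(\<lambda>u. ennreal (norm (h u))) \<in> borel_measurable (restrict_space borel {0<..})" by measurable
  show ?thesis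
  proof (rule integrableI_bounded)
    show "(\<lambda>(x, y). h (x * y)) \<in> borel_measurable (M \<Otimes>\<^sub>M N)" by (rule measurable_product_comp[OF hm])
    have "(\<integral>\<^sup>+z. ennreal (norm (case z of (x, y) \<Rightarrow> h (x * y))) \<partial>(M \<Otimes>\<^sub>M N))
      = (\<integral>\<^sup>+z. (case z of (x, y) \<Rightarrow> ennreal (norm (h (x * y)))) \<partial>(M \<Otimes>\<^sub>M N))"
      by (rule nn_integral_cong) (simp split: prod.split)
    also have "\<dots> = (\<integral>\<^sup>+x. \<integral>\<^sup>+y. ennreal (norm (h (x * y))) \<partial>N \<partial>M)"
      using N.nn_integral_fst[OF measurable_product_comp[OF nm]] by simp
    also have "\<dots> = (\<integral>\<^sup>+u. ennreal (norm (h u)) \<partial>E 1)" by (rule nn_integral_product[OF nm])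
    also have "\<dots> < \<infinity>" using h by (simp add: integrable_iff_bounded)
    finally show "(\<integral>\<^sup>+z. ennreal (norm (case z of (x, y) \<Rightarrow> h (x * y))) \<partial>(M \<Otimes>\<^sub>M N)) < \<infinity>" .
  qed
qed

lemma weight_ratio_bound:
  assumes a: "a \<ge> 1" and x: "x > 0"
  shows "ew (a * x) / ew x \<le> a powr (\<beta> + 1 / \<alpha> - 1)"
proof -
  have "x powr (1 / \<alpha>) \<le> (a * x) powr (1 / \<alpha>)" using a x \<alpha>_pos by (intro powr_mono2) auto
  then have e: "exp (- ((a * x) powr (1 / \<alpha>))) \<le> exp (- (x powr (1 / \<alpha>)))" by simp
  have "ew (a * x) \<le> a powr (\<beta> + 1 / \<alpha> - 1) * ew x"
  proof -
    have "ew (a * x) = a powr (\<beta> + 1 / \<alpha> - 1) * (x powr (\<beta> + 1 / \<alpha> - 1) * exp (- ((a * x) powr (1 / \<alpha>))) / (\<alpha> * Gamma b))"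
      using a x by (simp add: gauss_laguerre_weight_def powr_mult b_def)
    also have "\<dots> \<le> a powr (\<beta> + 1 / \<alpha> - 1) * (x powr (\<beta> + 1 / \<alpha> - 1) * exp (- (x powr (1 / \<alpha>))) / (\<alpha> * Gamma b))"
      using e Gamma_b_pos \<alpha>_pos by (intro mult_left_mono divide_right_mono) auto
    finally show ?thesis by (simp add: gauss_laguerre_weight_def b_def)
  qed
  then show ?thesis using ew_pos[OF x] by (simp add: divide_le_eq)
qed

text \<open>If \<open>\<Lambda>h\<close> vanishes, integrating it against dilated copies of the invariant weight shows that
  the Laplace transform of \<open>h\<close> vanishes on \<open>[1, \<infinity>)\<close>.\<close>

lemma Lam_eq_0_imp:
  assumes h: "h \<in> square_integrable (E 1)" and 0: "AE x in M. Lam h x = 0" and a: "a \<ge> 1"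
  shows "(\<integral>u. h u \<partial>E a) = 0"
proof -
  interpret M: prob_space M by (rule prob_space_M)
  interpret N: prob_space N by (rule prob_space_N)
  interpret E: prob_space "E 1" by (rule prob_space_E)
  interpret pair_sigma_finite M N ..
  note hm = square_integrableD(1)[OF h, unfolded borel_measurable_MNE]
  let ?k = "\<lambda>x. ew (a * x) / ew x"
  have k: "?k \<in> borel_measurable M" by (rule borel_measurable_MNE_I) measurable
  have k': "(\<lambda>z. ?k (fst z)) \<in> borel_measurable (M \<Otimes>\<^sub>M N)"
    by (rule measurable_compose[OF measurable_fst k])
  have mult: "(\<lambda>(x, y). x * y) \<in> M \<Otimes>\<^sub>M N \<rightarrow>\<^sub>M restrict_space borel {0<..}"
    using measurable_mult_halfline[of ew dens] by (simp add: M_def N_def)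
  have hmult: "(\<lambda>z. h (fst z * snd z)) \<in> borel_measurable (M \<Otimes>\<^sub>M N)"
    using measurable_product_comp[OF hm] by (simp add: case_prod_beta')
  have int: "integrable (M \<Otimes>\<^sub>M N) (\<lambda>(x, y). ?k x * h (x * y))"
  proof (rule Bochner_Integration.integrable_bound)
    show "integrable (M \<Otimes>\<^sub>M N) (\<lambda>z. a powr (\<beta> + 1 / \<alpha> - 1) * (case z of (x, y) \<Rightarrow> h (x * y)))"
      by (intro integrable_mult_right integrable_product E.integrable_square_integrable h)
    show "(\<lambda>(x, y). ?k x * h (x * y)) \<in> borel_measurable (M \<Otimes>\<^sub>M N)"
      unfolding case_prod_beta' using k' hmult by (rule borel_measurable_times)
    show "AE z in M \<Otimes>\<^sub>M N. norm (case z of (x, y) \<Rightarrow> ?k x * h (x * y)) \<le> norm (a powr (\<beta> + 1 / \<alpha> - 1) * (case z of (x, y) \<Rightarrow> h (x * y)))"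
    proof (rule AE_I2)
      fix z assume "z \<in> space (M \<Otimes>\<^sub>M N)"
      then obtain x y where z: "z = (x, y)" "x > 0" by (auto simp: space_pair_measure)
      have "\<bar>?k x\<bar> \<le> a powr (\<beta> + 1 / \<alpha> - 1)"
        using weight_ratio_bound[OF a z(2)] ew_nonneg by (simp add: abs_of_nonneg)
      from mult_right_mono[OF this abs_ge_zero[of "h (x * y)"]]
      show "norm (case z of (x, y) \<Rightarrow> ?k x * h (x * y)) \<le> norm (a powr (\<beta> + 1 / \<alpha> - 1) * (case z of (x, y) \<Rightarrow> h (x * y)))"
        unfolding z(1) prod.case real_norm_def abs_mult[of "?k x"] abs_mult[of "a powr (\<beta> + 1 / \<alpha> - 1)"] by simp
    qed
  qed
  have "(\<integral>u. h u \<partial>E a) = (\<integral>z. h (case z of (x, y) \<Rightarrow> x * y) \<partial>density (M \<Otimes>\<^sub>M N) (\<lambda>(x, y). ennreal (?k x)))"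
    unfolding distr_product_weighted[symmetric, OF less_le_trans[OF zero_less_one a]]
    using mult hm by (intro integral_distr) auto
  also have "(\<lambda>(x, y). ennreal (?k x)) = (\<lambda>z::real \<times> real. ennreal (?k (fst z)))" by auto
  also have "(\<integral>z. h (case z of (x, y) \<Rightarrow> x * y) \<partial>density (M \<Otimes>\<^sub>M N) (\<lambda>z. ennreal (?k (fst z))))
     = (\<integral>z. ?k (fst z) *\<^sub>R h (case z of (x, y) \<Rightarrow> x * y) \<partial>(M \<Otimes>\<^sub>M N))"
    using k' hmult ew_nonneg by (intro integral_density) (auto simp: case_prod_beta')
  also have "\<dots> = (\<integral>z. (case z of (x, y) \<Rightarrow> ?k x * h (x * y)) \<partial>(M \<Otimes>\<^sub>M N))"
    by (simp add: case_prod_beta')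
  also have "\<dots> = (\<integral>x. \<integral>y. ?k x * h (x * y) \<partial>N \<partial>M)"
    using integral_fst'[OF int] by simp
  also have "\<dots> = (\<integral>x. ?k x * Lam h x \<partial>M)"
    by (rule Bochner_Integration.integral_cong) (simp_all add: Lam_eq_integral(1)[OF hm])
  also have "\<dots> = (\<integral>x. 0 \<partial>M)"
  proof (rule integral_cong_AE)
    show "(\<lambda>x. ?k x * Lam h x) \<in> borel_measurable M"
      using k borel_measurable_Lam[OF hm] by (rule borel_measurable_times)
    show "AE x in M. ?k x * Lam h x = 0" using 0 by eventually_elim simp
  qed simp
  finally show ?thesis by simp
qed

lemma exp_square_integrable: "(\<lambda>u. exp (- (1 * u)) ^ k) \<in> square_integrable (E 1)"
proof -
  interpret E: prob_space "E 1" by (rule prob_space_E)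
  have "(\<lambda>_. 1) \<in> square_integrable (E 1)" by (simp add: square_integrable_def)
  then show ?thesis
  proof (rule square_integrable_bound)
    show "(\<lambda>u. exp (- (1 * u)) ^ k) \<in> borel_measurable (E 1)" by (rule borel_measurable_MNE_I) measurable
    show "AE u in E 1. \<bar>exp (- (1 * u)) ^ k\<bar> \<le> \<bar>1\<bar>"
      by (rule AE_I2) (simp add: power_le_one)
  qed
qed

text \<open>The functions orthogonal to \<open>h\<close> form a closed subspace. It contains the exponentials, so it contains
  \<open>h\<close> itself.\<close>

lemma Lam_injective:
  assumes h: "h \<in> square_integrable (E 1)" and 0: "AE x in M. Lam h x = 0"
  shows "AE x in E 1. h x = 0"
proof -
  interpret E: prob_space "E 1" by (rule prob_space_E)
  note hm = square_integrableD(1)[OF h, unfolded borel_measurable_MNE]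
  define A where "A = {f \<in> square_integrable (E 1). (\<integral>u. h u * f u \<partial>E 1) = 0}"
  interpret L2_subspace "E 1" A
  proof unfold_locales
    show "(\<lambda>_. 0) \<in> A" by (simp add: A_def square_integrable_def)
    show "(\<lambda>x. f x + g x) \<in> A" if "f \<in> A" "g \<in> A" for f g
      using that integrable_mult_square_integrable[OF h, of f] integrable_mult_square_integrable[OF h, of g]
      by (auto simp: A_def distrib_left intro: square_integrable_add)
    show "(\<lambda>x. c * f x) \<in> A" if "f \<in> A" for f c
    proof -
      have "(\<integral>u. h u * (c * f u) \<partial>E 1) = c * (\<integral>u. h u * f u \<partial>E 1)"
        by (subst integral_mult_right_zero[symmetric]) (simp add: mult_ac)
      then show ?thesis using that by (auto simp: A_def intro: square_integrable_cmult)
    qed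
  qed (auto simp: A_def sets_MNE)
  have exp_A: "(\<lambda>u. exp (- (1 * u)) ^ k) \<in> A" for k
  proof -
    have e: "(\<lambda>u. exp (- (a * u))) \<in> borel_measurable borel" for a :: real by measurable
    have m1: "h \<in> borel_measurable (weighted (\<lambda>u. exp (- (real (Suc k) * u))))"
      using hm by (simp add: measurable_weighted_iff)
    have m2: "(\<lambda>u. h u * exp (- (1 * u)) ^ k) \<in> borel_measurable (weighted (\<lambda>u. exp (- (1 * u))))"
      unfolding measurable_weighted_iff
    proof (rule borel_measurable_times[OF hm])
      show "(\<lambda>u::real. exp (- (1 * u)) ^ k) \<in> borel_measurable (restrict_space borel {0<..})"
        by (rule measurable_restrict_space1) measurable
    qed
    have "(\<integral>u. h u * exp (- (1 * u)) ^ k \<partial>E 1) = (LINT u:{0<..}|lborel. h u * exp (- (1 * u)) ^ k * exp (- (1 * u)))"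
      unfolding E_def by (rule integral_weighted(2)[OF e _ m2]) simp
    also have "\<dots> = (LINT u:{0<..}|lborel. h u * exp (- (real (Suc k) * u)))"
    proof -
      have "exp (- (1 * u)) ^ k * exp (- (1 * u)) = exp (- (real (Suc k) * u))" for u :: real
        by (simp add: algebra_simps flip: exp_of_nat_mult exp_add)
      then show ?thesis by (simp only: mult.assoc)
    qed
    also have "\<dots> = (\<integral>u. h u \<partial>E (real (Suc k)))"
      unfolding E_def by (rule integral_weighted(2)[OF e _ m1, symmetric]) simp
    also have "\<dots> = 0" by (rule Lam_eq_0_imp[OF h 0]) simp
    finally show ?thesis using exp_square_integrable by (simp add: A_def)
  qed
  have lim: "h \<in> L2_limits"
    by (rule all_limits[OF zero_less_one L2_limits_base[OF exp_A] h])
  have small: "norm2 (E 1) h \<le> \<epsilon>" if eps: "\<epsilon> > 0" for \<epsilon>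
  proof -
    obtain g where g: "g \<in> A" "norm2 (E 1) (\<lambda>x. h x - g x) < \<epsilon>" by (rule L2_limitsE[OF lim eps])
    have gs: "g \<in> square_integrable (E 1)" and g0: "(\<integral>u. h u * g u \<partial>E 1) = 0" using g by (auto simp: A_def)
    have "(norm2 (E 1) h)\<^sup>2 = (\<integral>u. h u * h u - h u * g u \<partial>E 1)"
      using integrable_mult_square_integrable[OF h h] integrable_mult_square_integrable[OF h gs] g0
      unfolding norm2_power2 by (simp add: power2_eq_square)
    also have "\<dots> = (\<integral>u. h u * (h u - g u) \<partial>E 1)" by (simp add: right_diff_distrib)
    also have "\<dots> \<le> norm2 (E 1) h * norm2 (E 1) (\<lambda>x. h x - g x)"
      using square_integrable_Cauchy_Schwarz[OF h square_integrable_diff[OF h gs]] by simp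
    also have "\<dots> \<le> norm2 (E 1) h * \<epsilon>" using g by (intro mult_left_mono) auto
    finally have le: "norm2 (E 1) h * norm2 (E 1) h \<le> norm2 (E 1) h * \<epsilon>" by (simp add: power2_eq_square)
    show ?thesis
    proof (cases "norm2 (E 1) h = 0")
      case False
      then have "norm2 (E 1) h > 0" using norm2_nonneg[of "E 1" h] by linarith
      then show ?thesis using le by simp
    qed (use eps in simp)
  qed
  have "norm2 (E 1) h \<le> 0"
  proof (rule field_le_epsilon)
    fix \<epsilon> :: real assume "0 < \<epsilon>"
    from small[OF this] show "norm2 (E 1) h \<le> 0 + \<epsilon>" by simp
  qed
  then have "norm2 (E 1) h = 0" using norm2_nonneg[of "E 1" h] by linarith
  then show ?thesis by (rule norm2_eq_0_AE[OF h])
qed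

end

section \<open>Moments of the hypergeometric kernel\<close>

lemma binomial_pochhammer_sums:
  assumes "\<bar>z\<bar> < (1::real)"
  shows "(\<lambda>k. pochhammer (\<alpha> + 1) k / fact k * z ^ k) sums (1 - z) powr (- \<alpha> - 1)"
proof -
  have "(\<lambda>n. ((- \<alpha> - 1) gchoose n) * (- z) ^ n) sums (1 + - z) powr (- \<alpha> - 1)"
    using assms by (intro gen_binomial_real) simp
  moreover have "((- \<alpha> - 1) gchoose n) * (- z) ^ n = pochhammer (\<alpha> + 1) n / fact n * z ^ n" for n
  proof -
    have "(- 1) ^ n * (- z) ^ n = z ^ n" by (simp flip: power_mult_distrib)
    then have "(- 1) ^ n * pochhammer (\<alpha> + 1) n / fact n * (- z) ^ n = pochhammer (\<alpha> + 1) n / fact n * z ^ n"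
      by (metis (no_types, lifting) mult.assoc mult.commute times_divide_eq_left)
    moreover have "- (- \<alpha> - 1) = \<alpha> + 1" by simp
    ultimately show ?thesis unfolding gbinomial_pochhammer by (simp only:)
  qed
  ultimately show ?thesis by simp
qed

lemma nn_integral_powr_01:
  assumes "(e::real) > -1"
  shows "(\<integral>\<^sup>+u. ennreal (u powr e) * indicator {0<..<1} u \<partial>lborel) = ennreal (1 / (e + 1))"
proof -
  have "((\<lambda>x. x powr e) has_integral (1 powr (e + 1) / (e + 1))) {0..1}"
    using assms by (intro has_integral_powr_from_0) auto
  then have "((\<lambda>x. x powr e) has_integral 1 / (e + 1)) {0<..<1}"
    by (simp add: has_integral_Icc_iff_Ioo)
  from nn_integral_has_integral_lebesgue[OF _ this]
  have "(\<integral>\<^sup>+u. ennreal (indicator {0<..<1} u * u powr e) \<partial>lborel) = ennreal (1 / (e + 1))"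
    by (simp add: nn_integral_completion)
  moreover have "ennreal (indicator {0<..<1} u * u powr e) = ennreal (u powr e) * indicator {0<..<1} u" for u :: real
    by (simp add: indicator_def)
  ultimately show ?thesis by simp
qed

text \<open>Integration by parts against the Beta integral.\<close>

lemma beta_difference_integral:
  fixes \<alpha> a x :: real
  assumes \<alpha>: "0 < \<alpha>" "\<alpha> < 1" and a: "\<alpha> < a" "a \<le> x"
  shows "((\<lambda>u. (u powr (a - 1) - u powr (x - 1)) * (1 - u) powr (- \<alpha> - 1)) has_integral
    Gamma (1 - \<alpha>) / \<alpha> * (Gamma x / Gamma (x - \<alpha>) - Gamma a / Gamma (a - \<alpha>))) {0..1}"
proof -
  \<comment> \<open>\<open>H\<close> vanishes at both ends, at \<open>1\<close> because \<open>\<alpha> < 1\<close>; its derivative is the integrand plus Beta integrands\<close>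
  define H where "H u = (u powr a - u powr x) * (1 - u) powr (- \<alpha>) / \<alpha>" for u :: real
  define f where "f u = (u powr (a - 1) - u powr (x - 1)) * (1 - u) powr (- \<alpha> - 1)" for u :: real
  define r where "r u = ((a - \<alpha>) * (u powr (a - 1) * (1 - u) powr ((1 - \<alpha>) - 1)) - (x - \<alpha>) * (u powr (x - 1) * (1 - u) powr ((1 - \<alpha>) - 1))) / \<alpha>" for u :: real
  have apos: "a > 0" "x > 0" using \<alpha> a by auto
  have der: "(H has_real_derivative f u + r u) (at u)" if u: "0 < u" "u < 1" for u
  proof -
    have d1: "((\<lambda>u. u powr p) has_real_derivative p * u powr (p - 1)) (at u)" for p
      by (rule has_real_derivative_powr[OF u(1)])
    have d2: "((\<lambda>u. (1 - u) powr (- \<alpha>)) has_real_derivative (- \<alpha> * (1 - u) powr (- \<alpha> - 1)) * (- 1)) (at u)"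
      by (rule DERIV_chain2[OF has_real_derivative_powr]) (use u in \<open>auto intro!: derivative_eq_intros\<close>)
    have p: "u powr p = u * u powr (p - 1)" for p using u powr_add[of u 1 "p - 1"] by simp
    have q: "(1 - u) powr (- \<alpha>) = (1 - u) * (1 - u) powr (- \<alpha> - 1)" using u powr_add[of "1 - u" 1 "- \<alpha> - 1"] by simp
    have q': "(1 - \<alpha>) - 1 = - \<alpha>" by simp
    have "(H has_real_derivative ((a * u powr (a - 1) - x * u powr (x - 1)) * (1 - u) powr (- \<alpha>) + ((- \<alpha> * (1 - u) powr (- \<alpha> - 1)) * (- 1)) * (u powr a - u powr x)) / \<alpha>) (at u)"
      unfolding H_def by (intro DERIV_cdivide DERIV_mult DERIV_diff d1 d2)
    moreover have "((a * u powr (a - 1) - x * u powr (x - 1)) * (1 - u) powr (- \<alpha>) + ((- \<alpha> * (1 - u) powr (- \<alpha> - 1)) * (- 1)) * (u powr a - u powr x)) / \<alpha> = f u + r u"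
    proof -
      define A X Q where "A = u powr (a - 1)" and "X = u powr (x - 1)" and "Q = (1 - u) powr (- \<alpha> - 1)"
      have "((a * A - x * X) * ((1 - u) * Q) + ((- \<alpha> * Q) * (- 1)) * (u * A - u * X)) / \<alpha>
        = (A - X) * Q + ((a - \<alpha>) * (A * ((1 - u) * Q)) - (x - \<alpha>) * (X * ((1 - u) * Q))) / \<alpha>"
        using \<alpha> by (simp add: field_simps)
      then show ?thesis unfolding f_def r_def q' q p[of a] p[of x] A_def X_def Q_def .
    qed
    ultimately show ?thesis by simp
  qed
  have cont: "continuous_on {0..1} H"
  proof -
    have "isCont H u" if "0 < u" "u < 1" for u using DERIV_isCont[OF der[OF that]] .
    moreover have "continuous (at_right 0) H"
    proof -
      have "((\<lambda>u. u powr p) \<longlongrightarrow> 0) (at_right 0)" if "p > 0" for p :: real using that by real_asymp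
      moreover have "((\<lambda>u. (1 - u) powr (- \<alpha>)) \<longlongrightarrow> 1) (at_right 0)" by real_asymp
      ultimately have "(H \<longlongrightarrow> (0 - 0) * 1 / \<alpha>) (at_right 0)"
        unfolding H_def using \<alpha> apos by (intro tendsto_intros) auto
      then show ?thesis by (simp add: continuous_within H_def)
    qed
    moreover have "continuous (at_left 1) H"
    proof -
      define D where "D u = u powr a - u powr x" for u :: real
      have "(D has_real_derivative a * 1 powr (a - 1) - x * 1 powr (x - 1)) (at 1)"
        unfolding D_def by (intro DERIV_diff has_real_derivative_powr) auto
      then have "((\<lambda>u. (D u - D 1) / (u - 1)) \<longlongrightarrow> a - x) (at_left 1)"
        by (simp add: has_field_derivative_iff filterlim_at_split)
      moreover have "((\<lambda>u. (1 - u) powr (1 - \<alpha>)) \<longlongrightarrow> 0) (at_left 1)" using \<alpha> by real_asymp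
      ultimately have "((\<lambda>u. - ((D u - D 1) / (u - 1) * (1 - u) powr (1 - \<alpha>)) / \<alpha>) \<longlongrightarrow> - ((a - x) * 0) / \<alpha>) (at_left 1)"
        using \<alpha> by (intro tendsto_intros) auto
      moreover have "\<forall>\<^sub>F u in at_left 1. - ((D u - D 1) / (u - 1) * (1 - u) powr (1 - \<alpha>)) / \<alpha> = H u"
        using eventually_at_left_real[of 0 "1::real", OF zero_less_one]
      proof eventually_elim
        case (elim u)
        have "(1 - u) powr (1 - \<alpha>) = (1 - u) * (1 - u) powr (- \<alpha>)"
          using elim powr_add[of "1 - u" 1 "- \<alpha>"] by simp
        moreover have "d / (u - 1) * ((1 - u) * q) = - (d * q)" for d q
        proof -
          have "1 - u = - (u - 1)" "u - 1 \<noteq> 0" using elim by auto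
          then show ?thesis by (simp only: mult_minus_left mult_minus_right) simp
        qed
        moreover have "D 1 = 0" by (simp add: D_def)
        ultimately have "- ((D u - D 1) / (u - 1) * (1 - u) powr (1 - \<alpha>)) / \<alpha> = D u * (1 - u) powr (- \<alpha>) / \<alpha>"
          by (simp only: diff_zero minus_minus)
        then show ?case unfolding H_def D_def .
      qed
      ultimately have "(H \<longlongrightarrow> 0) (at_left 1)" using tendsto_cong by force
      then show ?thesis by (simp add: continuous_within H_def)
    qed
    ultimately show ?thesis
      by (intro continuous_on_IccI) (auto simp: continuous_within isCont_def)
  qed
  have "((\<lambda>u. f u + r u) has_integral H 1 - H 0) {0..1}"
    using der by (intro fundamental_theorem_of_calculus_interior cont)
      (auto simp: has_real_derivative_iff_has_vector_derivative)
  then have 1: "((\<lambda>u. f u + r u) has_integral 0) {0..1}" by (simp add: H_def)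
  have Bet: "((\<lambda>u. u powr (p - 1) * (1 - u) powr ((1 - \<alpha>) - 1)) has_integral Beta p (1 - \<alpha>)) {0..1}" if "p > 0" for p
    using \<alpha> that by (intro has_integral_Beta_real) auto
  have 2: "(r has_integral ((a - \<alpha>) * Beta a (1 - \<alpha>) - (x - \<alpha>) * Beta x (1 - \<alpha>)) / \<alpha>) {0..1}"
    unfolding r_def by (intro has_integral_divide has_integral_diff has_integral_mult_right Bet apos)
  have Beta: "(p - \<alpha>) * Beta p (1 - \<alpha>) = Gamma (1 - \<alpha>) * (Gamma p / Gamma (p - \<alpha>))" if "p > \<alpha>" for p
  proof -
    have "Gamma (p - \<alpha> + 1) = (p - \<alpha>) * Gamma (p - \<alpha>)"
      using that by (intro Gamma_plus1) (auto simp: nonpos_Ints_def)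
    moreover have "p - \<alpha> + 1 = p + (1 - \<alpha>)" by simp
    ultimately have "Gamma (p + (1 - \<alpha>)) = (p - \<alpha>) * Gamma (p - \<alpha>)" by simp
    moreover have "Gamma (p - \<alpha>) > 0" using that by (intro Gamma_real_pos) simp
    ultimately show ?thesis using that unfolding Beta_def by (simp only:) simp
  qed
  have "((\<lambda>u. (f u + r u) - r u) has_integral 0 - ((a - \<alpha>) * Beta a (1 - \<alpha>) - (x - \<alpha>) * Beta x (1 - \<alpha>)) / \<alpha>) {0..1}"
    by (rule has_integral_diff[OF 1 2])
  moreover have "0 - ((a - \<alpha>) * Beta a (1 - \<alpha>) - (x - \<alpha>) * Beta x (1 - \<alpha>)) / \<alpha>
    = Gamma (1 - \<alpha>) / \<alpha> * (Gamma x / Gamma (x - \<alpha>) - Gamma a / Gamma (a - \<alpha>))"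
  proof -
    have "Gamma (1 - \<alpha>) / \<alpha> * (p - q) = 0 - (Gamma (1 - \<alpha>) * q - Gamma (1 - \<alpha>) * p) / \<alpha>" for p q
      using \<alpha> by (simp add: field_simps)
    moreover have "\<alpha> < x" using a by simp
    ultimately show ?thesis unfolding Beta[OF a(1)] Beta[OF \<open>\<alpha> < x\<close>] by simp
  qed
  ultimately show ?thesis by (simp add: f_def)
qed

text \<open>Expand \<open>(1 - u) powr (- \<alpha> - 1)\<close> and integrate term by term; all terms are nonnegative. Each of the two
  series alone diverges, only their difference converges.\<close>

lemma beta_difference_series:
  fixes \<alpha> a x :: real
  assumes \<alpha>: "0 < \<alpha>" "\<alpha> < 1" and a: "\<alpha> < a" "a \<le> x"
  shows "(\<Sum>k. ennreal (pochhammer (\<alpha> + 1) k / fact k * (1 / (a + real k) - 1 / (x + real k))))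
    = ennreal (Gamma (1 - \<alpha>) / \<alpha> * (Gamma x / Gamma (x - \<alpha>) - Gamma a / Gamma (a - \<alpha>)))"
proof -
  define w where "w k = pochhammer (\<alpha> + 1) k / fact k" for k
  have w: "w k \<ge> 0" for k using \<alpha> by (simp add: w_def pochhammer_nonneg)
  define f where "f u = (u powr (a - 1) - u powr (x - 1)) * (1 - u) powr (- \<alpha> - 1)" for u :: real
  have mono: "u powr (x - 1) \<le> u powr (a - 1)" if "u \<in> {0<..<1}" for u
    using that a by (intro powr_mono') auto
  have f0: "0 \<le> f u" if "u \<in> {0<..<1}" for u using mono[OF that] by (simp add: f_def)
  have "(f has_integral Gamma (1 - \<alpha>) / \<alpha> * (Gamma x / Gamma (x - \<alpha>) - Gamma a / Gamma (a - \<alpha>))) {0<..<1}"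
    using beta_difference_integral[OF assms] unfolding f_def has_integral_Icc_iff_Ioo .
  from nn_integral_has_integral_lebesgue[OF f0 this]
  have "ennreal (Gamma (1 - \<alpha>) / \<alpha> * (Gamma x / Gamma (x - \<alpha>) - Gamma a / Gamma (a - \<alpha>))) = (\<integral>\<^sup>+u. ennreal (indicator {0<..<1} u * f u) \<partial>lborel)"
    by (simp add: nn_integral_completion f_def)
  also have "\<dots> = (\<integral>\<^sup>+u. (\<Sum>k. ennreal (w k * (u powr (a + real k - 1) - u powr (x + real k - 1))) * indicator {0<..<1} u) \<partial>lborel)"
  proof (rule nn_integral_cong)
    fix u :: real
    show "ennreal (indicator {0<..<1} u * f u) = (\<Sum>k. ennreal (w k * (u powr (a + real k - 1) - u powr (x + real k - 1))) * indicator {0<..<1} u)"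
    proof (cases "u \<in> {0<..<1}")
      case True
      have p: "u powr (p + real k - 1) = u powr (p - 1) * u ^ k" for p k
      proof -
        have "u powr (p + real k - 1) = u powr ((p - 1) + real k)" by (simp add: algebra_simps)
        then show ?thesis using True by (simp only: powr_add) (simp add: powr_realpow)
      qed
      have "(\<lambda>k. (u powr (a - 1) - u powr (x - 1)) * (w k * u ^ k)) sums f u"
        unfolding f_def w_def using True by (intro sums_mult binomial_pochhammer_sums) auto
      then have s: "(\<lambda>k. w k * (u powr (a + real k - 1) - u powr (x + real k - 1))) sums f u"
        unfolding p by (simp add: algebra_simps)
      have "0 \<le> w k * (u powr (a + real k - 1) - u powr (x + real k - 1))" for k
        unfolding p left_diff_distrib[symmetric] using w mono[OF True] True by (intro mult_nonneg_nonneg) auto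
      from suminf_ennreal_eq[OF this s] show ?thesis using True by simp
    qed simp
  qed
  also have "\<dots> = (\<Sum>k. \<integral>\<^sup>+u. ennreal (w k * (u powr (a + real k - 1) - u powr (x + real k - 1))) * indicator {0<..<1} u \<partial>lborel)"
    by (rule nn_integral_suminf) measurable
  also have "\<dots> = (\<Sum>k. ennreal (w k * (1 / (a + real k) - 1 / (x + real k))))"
  proof (rule suminf_cong)
    fix k
    have hp: "((\<lambda>u. u powr (p + real k - 1)) has_integral 1 / (p + real k)) {0<..<1}" if "p > 0" for p
    proof -
      have "((\<lambda>u. u powr (p + real k - 1)) has_integral (1 powr ((p + real k - 1) + 1) / ((p + real k - 1) + 1))) {0..1}"
        using that by (intro has_integral_powr_from_0) auto
      then show ?thesis by (simp add: has_integral_Icc_iff_Ioo)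
    qed
    have hi: "((\<lambda>u. w k * (u powr (a + real k - 1) - u powr (x + real k - 1))) has_integral w k * (1 / (a + real k) - 1 / (x + real k))) {0<..<1}"
      using a \<alpha> by (intro has_integral_mult_right has_integral_diff hp) auto
    have nn0: "0 \<le> w k * (u powr (a + real k - 1) - u powr (x + real k - 1))" if "u \<in> {0<..<1}" for u
      using that w[of k] a by (intro mult_nonneg_nonneg) (auto intro!: powr_mono')
    have "(\<integral>\<^sup>+u. ennreal (indicator {0<..<1} u * (w k * (u powr (a + real k - 1) - u powr (x + real k - 1)))) \<partial>lborel)
      = ennreal (w k * (1 / (a + real k) - 1 / (x + real k)))"
      by (rule nn_integral_has_integral_lebesgue[OF nn0 hi])
    moreover have "ennreal (indicator {0<..<1} u * v) = ennreal v * indicator {0<..<1} u" for u v :: real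
      by (simp add: indicator_def)
    ultimately show "(\<integral>\<^sup>+u. ennreal (w k * (u powr (a + real k - 1) - u powr (x + real k - 1))) * indicator {0<..<1} u \<partial>lborel)
      = ennreal (w k * (1 / (a + real k) - 1 / (x + real k)))" by simp
  qed
  finally show ?thesis by (simp add: w_def)
qed

context gauss_laguerre
begin

text \<open>The weights of the shift to which the Gauss-Laguerre generator reduces on monomials.\<close>

definition "\<phi> n = Gamma (\<alpha> * real n + b) / Gamma (\<alpha> * real n + b - \<alpha>)"

lemma drift_eq: "gauss_laguerre_drift \<alpha> \<beta> = \<phi> 1"
  by (simp add: gauss_laguerre_drift_def \<phi>_def b_def add_ac)

text \<open>The first hypergeometric parameter is one less than the third, so the ratio of their Pochhammer symbols
  collapses to \<open>a / (a + k)\<close>.\<close>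

lemma kernel_series:
  assumes y: "0 < y" "y < 1"
  shows "(\<lambda>k. Gamma \<alpha> * \<alpha> * (pochhammer (\<alpha> + 1) k / fact k / (b + \<alpha> + real k)) * y powr (\<beta> + 1 / \<alpha> + 1 + real k / \<alpha>))
    sums gauss_laguerre_kernel \<alpha> \<beta> y"
proof -
  define a where "a = b + \<alpha>"
  have a: "a > 0" using b_pos \<alpha>_pos by (simp add: a_def)
  define z where "z = y powr (1 / \<alpha>)"
  have z: "0 < z" "z < 1" using y \<alpha>_pos powr_less_mono2[of "1 / \<alpha>" y 1] by (auto simp: z_def)
  have arg: "\<alpha> * (\<beta> + 1) + 1 = a" "\<alpha> * (\<beta> + 1) + 2 = a + 1" by (simp_all add: a_def b_def algebra_simps)
  have c: "\<beta> + 1 / \<alpha> + 1 = a / \<alpha>" using \<alpha>_pos by (simp add: a_def b_def field_simps)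
  define w where "w k = pochhammer (\<alpha> + 1) k / fact k" for k
  have w: "w k \<ge> 0" for k using \<alpha>_pos by (simp add: w_def pochhammer_nonneg)
  have coeff: "fps_nth (fps_hypergeo [a, \<alpha> + 1] [a + 1] 1) k = w k * (a / (a + real k))" for k
  proof -
    have "pochhammer a k * (a + real k) = a * pochhammer (a + 1) k"
      using pochhammer_rec[of a k] pochhammer_rec'[of a k] by (simp add: mult.commute)
    moreover have "pochhammer (a + 1) k > 0" using a by (intro pochhammer_pos) simp
    ultimately have "pochhammer a k / pochhammer (a + 1) k = a / (a + real k)"
      using a by (intro frac_eq_eq[THEN iffD2]) auto
    moreover have "fps_nth (fps_hypergeo [a, \<alpha> + 1] [a + 1] 1) k = w k * (pochhammer a k / pochhammer (a + 1) k)"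
      by (simp add: w_def mult.commute)
    ultimately show ?thesis by (simp only:)
  qed
  have "summable (\<lambda>k. w k * z ^ k)"
    using binomial_pochhammer_sums[of z \<alpha>] z by (simp add: w_def sums_iff)
  then have "summable (\<lambda>k. w k * (a / (a + real k)) * z ^ k)"
  proof (rule summable_comparison_test'[where N = 0])
    fix k
    have "a / (a + real k) \<le> 1" using a by simp
    then have le: "w k * (a / (a + real k)) \<le> w k" using w a by (intro mult_left_le) auto
    then show "norm (w k * (a / (a + real k)) * z ^ k) \<le> w k * z ^ k"
      using mult_right_mono[OF le, of "z ^ k"] w[of k] a z by (subst real_norm_def, subst abs_of_nonneg) auto
  qed
  then have "(\<lambda>k. w k * (a / (a + real k)) * z ^ k) sums hypergeometric_2F1 a (\<alpha> + 1) (a + 1) z"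
    unfolding hypergeometric_2F1_def eval_fps_def coeff by (rule summable_sums)
  then have "(\<lambda>k. Gamma \<alpha> / (a / \<alpha>) * y powr (a / \<alpha>) * (w k * (a / (a + real k)) * z ^ k)) sums gauss_laguerre_kernel \<alpha> \<beta> y"
    unfolding gauss_laguerre_kernel_def arg c z_def by (rule sums_mult)
  moreover have "Gamma \<alpha> / (a / \<alpha>) * y powr (a / \<alpha>) * (w k * (a / (a + real k)) * z ^ k)
    = Gamma \<alpha> * \<alpha> * (w k / (a + real k)) * y powr (a / \<alpha> + real k / \<alpha>)" for k
  proof -
    have "z ^ k = y powr (real k / \<alpha>)" using z y by (simp add: z_def powr_powr flip: powr_realpow)
    then have "y powr (a / \<alpha> + real k / \<alpha>) = y powr (a / \<alpha>) * z ^ k" by (simp add: powr_add)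
    then show ?thesis using a \<alpha>_pos by (simp add: field_simps)
  qed
  ultimately show ?thesis by (simp only: c w_def flip: a_def)
qed

text \<open>Termwise integration gives \<open>1 / ((a + k) * (x + k))\<close> with \<open>x - a = \<alpha> * (j + 1)\<close>; partial fractions lead to
  the Beta difference, and the reflection formula cancels the sine.\<close>

lemma kernel_moment:
  shows "set_integrable lborel {0<..<1} (\<lambda>y. y ^ j * gauss_laguerre_kernel \<alpha> \<beta> y)"
    and "sin (\<alpha> * pi) / pi * (LINT y:{0<..<1}|lborel. y ^ j * gauss_laguerre_kernel \<alpha> \<beta> y) * real (Suc j) = \<phi> (j + 2) - \<phi> 1"
proof -
  define a x where "a = b + \<alpha>" and "x = \<alpha> * real (j + 2) + b"
  define w where "w k = pochhammer (\<alpha> + 1) k / fact k" for k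
  have w: "w k \<ge> 0" for k using \<alpha>_pos by (simp add: w_def pochhammer_nonneg)
  have ax: "\<alpha> < a" "0 < a" "a \<le> x" "x - a = \<alpha> * real (Suc j)" "0 < x"
    using b_pos \<alpha>_pos by (auto simp: a_def x_def algebra_simps add_nonneg_pos)
  have G: "Gamma \<alpha> > 0" using \<alpha>_pos by (rule Gamma_real_pos)
  define K where "K = Gamma \<alpha> * \<alpha> / real (Suc j)"
  have K: "K \<ge> 0" using G \<alpha>_pos by (simp add: K_def)
  define V where "V = Gamma (1 - \<alpha>) / \<alpha> * (\<phi> (j + 2) - \<phi> 1)"
  have V: "V = Gamma (1 - \<alpha>) / \<alpha> * (Gamma x / Gamma (x - \<alpha>) - Gamma a / Gamma (a - \<alpha>))"
    by (simp add: V_def \<phi>_def x_def a_def add_ac)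
  define T where "T k y = Gamma \<alpha> * \<alpha> * (w k / (a + real k)) * y powr (\<beta> + 1 / \<alpha> + 1 + real k / \<alpha>)" for k y
  have T0: "0 \<le> T k y" for k y using w G \<alpha>_pos ax by (simp add: T_def)
  have ker: "(\<lambda>k. T k y) sums gauss_laguerre_kernel \<alpha> \<beta> y" if "y \<in> {0<..<1}" for y
    using kernel_series[of y] that by (simp add: T_def w_def a_def)
  have ker0: "0 \<le> gauss_laguerre_kernel \<alpha> \<beta> y" if "y \<in> {0<..<1}" for y
    by (rule sums_le[OF _ sums_zero ker[OF that]]) (rule T0)
  have pw: "ennreal (y ^ j * T k y) * indicator {0<..<1} y
     = ennreal (Gamma \<alpha> * \<alpha> * (w k / (a + real k))) * (ennreal (y powr (real j + (\<beta> + 1 / \<alpha> + 1 + real k / \<alpha>))) * indicator {0<..<1} y)" for k y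
  proof (cases "y \<in> {0<..<1}")
    case True
    define C where "C = Gamma \<alpha> * \<alpha> * (w k / (a + real k))"
    have "0 \<le> C" using w G \<alpha>_pos ax by (simp add: C_def)
    moreover have "y ^ j * T k y = C * y powr (real j + (\<beta> + 1 / \<alpha> + 1 + real k / \<alpha>))"
      unfolding T_def C_def[symmetric] powr_add[of y "real j"] using True by (simp add: powr_realpow)
    ultimately show ?thesis using True unfolding C_def[symmetric] by (simp add: ennreal_mult)
  qed simp
  have term_int: "(\<integral>\<^sup>+y. ennreal (y ^ j * T k y) * indicator {0<..<1} y \<partial>lborel) = ennreal K * ennreal (w k * (1 / (a + real k) - 1 / (x + real k)))" for k
  proof -
    have c: "\<beta> + 1 / \<alpha> + 1 = a / \<alpha>" using \<alpha>_pos by (simp add: a_def b_def field_simps)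
    have e1: "real j + (\<beta> + 1 / \<alpha> + 1 + real k / \<alpha>) + 1 = (x + real k) / \<alpha>"
    proof -
      have "x + real k = \<alpha> * (real j + 1) + (a + real k)" by (simp add: x_def a_def algebra_simps)
      then show ?thesis unfolding c using \<alpha>_pos by (simp add: add_divide_distrib)
    qed
    have xk: "(x + real k) / \<alpha> > 0" using ax \<alpha>_pos by simp
    then have e2: "real j + (\<beta> + 1 / \<alpha> + 1 + real k / \<alpha>) > -1" using e1 by linarith
    have "(\<integral>\<^sup>+y. ennreal (y ^ j * T k y) * indicator {0<..<1} y \<partial>lborel)
       = ennreal (Gamma \<alpha> * \<alpha> * (w k / (a + real k))) * ennreal (1 / ((x + real k) / \<alpha>))"
      unfolding pw by (subst nn_integral_cmult) (simp_all add: nn_integral_powr_01[OF e2] e1)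
    also have "\<dots> = ennreal (Gamma \<alpha> * \<alpha> * (w k / (a + real k)) * (1 / ((x + real k) / \<alpha>)))"
      using w[of k] G \<alpha>_pos ax by (intro ennreal_mult[symmetric]) auto
    also have "Gamma \<alpha> * \<alpha> * (w k / (a + real k)) * (1 / ((x + real k) / \<alpha>)) = K * (w k * (1 / (a + real k) - 1 / (x + real k)))"
    proof -
      have "1 / (a + real k) - 1 / (x + real k) = (x - a) / ((a + real k) * (x + real k))"
        using ax by (simp add: field_simps)
      then show ?thesis unfolding K_def ax(4) by simp
    qed
    also have "ennreal (K * (w k * (1 / (a + real k) - 1 / (x + real k)))) = ennreal K * ennreal (w k * (1 / (a + real k) - 1 / (x + real k)))"
      using K by (rule ennreal_mult')
    finally show ?thesis .
  qed
  have "(\<integral>\<^sup>+y. ennreal (y ^ j * gauss_laguerre_kernel \<alpha> \<beta> y) * indicator {0<..<1} y \<partial>lborel)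
    = (\<integral>\<^sup>+y. (\<Sum>k. ennreal (y ^ j * T k y) * indicator {0<..<1} y) \<partial>lborel)"
  proof (rule nn_integral_cong)
    fix y :: real
    show "ennreal (y ^ j * gauss_laguerre_kernel \<alpha> \<beta> y) * indicator {0<..<1} y = (\<Sum>k. ennreal (y ^ j * T k y) * indicator {0<..<1} y)"
    proof (cases "y \<in> {0<..<1}")
      case True
      then have "0 \<le> y ^ j * T k y" for k using T0 by simp
      from suminf_ennreal_eq[OF this sums_mult[OF ker[OF True]]] show ?thesis using True by simp
    qed simp
  qed
  also have "\<dots> = (\<Sum>k. \<integral>\<^sup>+y. ennreal (y ^ j * T k y) * indicator {0<..<1} y \<partial>lborel)"
    unfolding T_def by (rule nn_integral_suminf) measurable
  also have "\<dots> = ennreal K * (\<Sum>k. ennreal (w k * (1 / (a + real k) - 1 / (x + real k))))"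
    unfolding term_int by (rule ennreal_suminf_cmult)
  also have "\<dots> = ennreal K * ennreal V"
    using beta_difference_series[OF \<alpha>_pos \<alpha>_less_1 ax(1,3)] by (simp add: w_def V)
  also have "\<dots> = ennreal (K * V)" using K by (rule ennreal_mult'[symmetric])
  finally have nn: "(\<integral>\<^sup>+y. ennreal (y ^ j * gauss_laguerre_kernel \<alpha> \<beta> y) * indicator {0<..<1} y \<partial>lborel) = ennreal (K * V)" .
  define h where "h y = indicator {0<..<1} y *\<^sub>R (y ^ j * gauss_laguerre_kernel \<alpha> \<beta> y)" for y
  have h0: "0 \<le> h y" for y using ker0[of y] by (simp add: h_def indicator_def)
  have hm: "h \<in> borel_measurable lborel"
  proof -
    have "h y = (\<Sum>k. indicator {0<..<1} y *\<^sub>R (y ^ j * T k y))" for y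
    proof (cases "y \<in> {0<..<1}")
      case True
      then show ?thesis using sums_unique[OF sums_mult[OF ker[OF True], of "y ^ j"]] by (simp add: h_def)
    qed (simp add: h_def)
    then have "h = (\<lambda>y. \<Sum>k. indicator {0<..<1} y *\<^sub>R (y ^ j * T k y))" by (rule ext)
    moreover have "(\<lambda>y. \<Sum>k. indicator {0<..<1} y *\<^sub>R (y ^ j * T k y)) \<in> borel_measurable lborel"
      unfolding T_def by measurable
    ultimately show ?thesis by simp
  qed
  have hn: "(\<integral>\<^sup>+y. ennreal (h y) \<partial>lborel) = ennreal (K * V)"
  proof -
    have "ennreal (h y) = ennreal (y ^ j * gauss_laguerre_kernel \<alpha> \<beta> y) * indicator {0<..<1} y" for y
      by (simp add: h_def indicator_def)
    then show ?thesis using nn by simp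
  qed
  have hint: "integrable lborel h"
    using hm h0 hn by (intro integrableI_bounded) (auto simp: abs_of_nonneg)
  then show "set_integrable lborel {0<..<1} (\<lambda>y. y ^ j * gauss_laguerre_kernel \<alpha> \<beta> y)"
    by (simp add: set_integrable_def h_def[abs_def])
  have V0: "V \<ge> 0"
  proof -
    have "0 \<le> (\<lambda>u. (u powr (a - 1) - u powr (x - 1)) * (1 - u) powr (- \<alpha> - 1)) u" if "u \<in> {0..1}" for u
      using that ax by (cases "u = 0") (auto intro!: mult_nonneg_nonneg powr_mono')
    from has_integral_nonneg[OF beta_difference_integral[OF \<alpha>_pos \<alpha>_less_1 ax(1,3)] this] show ?thesis by (simp add: V)
  qed
  have "(LINT y:{0<..<1}|lborel. y ^ j * gauss_laguerre_kernel \<alpha> \<beta> y) = K * V"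
  proof -
    have "ennreal (\<integral>y. h y \<partial>lborel) = ennreal (K * V)"
      using nn_integral_eq_integral[OF hint] h0 hn by simp
    then have "(\<integral>y. h y \<partial>lborel) = K * V" using K V0 h0 by (simp add: integral_nonneg_AE)
    then show ?thesis by (simp add: set_lebesgue_integral_def h_def)
  qed
  moreover have "sin (\<alpha> * pi) / pi * (Gamma \<alpha> * Gamma (1 - \<alpha>)) = 1"
  proof -
    have "complex_of_real (Gamma \<alpha> * Gamma (1 - \<alpha>)) = Gamma (of_real \<alpha>) * Gamma (of_real (1 - \<alpha>))"
      by (simp only: of_real_mult Gamma_complex_of_real)
    also have "\<dots> = of_real pi / sin (of_real pi * complex_of_real \<alpha>)"
      using Gamma_reflection_complex[of "of_real \<alpha>"] by (simp only: of_real_diff of_real_1)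
    also have "\<dots> = of_real (pi / sin (pi * \<alpha>))"
      by (simp only: sin_of_real of_real_divide flip: of_real_mult)
    finally have "complex_of_real (Gamma \<alpha> * Gamma (1 - \<alpha>)) = of_real (pi / sin (pi * \<alpha>))" .
    then have "Gamma \<alpha> * Gamma (1 - \<alpha>) = pi / sin (pi * \<alpha>)" by (simp only: of_real_eq_iff)
    moreover have "sin (pi * \<alpha>) > 0" using \<alpha>_pos \<alpha>_less_1 by (intro sin_gt_zero) auto
    ultimately show ?thesis by (simp add: mult.commute)
  qed
  ultimately show "sin (\<alpha> * pi) / pi * (LINT y:{0<..<1}|lborel. y ^ j * gauss_laguerre_kernel \<alpha> \<beta> y) * real (Suc j) = \<phi> (j + 2) - \<phi> 1"
  proof -
    assume I: "(LINT y:{0<..<1}|lborel. y ^ j * gauss_laguerre_kernel \<alpha> \<beta> y) = K * V"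
      and refl: "sin (\<alpha> * pi) / pi * (Gamma \<alpha> * Gamma (1 - \<alpha>)) = 1"
    have KV: "K * V * real (Suc j) = (Gamma \<alpha> * Gamma (1 - \<alpha>)) * (\<phi> (j + 2) - \<phi> 1)"
      using \<alpha>_pos by (simp add: K_def V_def)
    have "sin (\<alpha> * pi) / pi * (K * V) * real (Suc j) = sin (\<alpha> * pi) / pi * (K * V * real (Suc j))"
      by (rule mult.assoc)
    also have "\<dots> = (sin (\<alpha> * pi) / pi * (Gamma \<alpha> * Gamma (1 - \<alpha>))) * (\<phi> (j + 2) - \<phi> 1)"
      unfolding KV by (rule mult.assoc[symmetric])
    finally have "sin (\<alpha> * pi) / pi * (K * V) * real (Suc j) = (sin (\<alpha> * pi) / pi * (Gamma \<alpha> * Gamma (1 - \<alpha>))) * (\<phi> (j + 2) - \<phi> 1)" .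
    then show ?thesis unfolding I refl by simp
  qed
qed

end

section \<open>The generators on polynomials and the dense range\<close>

lemma deriv_poly: "deriv (poly p) = poly (pderiv p)" for p :: "real poly"
  by (rule ext) (rule DERIV_imp_deriv[OF poly_DERIV])

definition laguerre_poly_operator :: "real poly \<Rightarrow> real poly" where
  "laguerre_poly_operator p = pCons 0 (pderiv (pderiv p)) + pderiv p - pCons 0 (pderiv p)"

lemma laguerre_operator_poly: "laguerre_operator (poly p) = poly (laguerre_poly_operator p)"
  by (rule ext) (simp add: laguerre_operator_def deriv_poly laguerre_poly_operator_def algebra_simps)

lemma coeff_laguerre_poly_operator:
  "coeff (laguerre_poly_operator p) k = (real k + 1)\<^sup>2 * coeff p (Suc k) - real k * coeff p k"
proof (cases k)
  case (Suc j)
  then show ?thesis by (simp add: laguerre_poly_operator_def coeff_pderiv power2_eq_square algebra_simps)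
qed (simp add: laguerre_poly_operator_def coeff_pderiv)

definition laguerre_poly :: "nat \<Rightarrow> real poly" where
  "laguerre_poly n = (\<Sum>k\<le>n. monom ((- 1) ^ k * real (n choose k) / fact k) k)"

lemma coeff_laguerre_poly: "coeff (laguerre_poly n) k = (- 1) ^ k * real (n choose k) / fact k"
  by (simp add: laguerre_poly_def coeff_sum binomial_eq_0)

lemma laguerre_poly_eigen: "laguerre_poly_operator (laguerre_poly n) = smult (- real n) (laguerre_poly n)"
proof (rule poly_eqI)
  fix k
  have "(real k + 1) * real (n choose Suc k) = (real n - real k) * real (n choose k)"
  proof (cases "k \<le> n")
    case True
    have "Suc k * (n choose Suc k) = (n - k) * (n choose k)"
      by (simp only: binomial_absorption binomial_absorb_comp)
    then have "real (Suc k * (n choose Suc k)) = real ((n - k) * (n choose k))" by (rule arg_cong)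
    then show ?thesis using True by (simp add: of_nat_diff add.commute distrib_right)
  qed (simp add: binomial_eq_0)
  then have "(real k + 1)\<^sup>2 * ((- 1) ^ Suc k * real (n choose Suc k) / fact (Suc k)) = - ((real n - real k) * ((- 1) ^ k * real (n choose k) / fact k))"
    by (simp add: power2_eq_square divide_simps)
  moreover have "u - c * d = - a * d" if "u = - ((a - c) * d)" for a c d u :: real
    unfolding that by (simp add: algebra_simps)
  ultimately show "coeff (laguerre_poly_operator (laguerre_poly n)) k = coeff (smult (- real n) (laguerre_poly n)) k"
    unfolding coeff_laguerre_poly_operator coeff_laguerre_poly coeff_smult by blast
qed

text \<open>Every polynomial is a linear combination of Laguerre polynomials, since there is one of each degree.\<close>

lemma poly_laguerre_induct:
  assumes smult: "\<And>c p. P p \<Longrightarrow> P (smult c p)" and add: "\<And>p q. P p \<Longrightarrow> P q \<Longrightarrow> P (p + q)"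
    and lag: "\<And>n. P (laguerre_poly n)"
  shows "P (p :: real poly)"
proof -
  have "\<forall>p. degree p < n \<or> p = 0 \<longrightarrow> P p" for n
  proof (induction n)
    case 0
    have "P (smult 0 (laguerre_poly 0))" by (intro smult lag)
    then show ?case by simp
  next
    case (Suc n)
    show ?case
    proof (intro allI impI)
      fix p :: "real poly" assume "degree p < Suc n \<or> p = 0"
      then have deg: "degree p \<le> n" by auto
      define c where "c = coeff p n / coeff (laguerre_poly n) n"
      have nz: "coeff (laguerre_poly n) n \<noteq> 0" by (simp add: coeff_laguerre_poly)
      define q where "q = p - smult c (laguerre_poly n)"
      have "coeff q k = 0" if "k \<ge> n" for k
      proof (cases "k = n")
        case True
        then show ?thesis using nz by (simp add: q_def c_def)
      next
        case False
        then have "coeff p k = 0" using that deg by (intro coeff_eq_0) simp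
        then show ?thesis using False that by (simp add: q_def coeff_laguerre_poly binomial_eq_0)
      qed
      then have "degree q < n \<or> q = 0"
        by (metis leading_coeff_0_iff linorder_not_less)
      then have "P q" using Suc by blast
      then have "P (q + smult c (laguerre_poly n))" by (intro add smult lag)
      then show "P p" by (simp add: q_def)
    qed
  qed
  from spec[OF this, of p "Suc (degree p)"] show ?thesis by simp
qed

context gauss_laguerre
begin

definition "moment n = fact n * Gamma b / Gamma (\<alpha> * real n + b)"

lemma Gamma_arg_pos: "\<alpha> * real n + b > 0"
  using b_pos \<alpha>_pos by (simp add: add_nonneg_pos)

lemma moment_pos: "moment n > 0"
  unfolding moment_def using Gamma_b_pos Gamma_real_pos[OF Gamma_arg_pos] by simp

lemma power_integrable_N: "integrable N (\<lambda>y. y ^ n)" "(\<integral>y. y ^ n \<partial>N) = moment n"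
proof -
  have meas: "(\<lambda>y. y ^ n) \<in> borel_measurable N" by (rule borel_measurable_MNE_I) measurable
  have nn: "AE y in N. 0 \<le> y ^ n" by (rule AE_I2) simp
  have "(\<integral>\<^sup>+y. ennreal (y ^ n) \<partial>N) = ennreal (moment n)" using N_moment[of n] by (simp add: moment_def)
  from nn_integral_eq_integrable[OF meas nn less_imp_le[OF moment_pos]] this
  show "integrable N (\<lambda>y. y ^ n)" "(\<integral>y. y ^ n \<partial>N) = moment n" by auto
qed

lemma set_integrable_power_dens:
  "set_integrable lborel {0<..} (\<lambda>y. y ^ n * dens y)"
  "(LINT y:{0<..}|lborel. y ^ n * dens y) = moment n"
proof -
  have meas: "(\<lambda>y. y ^ n) \<in> borel_measurable (weighted dens)" by (rule borel_measurable_weightedI) measurable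
  note I = integral_weighted[OF borel_measurable_lambda lambda_nonneg meas]
  show "set_integrable lborel {0<..} (\<lambda>y. y ^ n * dens y)"
    using I(1) power_integrable_N(1)[of n] by (simp add: N_def)
  show "(LINT y:{0<..}|lborel. y ^ n * dens y) = moment n"
    using I(2) power_integrable_N(2)[of n] by (simp add: N_def)
qed

text \<open>The action of the operator on coefficients.\<close>

definition moment_poly :: "real poly \<Rightarrow> real poly" where
  "moment_poly p = (\<Sum>k\<le>degree p. monom (coeff p k * moment k) k)"

lemma coeff_moment_poly: "coeff (moment_poly p) k = coeff p k * moment k"
  by (simp add: moment_poly_def coeff_sum coeff_eq_0)

lemma moment_poly_surj: "\<exists>p. moment_poly p = q"
proof
  define p where "p = (\<Sum>k\<le>degree q. monom (coeff q k / moment k) k)"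
  show "moment_poly p = q"
  proof (rule poly_eqI)
    fix k
    show "coeff (moment_poly p) k = coeff q k"
      using moment_pos[of k] by (simp add: coeff_moment_poly p_def coeff_sum coeff_eq_0)
  qed
qed

lemma moment_poly_smult: "moment_poly (smult c p) = smult c (moment_poly p)"
  by (rule poly_eqI) (simp add: coeff_moment_poly)

lemma poly_eq_sum: "degree p \<le> n \<Longrightarrow> poly p x = (\<Sum>k\<le>n. coeff p k * x ^ k)" for p :: "real poly"
  unfolding poly_altdef by (rule sum.mono_neutral_left) (auto simp: coeff_eq_0)

lemma poly_times_expand: "poly p (x * y) * d = (\<Sum>k\<le>degree p. (coeff p k * x ^ k) * (y ^ k * d))"
  for p :: "real poly"
  unfolding poly_altdef sum_distrib_right power_mult_distrib by (simp only: mult_ac)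

lemma Lam_poly: "Lam (poly p) = poly (moment_poly p)"
proof
  fix x
  have "Lam (poly p) x = (LINT y:{0<..}|lborel. (\<Sum>k\<le>degree p. (coeff p k * x ^ k) * (y ^ k * dens y)))"
    unfolding gauss_laguerre_Lambda_def mult_operator_def poly_times_expand ..
  also have "\<dots> = (\<Sum>k\<le>degree p. LINT y:{0<..}|lborel. (coeff p k * x ^ k) * (y ^ k * dens y))"
    using set_integrable_mult_right[OF set_integrable_power_dens(1)]
    unfolding set_lebesgue_integral_def set_integrable_def scaleR_sum_right
    by (intro Bochner_Integration.integral_sum) auto
  also have "\<dots> = (\<Sum>k\<le>degree p. coeff (moment_poly p) k * x ^ k)"
    unfolding set_integral_mult_right set_integrable_power_dens(2) coeff_moment_poly by (simp only: mult_ac)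
  also have "\<dots> = poly (moment_poly p) x"
    by (rule poly_eq_sum[symmetric]) (auto intro!: degree_le simp: coeff_moment_poly coeff_eq_0)
  finally show "Lam (poly p) x = poly (moment_poly p) x" .
qed

lemma poly_square_integrable:
  assumes meas: "\<And>f :: real \<Rightarrow> real. f \<in> borel_measurable borel \<Longrightarrow> f \<in> borel_measurable K"
    and fin: "\<And>n. (\<integral>\<^sup>+x. ennreal (x ^ n) \<partial>K) < \<infinity>"
  shows "poly p \<in> square_integrable K"
proof -
  have pow: "(\<lambda>x. c * x ^ n) \<in> square_integrable K" for c n
  proof (rule square_integrable_cmult)
    have "(\<integral>\<^sup>+x. ennreal (norm ((x ^ n)\<^sup>2)) \<partial>K) = (\<integral>\<^sup>+x. ennreal (x ^ (n * 2)) \<partial>K)"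
      by (simp add: power_mult)
    then have "integrable K (\<lambda>x. (x ^ n)\<^sup>2)" using fin[of "n * 2"] by (intro integrableI_bounded meas) auto
    then show "(\<lambda>x. x ^ n) \<in> square_integrable K" by (simp add: square_integrable_def meas)
  qed
  have "(\<lambda>x. \<Sum>k\<le>n. coeff p k * x ^ k) \<in> square_integrable K" for n
  proof (induction n)
    case 0
    show ?case using pow[of "coeff p 0" 0] by simp
  next
    case (Suc n)
    show ?case using square_integrable_add[OF Suc pow[of "coeff p (Suc n)" "Suc n"]] by (simp only: sum.atMost_Suc)
  qed
  from this[of "degree p"] show ?thesis by (simp add: poly_altdef[abs_def])
qed

lemma poly_square_integrable_M: "poly p \<in> square_integrable M"
  by (intro poly_square_integrable borel_measurable_MNE_I) (simp_all add: M_moment)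

lemma poly_square_integrable_E: "poly p \<in> square_integrable (E 1)"
  by (intro poly_square_integrable borel_measurable_MNE_I) (simp_all add: E_moment)

lemma L2_subspace_polynomials:
  shows "L2_subspace M (range poly)" "L2_subspace (E 1) (range poly)"
proof -
  interpret M: prob_space M by (rule prob_space_M)
  interpret E: prob_space "E 1" by (rule prob_space_E)
  have add: "(\<lambda>x. f x + g x) \<in> range poly" if fg: "f \<in> range poly" "g \<in> range poly" for f g :: "real \<Rightarrow> real"
  proof -
    obtain p q where "f = poly p" "g = poly q" using fg by blast
    then have "(\<lambda>x. f x + g x) = poly (p + q)" by auto
    then show ?thesis by simp
  qed
  have cmult: "(\<lambda>x. c * f x) \<in> range poly" if f: "f \<in> range poly" for f :: "real \<Rightarrow> real" and c
  proof -
    obtain p where "f = poly p" using f by blast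
    then have "(\<lambda>x. c * f x) = poly (smult c p)" by auto
    then show ?thesis by simp
  qed
  have zero: "(\<lambda>_::real. 0::real) \<in> range poly" by (rule image_eqI[of _ _ 0]) auto
  show "L2_subspace M (range poly)"
    by unfold_locales (use add cmult zero poly_square_integrable_M in \<open>auto simp: sets_MNE\<close>)
  show "L2_subspace (E 1) (range poly)"
    by unfold_locales (use add cmult zero poly_square_integrable_E in \<open>auto simp: sets_MNE\<close>)
qed

lemma nn_integral_exp_E: "(\<integral>\<^sup>+u. ennreal (exp (1 / 2 * u)) \<partial>E 1) < \<infinity>"
proof -
  have "(\<integral>\<^sup>+u. ennreal (exp (1 / 2 * u)) \<partial>E 1) = (\<integral>\<^sup>+u. ennreal (exp (- (1 * u))) * (ennreal (exp (1 / 2 * u)) * indicator {0<..} u) \<partial>lborel)"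
    unfolding E_def by (intro nn_integral_weighted borel_measurable_weightedI) auto
  also have "\<dots> = (\<integral>\<^sup>+u. ennreal (norm (indicator {0<..} u *\<^sub>R (exp (- (1 / 2 * u)) * u powr (1 - 1)))) \<partial>(lborel :: real measure))"
    by (intro nn_integral_cong) (auto simp: indicator_def simp flip: ennreal_mult exp_add)
  also have "\<dots> < \<infinity>"
    using Gamma_laplace_integral(2)[of 1 "1 / 2"] unfolding set_integrable_def integrable_iff_bounded by simp
  finally show ?thesis .
qed

text \<open>An exponential moment of the invariant law, from the factorisation of the exponential law.\<close>

lemma exp_moment_M: "\<exists>c>0. integrable M (\<lambda>x. exp (c * x))"
proof -
  interpret M: prob_space M by (rule prob_space_M)
  interpret N: prob_space N by (rule prob_space_N)
  interpret pair_sigma_finite M N ..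
  have m: "(\<lambda>u. ennreal (exp (1 / 2 * u))) \<in> borel_measurable (restrict_space borel {0<..} :: real measure)"
    by (rule measurable_restrict_space1) measurable
  note m2 = measurable_product_comp[OF m]
  have "(\<integral>\<^sup>+y. (\<integral>\<^sup>+x. ennreal (exp (1 / 2 * (x * y))) \<partial>M) \<partial>N) = (\<integral>\<^sup>+x. (\<integral>\<^sup>+y. ennreal (exp (1 / 2 * (x * y))) \<partial>N) \<partial>M)"
    using Fubini'[OF m2] by simp
  also have "\<dots> < \<infinity>" using nn_integral_product[OF m] nn_integral_exp_E by simp
  finally have fin: "(\<integral>\<^sup>+y. (\<integral>\<^sup>+x. ennreal (exp (1 / 2 * (x * y))) \<partial>M) \<partial>N) \<noteq> \<infinity>" by simp
  have "(\<lambda>y. \<integral>\<^sup>+x. ennreal (exp (1 / 2 * (x * y))) \<partial>M) \<in> borel_measurable N"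
    using M.borel_measurable_nn_integral[of "\<lambda>y x. ennreal (exp (1 / 2 * (x * y)))" N] measurable_pair_swap[OF m2]
    by (simp add: case_prod_beta')
  from nn_integral_PInf_AE[OF this fin]
  have ae: "AE y in N. (\<integral>\<^sup>+x. ennreal (exp (1 / 2 * (x * y))) \<partial>M) \<noteq> \<infinity>" .
  \<comment> \<open>the law \<open>N\<close> does not charge \<open>0\<close>, so some section at a positive \<open>y\<close> is finite\<close>
  have "\<exists>y>0. (\<integral>\<^sup>+x. ennreal (exp (1 / 2 * (x * y))) \<partial>M) \<noteq> \<infinity>"
  proof (rule ccontr)
    assume "\<not> ?thesis"
    then have top: "(\<integral>\<^sup>+x. ennreal (exp (1 / 2 * (x * y))) \<partial>M) = \<infinity>" if "y > 0" for y using that by blast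
    have "AE y in N. y > 0" by (rule AE_I2) simp
    with ae have "AE y in N. False"
    proof eventually_elim
      case (elim y)
      from elim(1) top[OF elim(2)] show False by (rule notE)
    qed
    then show False by simp
  qed
  then obtain y where y: "y > 0" "(\<integral>\<^sup>+x. ennreal (exp (1 / 2 * (x * y))) \<partial>M) \<noteq> \<infinity>" by blast
  have "integrable M (\<lambda>x. exp (y / 2 * x))"
  proof (rule integrableI_bounded)
    show "(\<lambda>x. exp (y / 2 * x)) \<in> borel_measurable M" by (rule borel_measurable_MNE_I) measurable
    show "(\<integral>\<^sup>+x. ennreal (norm (exp (y / 2 * x))) \<partial>M) < \<infinity>" using y(2) by (simp add: mult.commute less_top)
  qed
  then show ?thesis using y by (intro exI[of _ "y / 2"]) simp
qed

lemma polynomials_dense_M: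
  assumes f: "f \<in> square_integrable M" and \<epsilon>: "\<epsilon> > 0"
  obtains p where "norm2 M (\<lambda>x. f x - poly p x) < \<epsilon>"
proof -
  interpret L2_subspace M "range poly" by (rule L2_subspace_polynomials)
  obtain c where "c > 0" "integrable M (\<lambda>x. exp (c * x))" using exp_moment_M by blast
  from polynomials_dense[OF this _ f] have "f \<in> L2_limits" by simp
  then show ?thesis using \<epsilon> that by (auto elim: L2_limitsE)
qed

lemma polynomials_dense_E:
  assumes f: "f \<in> square_integrable (E 1)" and \<epsilon>: "\<epsilon> > 0"
  obtains p where "norm2 (E 1) (\<lambda>x. f x - poly p x) < \<epsilon>"
proof -
  interpret L2_subspace "E 1" "range poly" by (rule L2_subspace_polynomials)
  have "integrable (E 1) (\<lambda>x. exp (1 / 2 * x))"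
    using nn_integral_exp_E by (intro integrableI_bounded) (auto intro: borel_measurable_MNE_I)
  from polynomials_dense[OF _ this _ f] have "f \<in> L2_limits" by simp
  then show ?thesis using \<epsilon> that by (auto elim: L2_limitsE)
qed

text \<open>On monomials the two generators are weighted shifts, and the weights of the second one are the
  moment ratios of the density.\<close>

lemma moment_Suc: "moment (Suc k) * \<phi> (Suc k) = (real k + 1) * moment k"
proof -
  have "Gamma (\<alpha> * real k + b) > 0" "Gamma (\<alpha> * real (Suc k) + b) > 0" by (rule Gamma_real_pos[OF Gamma_arg_pos])+
  moreover have "\<alpha> * real (Suc k) + b - \<alpha> = \<alpha> * real k + b" by (simp add: algebra_simps)
  ultimately have "moment (Suc k) * \<phi> (Suc k) = fact (Suc k) * Gamma b / Gamma (\<alpha> * real k + b)"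
    unfolding moment_def \<phi>_def by (simp only:) simp
  then show ?thesis by (simp add: moment_def add.commute)
qed

lemma kernel_poly_integral:
  "(LINT y:{0<..<1}|lborel. poly q (x * y) * gauss_laguerre_kernel \<alpha> \<beta> y)
    = (\<Sum>k\<le>degree q. coeff q k * x ^ k * (LINT y:{0<..<1}|lborel. y ^ k * gauss_laguerre_kernel \<alpha> \<beta> y))"
proof -
  have "(LINT y:{0<..<1}|lborel. poly q (x * y) * gauss_laguerre_kernel \<alpha> \<beta> y)
    = (LINT y:{0<..<1}|lborel. (\<Sum>k\<le>degree q. (coeff q k * x ^ k) * (y ^ k * gauss_laguerre_kernel \<alpha> \<beta> y)))"
    unfolding poly_times_expand ..
  also have "\<dots> = (\<Sum>k\<le>degree q. LINT y:{0<..<1}|lborel. (coeff q k * x ^ k) * (y ^ k * gauss_laguerre_kernel \<alpha> \<beta> y))"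
    using set_integrable_mult_right[OF kernel_moment(1)]
    unfolding set_lebesgue_integral_def set_integrable_def scaleR_sum_right
    by (intro Bochner_Integration.integral_sum) auto
  finally show ?thesis by (simp only: set_integral_mult_right)
qed

text \<open>The intertwining of the generators: compare coefficients, where \<open>moment_Suc\<close> matches the two weights.\<close>

lemma gauss_laguerre_operator_moment_poly:
  "gauss_laguerre_operator \<alpha> \<beta> (poly (moment_poly p)) = poly (moment_poly (laguerre_poly_operator p))"
proof
  fix x
  define r where "r = moment_poly p"
  define I where "I k = (LINT y:{0<..<1}|lborel. y ^ k * gauss_laguerre_kernel \<alpha> \<beta> y)" for k
  define s where "s = sin (\<alpha> * pi) / pi"
  have I: "s * I k * real (Suc k) = \<phi> (k + 2) - \<phi> 1" for k
    using kernel_moment(2)[of k] by (simp add: s_def I_def)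
  define q where "q = (\<Sum>k\<le>degree r. monom (s * (coeff (pderiv (pderiv r)) k * I k)) k)"
  have cq: "coeff q k = s * (coeff (pderiv (pderiv r)) k * I k)" for k
  proof (cases "k \<le> degree r")
    case False
    then have "coeff (pderiv (pderiv r)) k = 0" by (simp add: coeff_pderiv coeff_eq_0)
    then show ?thesis by (simp add: q_def coeff_sum False)
  qed (simp add: q_def coeff_sum)
  have pq: "poly q x = s * (\<Sum>k\<le>degree (pderiv (pderiv r)). coeff (pderiv (pderiv r)) k * x ^ k * I k)"
  proof -
    have "degree q \<le> degree (pderiv (pderiv r))"
      by (rule degree_le) (auto simp: cq coeff_eq_0)
    from poly_eq_sum[OF this, of x] show ?thesis by (simp add: cq sum_distrib_left mult_ac)
  qed
  have "gauss_laguerre_operator \<alpha> \<beta> (poly r) x = (\<phi> 1 - x) * poly (pderiv r) x + x * poly q x"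
    unfolding gauss_laguerre_operator_def deriv_poly drift_eq kernel_poly_integral pq
    by (simp add: s_def I_def)
  also have "\<dots> = poly (smult (\<phi> 1) (pderiv r) - pCons 0 (pderiv r) + pCons 0 q) x"
    by (simp add: algebra_simps)
  also have "smult (\<phi> 1) (pderiv r) - pCons 0 (pderiv r) + pCons 0 q = moment_poly (laguerre_poly_operator p)"
  proof (rule poly_eqI)
    fix k
    have main: "coeff (smult (\<phi> 1) (pderiv r) - pCons 0 (pderiv r) + pCons 0 q) k = (real k + 1) * \<phi> (Suc k) * coeff r (Suc k) - real k * coeff r k"
    proof (cases k)
      case 0
      then show ?thesis by (simp add: coeff_pderiv)
    next
      case (Suc j)
      have "coeff (pCons 0 q) k = (s * I j * real (Suc j)) * (real k + 1) * coeff r (Suc k)"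
        by (simp add: Suc cq coeff_pderiv mult_ac)
      also have "\<dots> = (\<phi> (Suc k) - \<phi> 1) * (real k + 1) * coeff r (Suc k)"
        unfolding I using Suc by simp
      finally show ?thesis using Suc by (simp add: coeff_pderiv algebra_simps)
    qed
    have "(real k + 1) * \<phi> (Suc k) * coeff r (Suc k) = (real k + 1) * coeff p (Suc k) * (moment (Suc k) * \<phi> (Suc k))"
      by (simp add: r_def coeff_moment_poly)
    then show "coeff (smult (\<phi> 1) (pderiv r) - pCons 0 (pderiv r) + pCons 0 q) k = coeff (moment_poly (laguerre_poly_operator p)) k"
      unfolding main coeff_moment_poly coeff_laguerre_poly_operator moment_Suc
      by (simp add: r_def coeff_moment_poly power2_eq_square algebra_simps)
  qed
  finally show "gauss_laguerre_operator \<alpha> \<beta> (poly (moment_poly p)) x = poly (moment_poly (laguerre_poly_operator p)) x"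
    by (simp add: r_def)
qed

end

section \<open>Intertwining of the semigroups\<close>

text \<open>Linearity is required only almost everywhere, as operators act on representatives.\<close>

definition L2_contraction :: "'a measure \<Rightarrow> 'b measure \<Rightarrow> (('a \<Rightarrow> real) \<Rightarrow> 'b \<Rightarrow> real) \<Rightarrow> bool" where
  "L2_contraction V W T \<longleftrightarrow> (\<forall>f\<in>square_integrable V. T f \<in> square_integrable W) \<and>
    (\<forall>f\<in>square_integrable V. \<forall>g\<in>square_integrable V. \<forall>a b.
      AE x in W. T (\<lambda>x. a * f x + b * g x) x = a * T f x + b * T g x) \<and>
    (\<forall>f\<in>square_integrable V. norm2 W (T f) \<le> norm2 V f)"

lemma L2_contractionD:
  assumes "L2_contraction V W T" "f \<in> square_integrable V"
  shows "T f \<in> square_integrable W" "norm2 W (T f) \<le> norm2 V f"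
  using assms by (auto simp: L2_contraction_def)

lemma L2_contraction_linear:
  assumes "L2_contraction V W T" "f \<in> square_integrable V" "g \<in> square_integrable V"
  shows "AE x in W. T (\<lambda>x. a * f x + b * g x) x = a * T f x + b * T g x"
  using assms by (auto simp: L2_contraction_def)

lemma L2_contraction_diff:
  assumes T: "L2_contraction V W T" and f: "f \<in> square_integrable V" and g: "g \<in> square_integrable V"
  shows "norm2 W (\<lambda>x. T f x - T g x) \<le> norm2 V (\<lambda>x. f x - g x)"
proof -
  have d: "(\<lambda>x. f x - g x) \<in> square_integrable V" by (rule square_integrable_diff[OF f g])
  have "norm2 W (\<lambda>x. T f x - T g x) = norm2 W (T (\<lambda>x. f x - g x))"
  proof (rule norm2_cong_AE)
    show "AE x in W. T f x - T g x = T (\<lambda>x. f x - g x) x"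
      using L2_contraction_linear[OF T f g, of 1 "- 1"] by eventually_elim simp
    note S = L2_contractionD(1)[OF T]
    show "(\<lambda>x. T f x - T g x) \<in> borel_measurable W"
      by (rule square_integrableD(1)[OF square_integrable_diff[OF S[OF f] S[OF g]]])
    show "T (\<lambda>x. f x - g x) \<in> borel_measurable W" by (rule square_integrableD(1)[OF S[OF d]])
  qed
  also have "\<dots> \<le> norm2 V (\<lambda>x. f x - g x)" by (rule L2_contractionD(2)[OF T d])
  finally show ?thesis .
qed

lemma norm2_diff_eq_0_iff:
  assumes f: "f \<in> square_integrable M" and g: "g \<in> square_integrable M"
  shows "norm2 M (\<lambda>x. f x - g x) = 0 \<longleftrightarrow> (AE x in M. f x = g x)"
proof
  assume "norm2 M (\<lambda>x. f x - g x) = 0"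
  from norm2_eq_0_AE[OF square_integrable_diff[OF f g] this] show "AE x in M. f x = g x" by simp
next
  assume "AE x in M. f x = g x"
  then have "AE x in M. f x - g x = 0" by eventually_elim simp
  then have "norm2 M (\<lambda>x. f x - g x) = norm2 M (\<lambda>_. 0)"
    using square_integrableD(1)[OF square_integrable_diff[OF f g]] by (intro norm2_cong_AE) auto
  then show "norm2 M (\<lambda>x. f x - g x) = 0" by (simp add: norm2_def)
qed

lemma L2_contraction_cong_AE:
  assumes T: "L2_contraction V W T" and f: "f \<in> square_integrable V" and g: "g \<in> square_integrable V"
    and eq: "AE x in V. f x = g x"
  shows "AE x in W. T f x = T g x"
proof -
  have "norm2 W (\<lambda>x. T f x - T g x) \<le> 0"
    using L2_contraction_diff[OF T f g] eq norm2_diff_eq_0_iff[OF f g] by simp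
  then have "norm2 W (\<lambda>x. T f x - T g x) = 0" using norm2_nonneg[of W "\<lambda>x. T f x - T g x"] by linarith
  then show ?thesis
    using norm2_diff_eq_0_iff[OF L2_contractionD(1)[OF T f] L2_contractionD(1)[OF T g]] by simp
qed

lemma L2_contraction_comp:
  assumes S: "L2_contraction V U S" and T: "L2_contraction U W T"
  shows "L2_contraction V W (\<lambda>f. T (S f))"
  unfolding L2_contraction_def
proof (intro conjI ballI allI)
  fix f assume f: "f \<in> square_integrable V"
  note Sf = L2_contractionD[OF S f]
  show "T (S f) \<in> square_integrable W" by (rule L2_contractionD(1)[OF T Sf(1)])
  show "norm2 W (T (S f)) \<le> norm2 V f" using L2_contractionD(2)[OF T Sf(1)] Sf(2) by linarith
next
  fix f g a b assume f: "f \<in> square_integrable V" and g: "g \<in> square_integrable V"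
  note Sf = L2_contractionD(1)[OF S f] and Sg = L2_contractionD(1)[OF S g]
  have "AE x in W. T (S (\<lambda>x. a * f x + b * g x)) x = T (\<lambda>x. a * S f x + b * S g x) x"
    by (intro L2_contraction_cong_AE[OF T] L2_contraction_linear[OF S f g] L2_contractionD(1)[OF S]
        square_integrable_add square_integrable_cmult f g Sf Sg)
  with L2_contraction_linear[OF T Sf Sg, of a b]
  show "AE x in W. T (S (\<lambda>x. a * f x + b * g x)) x = a * T (S f) x + b * T (S g) x"
    by eventually_elim simp
qed

lemma L2_contractions_agree_limit:
  assumes A: "L2_contraction V W A" and B: "L2_contraction V W B" and f: "f \<in> square_integrable V"
    and approx: "\<And>\<epsilon>. \<epsilon> > 0 \<Longrightarrow> \<exists>g\<in>square_integrable V. norm2 V (\<lambda>x. f x - g x) < \<epsilon> \<and> (AE x in W. A g x = B g x)"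
  shows "AE x in W. A f x = B f x"
proof -
  note Af = L2_contractionD(1)[OF A f] and Bf = L2_contractionD(1)[OF B f]
  have "norm2 W (\<lambda>x. A f x - B f x) \<le> 0"
  proof (rule field_le_epsilon)
    fix \<epsilon> :: real assume "0 < \<epsilon>"
    then have "\<epsilon> / 2 > 0" by simp
    then obtain g where g: "g \<in> square_integrable V" "norm2 V (\<lambda>x. f x - g x) < \<epsilon> / 2" "AE x in W. A g x = B g x"
      using approx by blast
    note Ag = L2_contractionD(1)[OF A g(1)] and Bg = L2_contractionD(1)[OF B g(1)]
    have "norm2 W (\<lambda>x. A g x - B g x) = 0" using norm2_diff_eq_0_iff[OF Ag Bg] g(3) by simp
    moreover have "norm2 W (\<lambda>x. A f x - A g x) \<le> norm2 V (\<lambda>x. f x - g x)"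
      by (rule L2_contraction_diff[OF A f g(1)])
    moreover have "norm2 W (\<lambda>x. B g x - B f x) \<le> norm2 V (\<lambda>x. f x - g x)"
      using L2_contraction_diff[OF B g(1) f] norm2_minus_commute[of V f g] by simp
    ultimately show "norm2 W (\<lambda>x. A f x - B f x) \<le> 0 + \<epsilon>"
      using norm2_triangle_diff[OF Af Ag Bf] norm2_triangle_diff[OF Ag Bg Bf] g(2) by simp
  qed
  then have "norm2 W (\<lambda>x. A f x - B f x) = 0" using norm2_nonneg[of W "\<lambda>x. A f x - B f x"] by linarith
  then show ?thesis using norm2_diff_eq_0_iff[OF Af Bf] by simp
qed

lemma contraction_semigroup_L2_contraction:
  assumes "contraction_semigroup w P" "t \<ge> 0"
  shows "L2_contraction (weighted w) (weighted w) (P t)"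
  using assms
  unfolding contraction_semigroup_def bounded_L2_operator_def L2_contraction_def
    L2_eq_square_integrable L2_norm_eq_norm2 L2_eq_def by blast

text \<open>A semigroup multiplies an eigenvector of its generator by an exponential: cutting \<open>[0, T]\<close> into
  \<open>n\<close> pieces, the error of each piece is \<open>o (1 / n)\<close> and contractivity lets the errors add up.\<close>

lemma semigroup_eigenvector:
  assumes P: "contraction_semigroup w P" and gen: "L2_generator w P f (\<lambda>x. \<mu> * f x)"
    and \<mu>: "\<mu> \<le> 0" and t: "t \<ge> 0"
  shows "AE x in weighted w. P t f x = exp (\<mu> * t) * f x"
proof -
  define W where "W = weighted w"
  have C: "L2_contraction W W (P s)" if "s \<ge> 0" for s
    unfolding W_def by (rule contraction_semigroup_L2_contraction[OF P that])
  have f: "f \<in> square_integrable W"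
    and lim: "((\<lambda>h. norm2 W (\<lambda>x. (P h f x - f x) / h - \<mu> * f x)) \<longlongrightarrow> 0) (at_right 0)"
    using gen by (simp_all add: L2_generator_def L2_eq_square_integrable L2_norm_eq_norm2 W_def)
  have P_0: "AE x in W. P 0 f x = f x"
    using P f unfolding contraction_semigroup_def L2_eq_square_integrable L2_eq_def W_def by blast
  have P_add: "AE x in W. P (h + s) f x = P h (P s f) x" if "s \<ge> 0" "h \<ge> 0" for s h
    using P f that unfolding contraction_semigroup_def L2_eq_square_integrable L2_eq_def W_def by blast
  have Pf: "P s f \<in> square_integrable W" if "s \<ge> 0" for s by (rule L2_contractionD(1)[OF C[OF that] f])
  have ef: "(\<lambda>x. c * f x) \<in> square_integrable W" for c by (rule square_integrable_cmult[OF f])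
  define err where "err h = norm2 W (\<lambda>x. P h f x - exp (\<mu> * h) * f x)" for h
  have P0: "err 0 = 0"
  proof -
    have "AE x in W. P 0 f x = exp (\<mu> * 0) * f x" using P_0 by simp
    then show ?thesis unfolding err_def by (subst norm2_diff_eq_0_iff[OF Pf ef]) auto
  qed
  \<comment> \<open>pass through \<open>P h (P s f)\<close>, \<open>P h (exp (\<mu> * s) * f)\<close> and \<open>exp (\<mu> * s) * P h f\<close>\<close>
  have step: "err (s + h) \<le> err s + err h" if s: "s \<ge> 0" and h: "h \<ge> 0" for s h
  proof -
    have S1: "P (h + s) f \<in> square_integrable W" using s h by (intro Pf) simp
    have S2: "P h (P s f) \<in> square_integrable W" by (rule L2_contractionD(1)[OF C[OF h] Pf[OF s]])
    have S3: "P h (\<lambda>x. exp (\<mu> * s) * f x) \<in> square_integrable W" by (rule L2_contractionD(1)[OF C[OF h] ef])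
    have S4: "(\<lambda>x. exp (\<mu> * s) * P h f x) \<in> square_integrable W" by (rule square_integrable_cmult[OF Pf[OF h]])
    have "norm2 W (\<lambda>x. P (h + s) f x - P h (P s f) x) = 0"
      using P_add[OF s h] norm2_diff_eq_0_iff[OF S1 S2] by simp
    moreover have "norm2 W (\<lambda>x. P h (P s f) x - P h (\<lambda>x. exp (\<mu> * s) * f x) x) \<le> err s"
      unfolding err_def by (rule L2_contraction_diff[OF C[OF h] Pf[OF s] ef])
    moreover have "norm2 W (\<lambda>x. P h (\<lambda>x. exp (\<mu> * s) * f x) x - exp (\<mu> * s) * P h f x) = 0"
    proof -
      have "AE x in W. P h (\<lambda>x. exp (\<mu> * s) * f x) x = exp (\<mu> * s) * P h f x"
        using L2_contraction_linear[OF C[OF h] f f, of "exp (\<mu> * s)" 0] by simp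
      then show ?thesis
        using norm2_diff_eq_0_iff[OF S3 S4] by simp
    qed
    moreover have "norm2 W (\<lambda>x. exp (\<mu> * s) * P h f x - exp (\<mu> * (s + h)) * f x) \<le> err h"
    proof -
      have "norm2 W (\<lambda>x. exp (\<mu> * s) * P h f x - exp (\<mu> * (s + h)) * f x) = exp (\<mu> * s) * err h"
        using norm2_cmult[of W "exp (\<mu> * s)" "\<lambda>x. P h f x - exp (\<mu> * h) * f x"]
        by (simp add: err_def right_diff_distrib distrib_left exp_add mult.assoc)
      also have "\<dots> \<le> 1 * err h"
        using \<mu> s by (intro mult_right_mono) (auto simp: err_def mult_nonpos_nonneg)
      finally show ?thesis by simp
    qed
    ultimately show ?thesis
      using norm2_triangle_diff[OF S1 S2 ef[of "exp (\<mu> * (s + h))"]] norm2_triangle_diff[OF S2 S3 ef[of "exp (\<mu> * (s + h))"]]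
        norm2_triangle_diff[OF S3 S4 ef[of "exp (\<mu> * (s + h))"]]
      unfolding err_def[of "s + h"] add.commute[of h s] by linarith
  qed
  have multi: "err (real n * h) \<le> real n * err h" if h: "h \<ge> 0" for n h
  proof (induction n)
    case 0
    then show ?case using P0 by simp
  next
    case (Suc n)
    have "err (real (Suc n) * h) = err (real n * h + h)" by (simp add: algebra_simps)
    also have "\<dots> \<le> err (real n * h) + err h" using h by (intro step) auto
    also have "\<dots> \<le> real (Suc n) * err h" using Suc by (simp add: algebra_simps)
    finally show ?case .
  qed
  have small: "((\<lambda>h. err h / h) \<longlongrightarrow> 0) (at_right 0)"
  proof (rule tendsto_sandwich[OF _ _ tendsto_const])
    show "\<forall>\<^sub>F h in at_right 0. 0 \<le> err h / h"
      using eventually_at_right_less[of 0] by eventually_elim (simp add: err_def)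
    have "((\<lambda>h. (exp (\<mu> * h) - 1) / h) \<longlongrightarrow> \<mu>) (at_right 0)"
    proof -
      have "((\<lambda>h. exp (\<mu> * h)) has_real_derivative \<mu>) (at 0)"
        by (auto intro!: derivative_eq_intros)
      then have "((\<lambda>h. (exp (\<mu> * h) - exp (\<mu> * 0)) / (h - 0)) \<longlongrightarrow> \<mu>) (at 0)"
        by (simp add: has_field_derivative_iff)
      then show ?thesis by (simp add: filterlim_at_split)
    qed
    then have "((\<lambda>h. norm2 W (\<lambda>x. (P h f x - f x) / h - \<mu> * f x) + \<bar>\<mu> - (exp (\<mu> * h) - 1) / h\<bar> * norm2 W f)
      \<longlongrightarrow> 0 + \<bar>\<mu> - \<mu>\<bar> * norm2 W f) (at_right 0)"
      by (intro tendsto_intros lim)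
    then show "((\<lambda>h. norm2 W (\<lambda>x. (P h f x - f x) / h - \<mu> * f x) + \<bar>\<mu> - (exp (\<mu> * h) - 1) / h\<bar> * norm2 W f) \<longlongrightarrow> 0) (at_right 0)"
      by simp
    show "\<forall>\<^sub>F h in at_right 0. err h / h \<le> norm2 W (\<lambda>x. (P h f x - f x) / h - \<mu> * f x) + \<bar>\<mu> - (exp (\<mu> * h) - 1) / h\<bar> * norm2 W f"
      using eventually_at_right_less[of 0]
    proof eventually_elim
      case (elim h)
      have q: "(\<lambda>x. (P h f x - f x) / h - \<mu> * f x) \<in> square_integrable W"
      proof -
        have "(\<lambda>x. 1 / h * (P h f x - f x) - \<mu> * f x) \<in> square_integrable W"
          using elim by (intro square_integrable_diff square_integrable_cmult Pf f) simp
        then show ?thesis by simp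
      qed
      have "err h / h = norm2 W (\<lambda>x. 1 / h * (P h f x - exp (\<mu> * h) * f x))"
        using elim by (subst norm2_cmult) (simp add: err_def)
      also have "\<dots> = norm2 W (\<lambda>x. ((P h f x - f x) / h - \<mu> * f x) + (\<mu> - (exp (\<mu> * h) - 1) / h) * f x)"
        using elim by (intro arg_cong[where f = "norm2 W"] ext) (simp add: field_simps)
      also have "\<dots> \<le> norm2 W (\<lambda>x. (P h f x - f x) / h - \<mu> * f x) + norm2 W (\<lambda>x. (\<mu> - (exp (\<mu> * h) - 1) / h) * f x)"
        by (rule norm2_triangle[OF q ef])
      finally show ?case by (simp only: norm2_cmult)
    qed
  qed
  have "err t \<le> 0"
  proof (cases "t = 0")
    case False
    then have tpos: "t > 0" using t by simp
    have "filterlim (\<lambda>n. t / real (Suc n)) (at_right 0) sequentially"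
      unfolding filterlim_at_right_to_0 filterlim_at
    proof
      show "((\<lambda>n. t / real (Suc n)) \<longlongrightarrow> 0) sequentially"
        by (rule tendsto_divide_0[OF tendsto_const]) (intro filterlim_at_top_imp_at_infinity filterlim_compose[OF filterlim_real_sequentially filterlim_Suc])
    qed (use tpos in simp)
    from filterlim_compose[OF small this]
    have "(\<lambda>n. t * (err (t / real (Suc n)) / (t / real (Suc n)))) \<longlonglongrightarrow> t * 0"
      by (intro tendsto_intros)
    moreover have "err t \<le> t * (err (t / real (Suc n)) / (t / real (Suc n)))" for n
      using multi[of "t / real (Suc n)" "Suc n"] tpos by (simp add: mult.commute)
    ultimately show ?thesis by (intro LIMSEQ_le_const[where a = "err t"]) auto
  qed (simp add: P0)
  then have "err t = 0" by (simp add: err_def order_antisym)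
  then show ?thesis
    unfolding err_def W_def[symmetric] by (subst (asm) norm2_diff_eq_0_iff[OF Pf[OF t] ef])
qed

context gauss_laguerre
begin

lemma Lam_L2_contraction: "L2_contraction (E 1) M Lam"
  unfolding L2_contraction_def using Lam_contraction Lam_linear by blast

text \<open>By linearity it suffices to take a Laguerre polynomial. Both sides then equal the same exponential times
  its image under the operator.\<close>

lemma Lam_intertwines_poly:
  assumes P: "gauss_laguerre_semigroup \<alpha> \<beta> P" and Q: "laguerre_semigroup Q" and t: "t \<ge> 0"
  shows "AE x in M. P t (Lam (poly p)) x = Lam (Q t (poly p)) x"
proof -
  have CP: "L2_contraction M M (P t)"
    using contraction_semigroup_L2_contraction[of ew P t] P t by (simp add: gauss_laguerre_semigroup_def M_def)
  have CQ: "L2_contraction (E 1) (E 1) (Q t)"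
    using contraction_semigroup_L2_contraction[of laguerre_weight Q t] Q t
    by (simp add: laguerre_semigroup_def laguerre_eq_E)
  define A B where "A f = P t (Lam f)" and "B f = Lam (Q t f)" for f
  have A: "L2_contraction (E 1) M A" unfolding A_def by (rule L2_contraction_comp[OF Lam_L2_contraction CP])
  have B: "L2_contraction (E 1) M B" unfolding B_def by (rule L2_contraction_comp[OF CQ Lam_L2_contraction])
  note polyE = poly_square_integrable_E
  have "AE x in M. A (poly p) x = B (poly p) x"
  proof (induction p rule: poly_laguerre_induct)
    case (1 c p)
    have eq: "(\<lambda>x. c * poly p x + 0 * poly p x) = poly (smult c p)" by auto
    from L2_contraction_linear[OF A polyE polyE, of c p 0 p, unfolded eq] L2_contraction_linear[OF B polyE polyE, of c p 0 p, unfolded eq]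
    show ?case using 1 by eventually_elim (simp only:)
  next
    case (2 p q)
    have eq: "(\<lambda>x. 1 * poly p x + 1 * poly q x) = poly (p + q)" by auto
    from L2_contraction_linear[OF A polyE polyE, of 1 p 1 q, unfolded eq] L2_contraction_linear[OF B polyE polyE, of 1 p 1 q, unfolded eq]
    show ?case using 2 by eventually_elim (simp only:)
  next
    case (3 n)
    define l where "l = laguerre_poly n"
    have "L2_generator laguerre_weight Q (poly l) (laguerre_operator (poly l))"
      using Q by (simp add: laguerre_semigroup_def generated_on_polynomials_def polynomial_functions_def)
    moreover have "laguerre_operator (poly l) = (\<lambda>x. - real n * poly l x)"
      unfolding laguerre_operator_poly l_def laguerre_poly_eigen by (rule ext) simp
    ultimately have "L2_generator laguerre_weight Q (poly l) (\<lambda>x. - real n * poly l x)" by simp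
    from semigroup_eigenvector[OF _ this _ t]
    have Ql: "AE x in E 1. Q t (poly l) x = exp (- real n * t) * poly l x"
      using Q unfolding laguerre_eq_E by (simp add: laguerre_semigroup_def)
    have "L2_generator ew P (poly (moment_poly l)) (gauss_laguerre_operator \<alpha> \<beta> (poly (moment_poly l)))"
      using P by (simp add: gauss_laguerre_semigroup_def generated_on_polynomials_def polynomial_functions_def)
    moreover have "gauss_laguerre_operator \<alpha> \<beta> (poly (moment_poly l)) = (\<lambda>x. - real n * poly (moment_poly l) x)"
      unfolding gauss_laguerre_operator_moment_poly l_def laguerre_poly_eigen moment_poly_smult by (rule ext) simp
    ultimately have "L2_generator ew P (poly (moment_poly l)) (\<lambda>x. - real n * poly (moment_poly l) x)" by simp
    from semigroup_eigenvector[OF _ this _ t]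
    have Al: "AE x in M. A (poly l) x = exp (- real n * t) * poly (moment_poly l) x"
      using P unfolding M_def by (simp add: gauss_laguerre_semigroup_def A_def Lam_poly)
    have "AE x in M. B (poly l) x = Lam (\<lambda>x. exp (- real n * t) * poly l x) x"
      unfolding B_def
      by (intro L2_contraction_cong_AE[OF Lam_L2_contraction _ _ Ql] L2_contractionD(1)[OF CQ] polyE square_integrable_cmult)
    moreover have "(\<lambda>x. exp (- real n * t) * poly l x) = poly (smult (exp (- real n * t)) l)" by auto
    ultimately have "AE x in M. B (poly l) x = exp (- real n * t) * poly (moment_poly l) x"
      by (simp add: Lam_poly moment_poly_smult)
    with Al show ?case unfolding l_def[symmetric] by eventually_elim simp
  qed
  then show ?thesis by (simp add: A_def B_def)
qed

lemma Lam_intertwines: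
  assumes P: "gauss_laguerre_semigroup \<alpha> \<beta> P" and Q: "laguerre_semigroup Q" and t: "t \<ge> 0"
    and f: "f \<in> square_integrable (E 1)"
  shows "AE x in M. P t (Lam f) x = Lam (Q t f) x"
proof (rule L2_contractions_agree_limit[where A = "\<lambda>f. P t (Lam f)" and B = "\<lambda>f. Lam (Q t f)", OF _ _ f])
  show "L2_contraction (E 1) M (\<lambda>f. P t (Lam f))"
    using contraction_semigroup_L2_contraction[of ew P t] P t
    by (intro L2_contraction_comp[OF Lam_L2_contraction]) (simp add: gauss_laguerre_semigroup_def M_def)
  show "L2_contraction (E 1) M (\<lambda>f. Lam (Q t f))"
    using contraction_semigroup_L2_contraction[of laguerre_weight Q t] Q t
    by (intro L2_contraction_comp[OF _ Lam_L2_contraction]) (simp add: laguerre_semigroup_def laguerre_eq_E)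
  fix \<epsilon> :: real assume "\<epsilon> > 0"
  then obtain p where "norm2 (E 1) (\<lambda>x. f x - poly p x) < \<epsilon>" by (rule polynomials_dense_E[OF f])
  then show "\<exists>g\<in>square_integrable (E 1). norm2 (E 1) (\<lambda>x. f x - g x) < \<epsilon> \<and> (AE x in M. P t (Lam g) x = Lam (Q t g) x)"
    using poly_square_integrable_E Lam_intertwines_poly[OF P Q t] by blast
qed

lemma Lam_markov: "markov_operator dens Lam"
  unfolding markov_operator_def
proof (intro conjI ballI allI impI)
  show "dens \<in> borel_measurable (restrict_space borel {0<..})"
    by (rule measurable_restrict_space1) (rule borel_measurable_lambda)
  show "prob_space (weighted dens)" using prob_space_N by (simp add: N_def)
qed (auto simp: lambda_nonneg gauss_laguerre_Lambda_def)

lemma Lam_bounded: "bounded_L2_operator laguerre_weight ew Lam"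
  unfolding bounded_L2_operator_def L2_eq norm2_eq L2_eq_def M_def[symmetric]
proof (intro conjI ballI allI exI[of _ 1])
  show "norm2 M (Lam f) \<le> 1 * norm2 (E 1) f" if "f \<in> square_integrable (E 1)" for f
    using Lam_contraction(2)[OF that] by simp
qed (auto intro: Lam_contraction Lam_linear)

lemma Lam_one_to_one: "L2_one_to_one laguerre_weight ew Lam"
  unfolding L2_one_to_one_def L2_eq L2_eq_def M_def[symmetric] laguerre_eq_E
proof (intro ballI impI)
  fix f g assume f: "f \<in> square_integrable (E 1)" and g: "g \<in> square_integrable (E 1)" and eq: "AE x in M. Lam f x = Lam g x"
  have "AE x in M. Lam (\<lambda>x. 1 * f x + - 1 * g x) x = 0"
    using Lam_linear[OF f g, of 1 "- 1"] eq by eventually_elim simp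
  then have "AE x in M. Lam (\<lambda>x. f x - g x) x = 0" by simp
  from Lam_injective[OF square_integrable_diff[OF f g] this] show "AE x in E 1. f x = g x" by simp
qed

lemma Lam_dense_range: "L2_closure ew (Lam ` L2 laguerre_weight) = L2 ew"
proof
  show "L2 ew \<subseteq> L2_closure ew (Lam ` L2 laguerre_weight)"
    unfolding L2_closure_def L2_eq norm2_eq
  proof (intro subsetI CollectI conjI allI impI)
    fix g and \<epsilon> :: real assume g: "g \<in> square_integrable M" and "\<epsilon> > 0"
    then obtain q where q: "norm2 M (\<lambda>x. g x - poly q x) < \<epsilon>" by (elim polynomials_dense_M)
    obtain p where "moment_poly p = q" using moment_poly_surj by blast
    then have "poly q = Lam (poly p)" by (simp add: Lam_poly)
    then show "\<exists>h\<in>Lam ` square_integrable (E 1). norm2 M (\<lambda>x. g x - h x) < \<epsilon>"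
      using q poly_square_integrable_E by (intro bexI[of _ "poly q"]) auto
  qed
qed (auto simp: L2_closure_def)

end

theorem theorem1p2:
  fixes \<alpha> \<beta> :: real
  assumes "0 < \<alpha>" and "\<alpha> < 1" and "1 - 1 / \<alpha> \<le> \<beta>"
  shows "markov_operator (gauss_laguerre_lambda \<alpha> \<beta>) (gauss_laguerre_Lambda \<alpha> \<beta>) \<and>
    (\<forall>f\<in>L2 laguerre_weight. AE x in weighted (gauss_laguerre_weight \<alpha> \<beta>).
       set_integrable lborel {0<..} (\<lambda>y. f (x * y) * gauss_laguerre_lambda \<alpha> \<beta> y)) \<and>
    bounded_L2_operator laguerre_weight (gauss_laguerre_weight \<alpha> \<beta>) (gauss_laguerre_Lambda \<alpha> \<beta>) \<and>
    L2_one_to_one laguerre_weight (gauss_laguerre_weight \<alpha> \<beta>) (gauss_laguerre_Lambda \<alpha> \<beta>) \<and>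
    L2_closure (gauss_laguerre_weight \<alpha> \<beta>) (gauss_laguerre_Lambda \<alpha> \<beta> ` L2 laguerre_weight) =
      L2 (gauss_laguerre_weight \<alpha> \<beta>) \<and>
    (\<forall>P Q. gauss_laguerre_semigroup \<alpha> \<beta> P \<longrightarrow> laguerre_semigroup Q \<longrightarrow>
       (\<forall>t\<ge>0. \<forall>f\<in>L2 laguerre_weight.
          L2_eq (gauss_laguerre_weight \<alpha> \<beta>)
            (P t (gauss_laguerre_Lambda \<alpha> \<beta> f)) (gauss_laguerre_Lambda \<alpha> \<beta> (Q t f))))"
proof -
  interpret gauss_laguerre \<alpha> \<beta> using assms by unfold_locales
  show ?thesis
    using Lam_markov AE_set_integrable_section Lam_bounded Lam_one_to_one Lam_dense_range Lam_intertwines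
    unfolding L2_eq(1) L2_eq_def M_def[symmetric] by blast
qed

end
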